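(* Let $\alpha>0$, $1\le q\le\infty$, and let $r\in\mathbb N$ with $r>\alpha$. Then the norm of $\mathbf B^{\alpha}_q=(\mathbf H,\mathbf H^{r})^K_{\alpha/r,q}$ is equivalent to $$f\mapsto\|f\|_{\mathbf H}+\Big(\sum_{j=0}^{\infty}\big(2^{j\alpha}\,\mathcal E_\Delta(2^{j},f)\big)^q\Big)^{1/q}$$ (with the supremum over $j$ when $q=\infty$).
   Context: Let $G=\mathbb R_+\times\mathbb R$ be the "$ax+b$" group with multiplication $(a_1,b_1)(a_2,b_2)=(a_1a_2,\,a_1b_2+b_1)$. Let $T$ be a strongly continuous unitary representation of $G$ in a Hilbert space $\mathbf H$. Put $T_1(t)=T(e^{t},0)$, $T_2(t)=T(1,t)$, with generators $\mathbb A_1,\mathbb A_2$. For $r\in\mathbb N$, $\mathbf H^{r}$ is the space of $f\in\mathbf H$ for which all products $\mathbb A_{j_1}\cdots\mathbb A_{j_k}f$, $1\le k\le r$, $j_i\in\{1,2\}$, are defined, with norm $\|f\|_{\mathbf H}+\sum_{k=1}^r\sum_{(j_1,\dots,j_k)\in\{1,2\}^k}\|\mathbb A_{j_1}\cdots\mathbb A_{j_k}f\|_{\mathbf H}$. $\Delta$ is the self-adjoint non-negative closure of $-\mathbb A_1^2-\mathbb A_2^2$ from the Gårding space. $\mathbf{PW}_\omega(\Delta^{1/2})$ is the range of the spectral projection $\mathbf 1_{[0,\omega]}(\Delta^{1/2})$, and $\mathcal E_\Delta(\sigma,f)=\inf_{g\in\mathbf{PW}_\sigma(\Delta^{1/2})}\|f-g\|_{\mathbf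 H}$. $K(t,f,\mathbf H,\mathbf H^r)=\inf\{\|f_0\|_{\mathbf H}+t\|f_1\|_{\mathbf H^r}: f=f_0+f_1\}$, and $\mathbf B^\alpha_q=(\mathbf H,\mathbf H^r)^K_{\alpha/r,q}$ is the set of $f\in\mathbf H$ with finite norm $\|f\|_{\mathbf H}+\big(\int_0^\infty(s^{-\alpha}K(s^r,f,\mathbf H,\mathbf H^r))^q\frac{ds}{s}\big)^{1/q}$ (usual modification for $q=\infty$). *)

theory Defs
  imports "HOL-Analysis.Analysis"
begin

definition axb_mult :: "real \<times> real \<Rightarrow> real \<times> real \<Rightarrow> real \<times> real" where
  "axb_mult p q = (fst p * fst q, fst p * snd q + snd p)"

definition axb_G :: "(real \<times> real) set" where
  "axb_G = {p. fst p > 0}"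

definition unitary_rep :: "(real \<times> real \<Rightarrow> 'h::{real_inner,complete_space} \<Rightarrow> 'h) \<Rightarrow> bool" where
  "unitary_rep T \<longleftrightarrow>
     (\<forall>p\<in>axb_G. linear (T p) \<and> (\<forall>x. norm (T p x) = norm x) \<and> surj (T p)) \<and>
     T (1, 0) = id \<and>
     (\<forall>p\<in>axb_G. \<forall>q\<in>axb_G. T (axb_mult p q) = T p \<circ> T q) \<and>
     (\<forall>x. continuous_on axb_G (\<lambda>p. T p x))"

definition one_param :: "(real \<times> real \<Rightarrow> 'h \<Rightarrow> 'h) \<Rightarrow> nat \<Rightarrow> real \<Rightarrow> 'h \<Rightarrow> 'h" where
  "one_param T j t = (if j = 1 then T (exp t, 0) else T (1, t))"

definition gen :: "(real \<times> real \<Rightarrow> 'h::real_normed_vector \<Rightarrow> 'h) \<Rightarrow> nat \<Rightarrow> 'h \<Rightarrow> 'h option" where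
  "gen T j f =
     (if \<exists>g. ((\<lambda>t. one_param T j t f) has_vector_derivative g) (at 0)
      then Some (THE g. ((\<lambda>t. one_param T j t f) has_vector_derivative g) (at 0))
      else None)"

primrec appl :: "(real \<times> real \<Rightarrow> 'h::real_normed_vector \<Rightarrow> 'h) \<Rightarrow> nat list \<Rightarrow> 'h \<Rightarrow> 'h option" where
  "appl T [] f = Some f"
| "appl T (j # js) f = Option.bind (appl T js f) (gen T j)"

definition idx_lists :: "nat \<Rightarrow> nat list set" where
  "idx_lists k = {js. length js = k \<and> set js \<subseteq> {1, 2}}"

definition in_Hr :: "(real \<times> real \<Rightarrow> 'h::real_normed_vector \<Rightarrow> 'h) \<Rightarrow> nat \<Rightarrow> 'h \<Rightarrow> bool" where
  "in_Hr T r f \<longleftrightarrow> (\<forall>k\<in>{1..r}. \<forall>js\<in>idx_lists k. appl T js f \<noteq> None)"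

definition Hr_norm :: "(real \<times> real \<Rightarrow> 'h::real_normed_vector \<Rightarrow> 'h) \<Rightarrow> nat \<Rightarrow> 'h \<Rightarrow> real" where
  "Hr_norm T r f = norm f + (\<Sum>k=1..r. \<Sum>js\<in>idx_lists k. norm (the (appl T js f)))"

definition K_fun :: "(real \<times> real \<Rightarrow> 'h::real_normed_vector \<Rightarrow> 'h) \<Rightarrow> nat \<Rightarrow> real \<Rightarrow> 'h \<Rightarrow> real" where
  "K_fun T r t f = Inf {norm f0 + t * Hr_norm T r f1 | f0 f1. in_Hr T r f1 \<and> f = f0 + f1}"

definition root_enn :: "ennreal \<Rightarrow> real \<Rightarrow> ennreal" where
  "root_enn I p = (if I = \<infinity> then \<infinity> else ennreal (enn2real I powr (1 / p)))"

text \<open>Norm of B^alpha_q = (H,H^r)^K_{alpha/r,q}; value \<infinity> means f is not in the space.\<close>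
definition besov_norm :: "(real \<times> real \<Rightarrow> 'h::real_normed_vector \<Rightarrow> 'h) \<Rightarrow> nat \<Rightarrow> real \<Rightarrow> ennreal \<Rightarrow> 'h \<Rightarrow> ennreal" where
  "besov_norm T r \<alpha> q f = ennreal (norm f) +
     (if q = \<infinity> then (SUP s\<in>{0<..}. ennreal (s powr (-\<alpha>) * K_fun T r (s ^ r) f))
      else root_enn
        (\<integral>\<^sup>+ s. indicator {0<..} s * ennreal ((s powr (-\<alpha>) * K_fun T r (s ^ r) f) powr enn2real q / s) \<partial>lborel)
        (enn2real q))"

definition is_pvm :: "(real set \<Rightarrow> 'h::{real_inner,complete_space} \<Rightarrow> 'h) \<Rightarrow> bool" where
  "is_pvm E \<longleftrightarrow>
     (\<forall>B\<in>sets borel. bounded_linear (E B) \<and> (\<forall>x y. inner (E B x) y = inner x (E B y)) \<and> E B \<circ> E B = E B) \<and>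
     E UNIV = id \<and>
     (\<forall>A\<in>sets borel. \<forall>B\<in>sets borel. E (A \<inter> B) = E A \<circ> E B) \<and>
     (\<forall>x. measure_space UNIV (sets borel) (\<lambda>B. ennreal (inner (E B x) x)))"

definition spec_meas :: "(real set \<Rightarrow> 'h::real_inner \<Rightarrow> 'h) \<Rightarrow> 'h \<Rightarrow> real measure" where
  "spec_meas E x = measure_of UNIV (sets borel) (\<lambda>B. ennreal (inner (E B x) x))"

text \<open>Graph of the self-adjoint operator \<integral> \<lambda> dE(\<lambda>):
  f is in the domain iff \<integral> \<lambda>^2 d<E f,f> < \<infinity>, and g is its image iff
  <g, E[-n,n] h> = \<integral>_{[-n,n]} \<lambda> d<E(\<lambda>) f, h> for all h and n (polarization).\<close>
definition pvm_op_graph :: "(real set \<Rightarrow> 'h::real_inner \<Rightarrow> 'h) \<Rightarrow> ('h \<times> 'h) set" where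
  "pvm_op_graph E = {(f, g). integrable (spec_meas E f) (\<lambda>l. l ^ 2) \<and>
     (\<forall>h. \<forall>n::nat. inner g (E {- real n .. real n} h) =
        ((\<integral>l. indicator {- real n .. real n} l * l \<partial>spec_meas E (f + h))
         - (\<integral>l. indicator {- real n .. real n} l * l \<partial>spec_meas E (f - h))) / 4)}"

fun iter_dd :: "(real \<times> real \<Rightarrow> real) \<Rightarrow> (real \<times> real) list \<Rightarrow> real \<times> real \<Rightarrow> real" where
  "iter_dd \<phi> [] = \<phi>"
| "iter_dd \<phi> (v # vs) = (\<lambda>x. frechet_derivative (iter_dd \<phi> vs) (at x) v)"

definition smooth_on_R2 :: "(real \<times> real) set \<Rightarrow> (real \<times> real \<Rightarrow> real) \<Rightarrow> bool" where
  "smooth_on_R2 U \<phi> \<longleftrightarrow> (\<forall>vs. \<forall>x\<in>U. iter_dd \<phi> vs differentiable (at x))"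

definition test_fun :: "(real \<times> real \<Rightarrow> real) \<Rightarrow> bool" where
  "test_fun \<phi> \<longleftrightarrow> smooth_on_R2 axb_G \<phi> \<and>
     (\<exists>K. compact K \<and> K \<subseteq> axb_G \<and> (\<forall>p. p \<notin> K \<longrightarrow> \<phi> p = 0))"

text \<open>T(\<phi>) f = \<integral>_G \<phi>(g) T(g) f dg. The Haar density 1/a^2 is absorbed into \<phi>
  (\<phi> \<mapsto> \<phi>/a^2 is a bijection of C_c^\<infinity>(G)), so Lebesgue measure da db is used.\<close>
definition garding_vec :: "(real \<times> real \<Rightarrow> 'h::real_normed_vector \<Rightarrow> 'h) \<Rightarrow> (real \<times> real \<Rightarrow> real) \<Rightarrow> 'h \<Rightarrow> 'h" where
  "garding_vec T \<phi> f = integral UNIV (\<lambda>p. \<phi> p *\<^sub>R T p f)"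

definition garding_space :: "(real \<times> real \<Rightarrow> 'h::real_normed_vector \<Rightarrow> 'h) \<Rightarrow> 'h set" where
  "garding_space T = span {garding_vec T \<phi> f | \<phi> f. test_fun \<phi>}"

definition lap_graph :: "(real \<times> real \<Rightarrow> 'h::real_normed_vector \<Rightarrow> 'h) \<Rightarrow> ('h \<times> 'h) set" where
  "lap_graph T = {(f, - the (appl T [1, 1] f) - the (appl T [2, 2] f)) | f. f \<in> garding_space T}"

text \<open>Best approximation by Paley-Wiener vectors: PW_\<sigma>(\<Delta>^{1/2}) = range 1_{[0,\<sigma>]}(\<Delta>^{1/2})
  = range E([0,\<sigma>^2]) where E is the spectral measure of \<Delta>.\<close>
definition best_approx :: "(real set \<Rightarrow> 'h::real_normed_vector \<Rightarrow> 'h) \<Rightarrow> real \<Rightarrow> 'h \<Rightarrow> real" where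
  "best_approx E \<sigma> f = infdist f (range (E {0 .. \<sigma> ^ 2}))"

definition approx_norm :: "(real set \<Rightarrow> 'h::real_normed_vector \<Rightarrow> 'h) \<Rightarrow> real \<Rightarrow> ennreal \<Rightarrow> 'h \<Rightarrow> ennreal" where
  "approx_norm E \<alpha> q f = ennreal (norm f) +
     (if q = \<infinity> then (SUP j::nat. ennreal (2 powr (real j * \<alpha>) * best_approx E (2 ^ j) f))
      else root_enn (\<Sum>j. ennreal ((2 powr (real j * \<alpha>) * best_approx E (2 ^ j) f) powr enn2real q))
             (enn2real q))"

end

theory Submission
  imports Defs
begin

text \<open>
  By the usual real interpolation argument it suffices to have a Jackson inequality
  \<open>\<sigma>\<^sup>r dist(f, PW\<^sub>\<sigma>) \<le> C \<parallel>f\<parallel>\<close> (norm of \<open>H\<^sup>r\<close> on the right) and a Bernstein inequality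
  \<open>\<parallel>f\<parallel> \<le> C \<sigma>\<^sup>r \<parallel>f\<parallel>\<close> (norm of \<open>H\<^sup>r\<close> on the left) on \<open>PW\<^sub>\<sigma>\<close>; both are proved by induction on \<open>r\<close> in
  steps of two, each step costing one application of \<open>\<Delta>\<close>, with the cases \<open>r = 0, 1\<close> as base.

  Jackson only needs that \<open>\<Delta> = - A\<^sub>1\<^sup>2 - A\<^sub>2\<^sup>2\<close> on \<open>H\<^sup>2\<close>, which follows from self-adjointness because the
  \<open>A\<^sub>j\<close> are skew.  Bernstein is elliptic regularity: the commutation relation \<open>[A\<^sub>1, A\<^sub>2] = A\<^sub>2\<close> gives
  \<open>\<parallel>A\<^sub>i A\<^sub>j v\<parallel> \<le> \<parallel>\<Delta> v\<parallel> + \<parallel>v\<parallel>\<close> on Garding vectors, hence \<open>dom \<Delta> \<subseteq> H\<^sup>2\<close>; and if \<open>\<Delta> u = g\<close>, then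
  \<open>\<Delta> (A\<^sub>j u) = A\<^sub>j g + [\<Delta>, A\<^sub>j] u\<close> holds weakly against Garding vectors, so by essential
  self-adjointness \<open>A\<^sub>j u \<in> dom \<Delta>\<close> and the regularity can be iterated.
\<close>

subsection \<open>One-parameter unitary groups\<close>

text \<open>\<open>E\<close> is only known to be a projection-valued measure whose operator is the
  closure of the Garding Laplacian. That its spectrum is nonnegative, and hence that the error of
  best approximation is the norm of a spectral tail, comes from the energy identity <Delta u, u> =
  |A_1 u|^2 + |A_2 u|^2. The square root of Delta is never formed: ranges are cut at \<sigma>^2 in
  the spectrum of Delta, and for odd r the half power enters only through the same energy identity.

  The interpolation runs on dyadic frequencies. Summing Bernstein over the blocks between 2^i and
  2^(i+1) bounds 2^(j \<alpha>) K(2^(-j r), f), up to a term with |f|, by the convolution of the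
  weighted errors at 2^i with the kernel \<theta>^(j-i), where \<theta> = 2^(\<alpha> - r). The
  condition \<alpha> < r gives \<theta> < 1 and so a Hardy inequality; \<alpha> > 0 makes the range
  s > 1 of the integral cost only a multiple of |f|.\<close>

lemma vector_difference_quotient:
  assumes "(F has_vector_derivative g) (at 0)"
  shows "((\<lambda>t. (1 / t) *\<^sub>R (F t - F 0)) \<longlongrightarrow> g) (at 0)"
proof -
  have "((\<lambda>t. norm (F t - F 0 - t *\<^sub>R g) / norm t) \<longlongrightarrow> 0) (at 0)"
    using assms unfolding has_vector_derivative_def has_derivative_at by simp
  moreover have "norm (F t - F 0 - t *\<^sub>R g) / norm t = norm ((1 / t) *\<^sub>R (F t - F 0) - g)"
    if "t \<noteq> 0" for t
  proof -
    have "(1 / t) *\<^sub>R (F t - F 0) - g = (1 / t) *\<^sub>R (F t - F 0 - t *\<^sub>R g)"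
      using that by (simp add: algebra_simps)
    then show ?thesis by simp
  qed
  ultimately have "((\<lambda>t. norm ((1 / t) *\<^sub>R (F t - F 0) - g)) \<longlongrightarrow> 0) (at 0)"
    by (metis (no_types, lifting) LIM_equal)
  then show ?thesis
    by (metis Lim_null tendsto_norm_zero_iff)
qed

locale unitary_group =
  fixes U :: "real \<Rightarrow> 'h::{real_inner,complete_space} \<Rightarrow> 'h"
  assumes linear_U: "linear (U t)"
    and norm_U [simp]: "norm (U t x) = norm x"
    and U_0 [simp]: "U 0 x = x"
    and U_add: "U (s + t) x = U s (U t x)"
    and continuous_U: "continuous_on UNIV (\<lambda>t. U t x)"
begin

definition D :: "'h \<Rightarrow> 'h \<Rightarrow> bool" where
  "D f g \<longleftrightarrow> ((\<lambda>t. U t f) has_vector_derivative g) (at 0)"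

lemma bounded_linear_U: "bounded_linear (U t)"
  using linear_U by (intro bounded_linear_intro[of _ 1]) (auto simp: linear_add linear_scale)

lemmas U_diff = linear_diff[OF linear_U] and U_scaleR = linear_scale[OF linear_U]
  and U_plus = linear_add[OF linear_U]

lemma inner_U: "inner (U t x) (U t y) = inner x y"
  using norm_U[of t "x + y"] norm_U[of t x] norm_U[of t y]
  by (simp add: U_plus norm_eq_sqrt_inner inner_add_left inner_add_right inner_commute)

lemma inner_U_minus: "inner (U t x) y = inner x (U (- t) y)"
  using inner_U[of t x "U (- t) y"] U_add[of t "- t" y] by simp

lemma D_unique: "D f g \<Longrightarrow> D f g' \<Longrightarrow> g = g'"
  unfolding D_def by (rule vector_derivative_unique_at)

lemma D_add: "D f g \<Longrightarrow> D f' g' \<Longrightarrow> D (f + f') (g + g')"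
  unfolding D_def U_plus by (rule has_vector_derivative_add)

lemma D_scaleR: "D f g \<Longrightarrow> D (c *\<^sub>R f) (c *\<^sub>R g)"
  unfolding D_def U_scaleR
  by (rule bounded_linear.has_vector_derivative[OF bounded_linear_scaleR_right])

lemma D_diff: "D f g \<Longrightarrow> D f' g' \<Longrightarrow> D (f - f') (g - g')"
  unfolding D_def U_diff by (rule has_vector_derivative_diff)

lemma D_zero: "D 0 0"
  using D_scaleR[of _ _ 0] unfolding D_def by (simp add: linear_0[OF linear_U])

lemma has_vector_derivative_U:
  assumes "D f g"
  shows "((\<lambda>t. U t f) has_vector_derivative U t g) (at t)"
proof -
  have "((\<lambda>s. U t (U s f)) has_vector_derivative U t g) (at 0)"
    using assms unfolding D_def
    by (rule bounded_linear.has_vector_derivative[OF bounded_linear_U])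
  then have "((\<lambda>s. U (t + s) f) has_vector_derivative U t g) (at (t - t))"
    by (simp add: U_add)
  moreover have "((\<lambda>x. x - t) has_vector_derivative 1) (at t)"
    by (auto intro!: derivative_eq_intros)
  ultimately show ?thesis
    using vector_diff_chain_at[of "\<lambda>x. x - t" 1 t "\<lambda>s. U (t + s) f" "U t g"] by (simp add: o_def)
qed

lemma D_skew:
  assumes "D f g" "D f' g'"
  shows "inner g f' = - inner f g'"
proof -
  have "((\<lambda>t. inner (U t f) (U t f')) has_vector_derivative
      (inner (U 0 f) g' + inner g (U 0 f'))) (at 0)"
    using assms unfolding D_def
    by (rule bounded_bilinear.has_vector_derivative[OF bounded_bilinear_inner])
  moreover have "((\<lambda>t. inner (U t f) (U t f')) has_vector_derivative 0) (at 0)"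
    by (simp add: inner_U)
  ultimately have "inner f g' + inner g f' = 0"
    by (metis U_0 vector_derivative_unique_at)
  then show ?thesis by simp
qed

section \<open>Closedness and weak characterization of a generator\<close>

lemma D_from_quotient_bound:
  assumes "\<And>\<epsilon>. \<epsilon> > 0 \<Longrightarrow> \<exists>\<delta>>0. \<forall>t. \<bar>t\<bar> < \<delta> \<longrightarrow> norm (U t f - f - t *\<^sub>R g) \<le> \<epsilon> * \<bar>t\<bar>"
  shows "D f g"
  unfolding D_def has_vector_derivative_def has_derivative_at_alt
  using assms bounded_linear_scaleR_left by auto

lemma U_near:
  assumes "\<epsilon> > 0"
  shows "\<exists>\<delta>>0. \<forall>t. \<bar>t\<bar> < \<delta> \<longrightarrow> norm (U t g - g) < \<epsilon>"
proof -
  have "isCont (\<lambda>t. U t g) 0"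
    using continuous_U by (simp add: continuous_on_eq_continuous_at)
  then show ?thesis
    using assms unfolding continuous_at_eps_delta
    by (auto simp: dist_norm)
qed

text \<open>Mean value inequality for \<open>U s f - s *\<^sub>R g0\<close>, whose derivative is
  \<open>U s g - g0\<close>. The vector \<open>g0\<close> may differ from the derivative
  \<open>g\<close>, so that the bound is uniform along a sequence of derivatives tending to
  \<open>g0\<close>.\<close>

lemma D_quotient_bound:
  assumes "D f g" and "\<And>s. \<bar>s\<bar> \<le> \<bar>t\<bar> \<Longrightarrow> norm (U s g - g0) \<le> \<epsilon>"
  shows "norm (U t f - f - t *\<^sub>R g0) \<le> \<epsilon> * \<bar>t\<bar>"
proof -
  have "norm ((U t f - t *\<^sub>R g0) - (U 0 f - 0 *\<^sub>R g0)) \<le> \<epsilon> * norm (t - 0)"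
  proof (rule differentiable_bound[of "cball 0 \<bar>t\<bar>" _ "\<lambda>s h. h *\<^sub>R (U s g - g0)"])
    show "((\<lambda>s. U s f - s *\<^sub>R g0) has_derivative (\<lambda>h. h *\<^sub>R (U s g - g0)))
        (at s within cball 0 \<bar>t\<bar>)" for s
    proof -
      have "((\<lambda>s. U s f - s *\<^sub>R g0) has_vector_derivative (U s g - g0)) (at s)"
        by (rule has_vector_derivative_diff has_vector_derivative_U assms)+
          (auto intro!: derivative_eq_intros)
      then show ?thesis
        unfolding has_vector_derivative_def by (rule has_derivative_at_withinI)
    qed
    show "onorm (\<lambda>h. h *\<^sub>R (U s g - g0)) \<le> \<epsilon>" if "s \<in> cball 0 \<bar>t\<bar>" for s
      using assms(2)[of s] that onorm_scaleR_left[OF bounded_linear_ident, of "U s g - g0"]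
      by (auto simp: onorm_id)
  qed auto
  then show ?thesis by (simp add: algebra_simps)
qed

text \<open>Unitarity gives |U s g_n - g0| \<le> |g_n - g0| + |U s g0 - g0|, so one
  \<open>\<delta>\<close> chosen for \<open>g0\<close> serves all large n and the quotient bound
  survives the limit.\<close>

lemma D_closed:
  assumes D: "\<And>n. D (f n) (g n)" and f: "f \<longlonglongrightarrow> f0" and g: "g \<longlonglongrightarrow> g0"
  shows "D f0 g0"
proof (rule D_from_quotient_bound)
  fix \<epsilon> :: real assume "\<epsilon> > 0"
  then obtain \<delta> where \<delta>: "\<delta> > 0" "\<And>t. \<bar>t\<bar> < \<delta> \<Longrightarrow> norm (U t g0 - g0) < \<epsilon> / 2"
    using U_near[of "\<epsilon> / 2" g0] by auto
  have "norm (U t f0 - f0 - t *\<^sub>R g0) \<le> \<epsilon> * \<bar>t\<bar>" if t: "\<bar>t\<bar> < \<delta>" for t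
  proof (rule tendsto_upperbound)
    show "(\<lambda>n. norm (U t (f n) - f n - t *\<^sub>R g0)) \<longlonglongrightarrow> norm (U t f0 - f0 - t *\<^sub>R g0)"
      by (intro tendsto_intros f bounded_linear.tendsto[OF bounded_linear_U])
    have "\<forall>\<^sub>F n in sequentially. norm (g n - g0) < \<epsilon> / 2"
      using tendstoD[OF g, of "\<epsilon> / 2"] \<open>\<epsilon> > 0\<close> by (simp add: dist_norm)
    then show "\<forall>\<^sub>F n in sequentially. norm (U t (f n) - f n - t *\<^sub>R g0) \<le> \<epsilon> * \<bar>t\<bar>"
    proof eventually_elim
      case (elim n)
      show ?case
      proof (rule D_quotient_bound[OF D])
        fix s assume "\<bar>s\<bar> \<le> \<bar>t\<bar>"
        have "U s (g n) - g0 = U s (g n - g0) + (U s g0 - g0)"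
          by (simp add: U_diff)
        then have "norm (U s (g n) - g0) \<le> norm (g n - g0) + norm (U s g0 - g0)"
          by (metis norm_U norm_triangle_ineq)
        then show "norm (U s (g n) - g0) \<le> \<epsilon>"
          using elim \<delta>(2)[of s] t \<open>\<bar>s\<bar> \<le> \<bar>t\<bar>\<close> by linarith
      qed
    qed
  qed auto
  then show "\<exists>\<delta>>0. \<forall>t. \<bar>t\<bar> < \<delta> \<longrightarrow> norm (U t f0 - f0 - t *\<^sub>R g0) \<le> \<epsilon> * \<bar>t\<bar>"
    using \<delta>(1) by blast
qed

text \<open>The group law carries the weak derivative at 0 to every t, so the scalar mean value
  theorem applies on an interval, with a bound from strong continuity at \<open>g\<close>. For
  Garding vectors this leaves only scalar integrals to differentiate.\<close>

lemma D_weak: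
  assumes weak: "\<And>h. ((\<lambda>t. inner (U t f) h) has_real_derivative inner g h) (at 0)"
  shows "D f g"
proof (rule D_from_quotient_bound)
  have deriv: "((\<lambda>t. inner (U t f) h) has_real_derivative inner (U t g) h) (at t)" for t h
  proof -
    have eq: "(\<lambda>s. inner (U (s + t) f) h) = (\<lambda>s. inner (U s f) (U (- t) h))"
      by (simp add: U_add add.commute[of _ t] inner_U_minus)
    have "((\<lambda>s. inner (U (s + t) f) h) has_real_derivative inner g (U (- t) h)) (at 0)"
      unfolding eq by (rule weak)
    then show ?thesis
      using DERIV_shift[of "\<lambda>s. inner (U s f) h" "inner (U t g) h" 0 t]
      by (simp add: inner_U_minus)
  qed
  fix \<epsilon> :: real assume "\<epsilon> > 0"
  then obtain \<delta> where \<delta>: "\<delta> > 0" "\<And>t. \<bar>t\<bar> < \<delta> \<Longrightarrow> norm (U t g - g) < \<epsilon>"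
    using U_near[of "\<epsilon>" g] by auto
  have "norm (U t f - f - t *\<^sub>R g) \<le> \<epsilon> * \<bar>t\<bar>" if t: "\<bar>t\<bar> < \<delta>" for t
  proof -
    \<comment> \<open>Testing against the remainder itself turns the scalar bound into a bound on
      its norm.\<close>
    define h where "h = U t f - f - t *\<^sub>R g"
    have "norm ((inner (U t f) h - t * inner g h) - (inner (U 0 f) h - 0 * inner g h))
        \<le> (\<epsilon> * norm h) * norm (t - 0)"
    proof (rule field_differentiable_bound[of "cball 0 \<bar>t\<bar>" _ "\<lambda>s. inner (U s g) h - inner g h"])
      show "((\<lambda>s. inner (U s f) h - s * inner g h) has_field_derivative
          inner (U s g) h - inner g h) (at s within cball 0 \<bar>t\<bar>)" for s
        by (rule has_field_derivative_at_within) (auto intro!: derivative_eq_intros deriv)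
      show "norm (inner (U s g) h - inner g h) \<le> \<epsilon> * norm h" if "s \<in> cball 0 \<bar>t\<bar>" for s
      proof -
        have "norm (inner (U s g) h - inner g h) \<le> norm (U s g - g) * norm h"
          using Cauchy_Schwarz_ineq2[of "U s g - g" h] by (simp add: inner_diff_left)
        also have "\<dots> \<le> \<epsilon> * norm h"
          using \<delta>(2)[of s] t that by (intro mult_right_mono) auto
        finally show ?thesis .
      qed
    qed auto
    moreover have "(inner (U t f) h - t * inner g h) - (inner (U 0 f) h - 0 * inner g h) = norm h ^ 2"
      by (simp add: h_def inner_diff_left power2_norm_eq_inner)
    ultimately have "norm h * norm h \<le> (\<epsilon> * \<bar>t\<bar>) * norm h"
      by (simp add: power2_eq_square mult_ac)
    then show ?thesis
      unfolding h_def[symmetric] using \<open>\<epsilon> > 0\<close>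
      by (cases "h = 0") (auto simp: mult_le_cancel_right)
  qed
  then show "\<exists>\<delta>>0. \<forall>t. \<bar>t\<bar> < \<delta> \<longrightarrow> norm (U t f - f - t *\<^sub>R g) \<le> \<epsilon> * \<bar>t\<bar>"
    using \<delta>(1) by blast
qed

end

subsection \<open>Sobolev vectors\<close>

text \<open>The graph of the generator, used in place of the option-valued
  \<open>gen\<close>.\<close>

definition gen_rel :: "(real \<times> real \<Rightarrow> 'h \<Rightarrow> 'h::real_normed_vector) \<Rightarrow> nat \<Rightarrow> 'h \<Rightarrow> 'h \<Rightarrow> bool" where
  "gen_rel T j f g \<longleftrightarrow> ((\<lambda>t. one_param T j t f) has_vector_derivative g) (at 0)"

lemma gen_rel_unique: "gen_rel T j f g \<Longrightarrow> gen_rel T j f g' \<Longrightarrow> g = g'"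
  unfolding gen_rel_def by (rule vector_derivative_unique_at)

lemma gen_eq_Some_iff: "gen T j f = Some g \<longleftrightarrow> gen_rel T j f g"
proof
  assume "gen T j f = Some g"
  then obtain g' where "gen_rel T j f g'" and "g = (THE g. gen_rel T j f g)"
    unfolding gen_def gen_rel_def by (auto split: if_splits)
  then show "gen_rel T j f g"
    by (metis gen_rel_unique the_equality)
next
  assume *: "gen_rel T j f g"
  then have "(THE g. gen_rel T j f g) = g"
    by (metis gen_rel_unique the_equality)
  then show "gen T j f = Some g"
    using * unfolding gen_def gen_rel_def by auto
qed

text \<open>\<open>appl\<close> peels off the outermost operator, whereas \<open>words_bound\<close>
  recurses on the operator applied first, which is the last letter of the word.\<close>

lemma appl_snoc: "appl T (js @ [j]) f = Option.bind (gen T j f) (appl T js)"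
  by (induction js) (simp_all split: Option.bind_split)

text \<open>The maximum over all words of length at most \<open>r\<close>, instead of the sum in
  \<open>Hr_norm\<close>; the two agree up to the number of words. Since membership in the space is
  part of the predicate and the recursion starts with the operator applied first, facts about A_j f
  feed directly into inductions on \<open>r\<close>.\<close>

primrec words_bound :: "(real \<times> real \<Rightarrow> 'h \<Rightarrow> 'h::real_normed_vector) \<Rightarrow> nat \<Rightarrow> 'h \<Rightarrow> real \<Rightarrow> bool" where
  "words_bound T 0 f M \<longleftrightarrow> norm f \<le> M"
| "words_bound T (Suc r) f M \<longleftrightarrow>
     norm f \<le> M \<and> (\<forall>j\<in>{1, 2}. \<exists>g. gen_rel T j f g \<and> words_bound T r g M)"

lemma words_bound_SucD:
  "words_bound T (Suc r) f M \<Longrightarrow> j \<in> {1, 2} \<Longrightarrow> \<exists>g. gen_rel T j f g \<and> words_bound T r g M"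
  by (metis words_bound.simps(2))

lemma words_bound_norm: "words_bound T r f M \<Longrightarrow> norm f \<le> M"
  by (cases r) auto

lemma words_bound_mono: "words_bound T r f M \<Longrightarrow> M \<le> N \<Longrightarrow> words_bound T r f N"
proof (induction r arbitrary: f)
  case (Suc r)
  then show ?case
    unfolding words_bound.simps by (meson order_trans)
qed simp

lemma words_bound_Suc: "words_bound T (Suc r) f M \<Longrightarrow> words_bound T r f M"
proof (induction r arbitrary: f)
  case (Suc r)
  then show ?case
    unfolding words_bound.simps(2) by meson
qed simp

lemma words_bound_iff_appl:
  "words_bound T r f M \<longleftrightarrow>
   (\<forall>js. length js \<le> r \<and> set js \<subseteq> {1, 2} \<longrightarrow> (\<exists>g. appl T js f = Some g \<and> norm g \<le> M))"
proof (induction r arbitrary: f)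
  case (Suc r)
  show ?case (is "?L \<longleftrightarrow> ?R")
  proof
    assume L: ?L
    show ?R
    proof (intro allI impI)
      fix js :: "nat list" assume js: "length js \<le> Suc r \<and> set js \<subseteq> {1, 2}"
      show "\<exists>g. appl T js f = Some g \<and> norm g \<le> M"
      proof (cases js rule: rev_cases)
        case Nil
        then show ?thesis using L by simp
      next
        case (snoc ks j)
        with js have "j \<in> {1, 2}" by auto
        with L obtain h where h: "gen_rel T j f h" "words_bound T r h M" by auto
        with js snoc Suc.IH[of h] obtain g where "appl T ks h = Some g" "norm g \<le> M" by auto
        then show ?thesis
          using snoc h(1) by (simp add: appl_snoc gen_eq_Some_iff[symmetric])
      qed
    qed
  next
    assume R: ?R
    have "\<exists>g. gen_rel T j f g \<and> words_bound T r g M" if j: "j \<in> {1, 2}" for j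
    proof -
      have R': "\<exists>g. appl T (ks @ [j]) f = Some g \<and> norm g \<le> M"
        if "length ks \<le> r \<and> set ks \<subseteq> {1, 2}" for ks
        using R[rule_format, of "ks @ [j]"] that j by auto
      have "appl T ([] @ [j]) f \<noteq> None"
        using R'[of "[]"] by auto
      then obtain h where h: "gen T j f = Some h"
        unfolding appl_snoc by (cases "gen T j f") auto
      then have "words_bound T r h M"
        unfolding Suc.IH using R' by (simp add: appl_snoc)
      then show ?thesis using h by (auto simp: gen_eq_Some_iff)
    qed
    moreover have "norm f \<le> M"
      using R[rule_format, of "[]"] by simp
    ultimately show ?L by auto
  qed
qed auto

lemma finite_idx_lists: "finite (idx_lists k)"
  unfolding idx_lists_def using finite_lists_length_eq[of "{1, 2::nat}" k]
  by (simp add: conj_commute)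

lemma Hr_norm_ge_appl:
  assumes "length js \<le> r" "set js \<subseteq> {1, 2}"
  shows "norm (the (appl T js f)) \<le> Hr_norm T r f"
proof (cases "js = []")
  case True
  then show ?thesis by (simp add: Hr_norm_def sum_nonneg)
next
  case False
  have "norm (the (appl T js f)) \<le> (\<Sum>is\<in>idx_lists (length js). norm (the (appl T is f)))"
    using assms by (intro member_le_sum) (auto simp: finite_idx_lists, simp add: idx_lists_def)
  also have "\<dots> \<le> (\<Sum>k=1..r. \<Sum>is\<in>idx_lists k. norm (the (appl T is f)))"
    using assms False
    by (intro member_le_sum[of _ _ "\<lambda>k. \<Sum>is\<in>idx_lists k. norm (the (appl T is f))"])
      (auto simp: sum_nonneg Suc_le_eq)
  also have "\<dots> \<le> Hr_norm T r f"
    by (simp add: Hr_norm_def)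
  finally show ?thesis .
qed

lemma words_bound_Hr_norm:
  assumes "in_Hr T r f"
  shows "words_bound T r f (Hr_norm T r f)"
  unfolding words_bound_iff_appl
proof (intro allI impI)
  fix js :: "nat list" assume js: "length js \<le> r \<and> set js \<subseteq> {1, 2}"
  have "appl T js f \<noteq> None"
  proof (cases "js = []")
    case False
    then have "length js \<in> {1..r}" "js \<in> idx_lists (length js)"
      using js by (auto simp: idx_lists_def Suc_le_eq)
    then show ?thesis using assms unfolding in_Hr_def by blast
  qed simp
  then show "\<exists>g. appl T js f = Some g \<and> norm g \<le> Hr_norm T r f"
    using Hr_norm_ge_appl[of js r T f] js by auto
qed

definition num_words :: "nat \<Rightarrow> real" where
  "num_words r = 1 + (\<Sum>k=1..r. real (card (idx_lists k)))"

lemma num_words_ge_1: "1 \<le> num_words r"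
  by (simp add: num_words_def sum_nonneg)

lemma words_bound_imp_Hr:
  assumes "words_bound T r f M"
  shows "in_Hr T r f" and "Hr_norm T r f \<le> num_words r * M"
proof -
  have *: "\<exists>g. appl T js f = Some g \<and> norm g \<le> M" if "js \<in> idx_lists k" "k \<le> r" for js k
    using assms that unfolding words_bound_iff_appl idx_lists_def by auto
  then show "in_Hr T r f"
    unfolding in_Hr_def by fastforce
  have "Hr_norm T r f \<le> M + (\<Sum>k=1..r. \<Sum>js\<in>idx_lists k. M)"
    unfolding Hr_norm_def
  proof (intro add_mono sum_mono)
    show "norm f \<le> M" by (rule words_bound_norm[OF assms])
    show "norm (the (appl T js f)) \<le> M" if "k \<in> {1..r}" "js \<in> idx_lists k" for k js
      using *[OF that(2)] that(1) by auto
  qed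
  also have "\<dots> = num_words r * M"
    by (simp add: num_words_def distrib_right sum_distrib_right)
  finally show "Hr_norm T r f \<le> num_words r * M" .
qed

lemma Hr_norm_nonneg: "0 \<le> Hr_norm T r f"
  by (simp add: Hr_norm_def sum_nonneg)

subsection \<open>Representations of the affine group\<close>

locale axb_rep =
  fixes T :: "real \<times> real \<Rightarrow> 'h::{real_inner,complete_space} \<Rightarrow> 'h"
  assumes rep: "unitary_rep T"
begin

lemma T_mult: "0 < a \<Longrightarrow> 0 < c \<Longrightarrow> T (a, b) (T (c, d) x) = T (a * c, a * d + b) x"
proof -
  assume "0 < a" "0 < c"
  then have "T (axb_mult (a, b) (c, d)) = T (a, b) \<circ> T (c, d)"
    using rep unfolding unitary_rep_def axb_G_def by simp
  then show ?thesis
    by (simp add: axb_mult_def fun_eq_iff)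
qed

lemma unitary_group_one_param: "unitary_group (one_param T j)"
proof (rule unitary_group.intro)
  show "linear (one_param T j t)" for t
    using rep by (auto simp: unitary_rep_def axb_G_def one_param_def)
  show "norm (one_param T j t x) = norm x" for t x
    using rep by (auto simp: unitary_rep_def axb_G_def one_param_def)
  show "one_param T j 0 x = x" for x
    using rep by (auto simp: unitary_rep_def one_param_def)
  show "one_param T j (s + t) x = one_param T j s (one_param T j t x)" for s t x
    by (auto simp: one_param_def T_mult exp_add add.commute)
  have cont: "continuous_on axb_G (\<lambda>p. T p x)" for x
    using rep by (auto simp: unitary_rep_def)
  show "continuous_on UNIV (\<lambda>t. one_param T j t x)" for x
    unfolding one_param_def
    by (cases "j = 1")
      (auto intro!: continuous_intros continuous_on_compose2[OF cont] simp: axb_G_def)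
qed

sublocale G: unitary_group "one_param T j" for j
  by (rule unitary_group_one_param)

lemma D_iff: "G.D j f g \<longleftrightarrow> gen_rel T j f g"
  by (simp add: G.D_def gen_rel_def)

lemma words_bound_add:
  "words_bound T r f M \<Longrightarrow> words_bound T r g N \<Longrightarrow> words_bound T r (f + g) (M + N)"
proof (induction r arbitrary: f g)
  case 0
  then show ?case by (auto intro: norm_triangle_le)
next
  case (Suc r)
  have "\<exists>k. gen_rel T j (f + g) k \<and> words_bound T r k (M + N)" if j: "j \<in> {1, 2}" for j
  proof -
    obtain f' g' where "gen_rel T j f f'" "words_bound T r f' M" "gen_rel T j g g'" "words_bound T r g' N"
      using words_bound_SucD[OF Suc.prems(1) j] words_bound_SucD[OF Suc.prems(2) j] by blast
    then show ?thesis using Suc.IH[of f' g'] G.D_add[of j f f' g g'] by (auto simp: D_iff)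
  qed
  moreover have "norm (f + g) \<le> M + N"
    using Suc.prems by (auto intro!: norm_triangle_le add_mono)
  ultimately show ?case by simp
qed

lemma words_bound_scaleR:
  "words_bound T r f M \<Longrightarrow> words_bound T r (c *\<^sub>R f) (\<bar>c\<bar> * M)"
proof (induction r arbitrary: f)
  case 0
  then show ?case by (auto intro: mult_left_mono)
next
  case (Suc r)
  have "\<exists>k. gen_rel T j (c *\<^sub>R f) k \<and> words_bound T r k (\<bar>c\<bar> * M)" if j: "j \<in> {1, 2}" for j
  proof -
    obtain f' where "gen_rel T j f f'" "words_bound T r f' M"
      using words_bound_SucD[OF Suc.prems j] by blast
    then show ?thesis using Suc.IH[of f'] G.D_scaleR[of j f f' c] by (auto simp: D_iff)
  qed
  moreover have "norm (c *\<^sub>R f) \<le> \<bar>c\<bar> * M"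
    using Suc.prems by (auto intro!: mult_left_mono)
  ultimately show ?case by simp
qed

lemma words_bound_uminus: "words_bound T r f M \<Longrightarrow> words_bound T r (- f) M"
  using words_bound_scaleR[of r f M "-1"] by simp

lemma words_bound_diff:
  "words_bound T r f M \<Longrightarrow> words_bound T r g N \<Longrightarrow> words_bound T r (f - g) (M + N)"
  using words_bound_add[of r f M "- g" N] words_bound_uminus[of r g N] by simp

lemma words_bound_zero: "0 \<le> M \<Longrightarrow> words_bound T r 0 M"
proof (induction r)
  case (Suc r)
  then show ?case using G.D_zero by (auto simp: D_iff)
qed auto

text \<open>The derivative at the identity of \<open>T\<^sub>1(t) T\<^sub>2(s) = T\<^sub>2(e\<^sup>t s) T\<^sub>1(t)\<close>, i.e.
  \<open>[A\<^sub>1, A\<^sub>2] = A\<^sub>2\<close>.\<close>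
lemma D_commutator:
  assumes f2: "G.D 2 f f2" and f12: "G.D 1 f2 f12" and f1: "G.D 1 f f1"
  shows "G.D 2 f1 (f12 - f2)"
proof -
  have 1: "one_param T 2 s (one_param T 1 t x) = one_param T 1 t (one_param T 2 (exp (- t) * s) x)"
    for s t x
    by (simp add: one_param_def T_mult exp_minus field_simps)
  have 2: "G.D 2 (one_param T 1 t f) (exp (- t) *\<^sub>R one_param T 1 t f2)" for t
  proof -
    have "((*) (exp (- t)) has_vector_derivative exp (- t)) (at 0)"
      by (auto intro!: derivative_eq_intros)
    moreover have "((\<lambda>s. one_param T 2 s f) has_vector_derivative f2) (at (exp (- t) * 0))"
      using f2 by (simp add: G.D_def)
    ultimately have "((\<lambda>s. one_param T 2 (exp (- t) * s) f) has_vector_derivative exp (- t) *\<^sub>R f2) (at 0)"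
      using vector_diff_chain_at by (fastforce simp: o_def)
    then have "((\<lambda>s. one_param T 1 t (one_param T 2 (exp (- t) * s) f)) has_vector_derivative
        one_param T 1 t (exp (- t) *\<^sub>R f2)) (at 0)"
      by (rule bounded_linear.has_vector_derivative[OF G.bounded_linear_U])
    then show ?thesis
      unfolding G.D_def 1 G.U_scaleR .
  qed
  define \<tau> :: "nat \<Rightarrow> real" where "\<tau> n = inverse (real (Suc n))" for n
  have \<tau>: "filterlim \<tau> (at 0) sequentially"
    unfolding filterlim_at \<tau>_def using LIMSEQ_inverse_real_of_nat by auto
  \<comment> \<open>Apply A_2 to the difference quotient of T_1(t) f at 0, using \<open>2\<close>.
    The images converge to the derivative of e^(-t) T_1(t) f2, which is \<open>f12 - f2\<close>;
    closedness of A_2 then yields both existence and value of A_2 f1.\<close>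
  have 3: "G.D 2 ((1 / \<tau> n) *\<^sub>R (one_param T 1 (\<tau> n) f - f))
      ((1 / \<tau> n) *\<^sub>R (exp (- \<tau> n) *\<^sub>R one_param T 1 (\<tau> n) f2 - f2))" for n
    by (intro G.D_scaleR G.D_diff 2 f2)
  have 4: "(\<lambda>n. (1 / \<tau> n) *\<^sub>R (one_param T 1 (\<tau> n) f - f)) \<longlonglongrightarrow> f1"
    using filterlim_compose[OF vector_difference_quotient[OF f1[unfolded G.D_def]] \<tau>] by simp
  have "((\<lambda>t. exp (- t)) has_field_derivative - 1) (at (0::real))"
    by (auto intro!: derivative_eq_intros)
  from has_vector_derivative_scaleR[OF this f12[unfolded G.D_def]]
  have "((\<lambda>t. exp (- t) *\<^sub>R one_param T 1 t f2) has_vector_derivative (f12 - f2)) (at 0)"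
    by simp
  from filterlim_compose[OF vector_difference_quotient[OF this] \<tau>]
  have 5: "(\<lambda>n. (1 / \<tau> n) *\<^sub>R (exp (- \<tau> n) *\<^sub>R one_param T 1 (\<tau> n) f2 - f2)) \<longlonglongrightarrow> f12 - f2"
    by simp
  show ?thesis
    by (rule G.D_closed[OF 3 4 5])
qed

end

subsection \<open>Integration in complete normed spaces\<close>

text \<open>A type variable of sort \<open>{real_normed_vector, complete_space}\<close> is not of sort \<open>banach\<close>, so the
  integrability theorems of the library do not apply to it directly; they do apply to the following
  copy of the type.\<close>

typedef 'a copy = "UNIV :: 'a set" by simp

instantiation copy :: (real_normed_vector) real_normed_vector
begin

definition "norm_copy x = norm (Rep_copy x)"
definition "zero_copy = Abs_copy 0"
definition "plus_copy x y = Abs_copy (Rep_copy x + Rep_copy y)"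
definition "minus_copy x y = Abs_copy (Rep_copy x - Rep_copy y)"
definition "uminus_copy x = Abs_copy (- Rep_copy x)"
definition "scaleR_copy c x = Abs_copy (c *\<^sub>R Rep_copy x)"
definition "sgn_copy x = Abs_copy (sgn (Rep_copy x))"
definition "dist_copy x y = norm (Rep_copy x - Rep_copy y)"
definition "uniformity_copy = (INF e\<in>{0 <..}. principal {(x :: 'a copy, y). dist x y < e})"
definition "open_copy U = (\<forall>x\<in>U. \<forall>\<^sub>F (x', y) in uniformity. x' = (x :: 'a copy) \<longrightarrow> y \<in> U)"

lemmas copy_defs = norm_copy_def zero_copy_def plus_copy_def minus_copy_def uminus_copy_def
  scaleR_copy_def dist_copy_def sgn_copy_def Abs_copy_inverse[OF UNIV_I]

instance
proof
  fix x y z :: "'a copy" and a b :: real and U :: "'a copy set"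
  show "dist x y = norm (x - y)"
    by (simp add: copy_defs)
  show "sgn x = scaleR (inverse (norm x)) x"
    by (simp add: copy_defs sgn_div_norm)
  show "uniformity = (INF e\<in>{0 <..}. principal {(x :: 'a copy, y). dist x y < e})"
    by (rule uniformity_copy_def)
  show "open U = (\<forall>x\<in>U. \<forall>\<^sub>F (x', y) in uniformity. x' = x \<longrightarrow> y \<in> U)"
    by (rule open_copy_def)
  show "norm (x + y) \<le> norm x + norm y"
    by (simp add: copy_defs norm_triangle_ineq)
  show "(norm x = 0) = (x = 0)"
    by (simp add: copy_defs Rep_copy_inject[symmetric])
qed (simp_all add: Rep_copy_inject[symmetric] copy_defs scaleR_add_left scaleR_add_right add_ac)

end

lemma bounded_linear_Rep_copy: "bounded_linear (Rep_copy :: 'a::real_normed_vector copy \<Rightarrow> 'a)"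
  by (rule bounded_linear_intro[of _ 1]) (auto simp: copy_defs)

lemma bounded_linear_Abs_copy: "bounded_linear (Abs_copy :: 'a::real_normed_vector \<Rightarrow> 'a copy)"
  by (rule bounded_linear_intro[of _ 1]) (auto simp: copy_defs)

instance copy :: ("{real_normed_vector, complete_space}") banach
proof
  fix X :: "nat \<Rightarrow> 'a copy" assume "Cauchy X"
  then have "Cauchy (\<lambda>n. Rep_copy (X n))"
    by (rule bounded_linear.Cauchy[OF bounded_linear_Rep_copy])
  then obtain l where "(\<lambda>n. Rep_copy (X n)) \<longlonglongrightarrow> l"
    using Cauchy_convergent convergent_def by blast
  from bounded_linear.tendsto[OF bounded_linear_Abs_copy this]
  show "convergent X"
    by (auto simp: Rep_copy_inverse convergent_def)
qed

text \<open>Makes \<open>garding_vec\<close> an honest integral: without integrability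
  \<open>integral\<close> would return its default value.\<close>

lemma has_integral_compact_support:
  fixes f :: "'n::euclidean_space \<Rightarrow> 'a::{real_normed_vector,complete_space}"
  assumes "continuous_on UNIV f" and "compact K" and "\<And>x. x \<notin> K \<Longrightarrow> f x = 0"
  shows "(f has_integral integral UNIV f) UNIV"
proof -
  obtain a b where K: "K \<subseteq> cbox a b"
    using bounded_subset_cbox_symmetric[OF compact_imp_bounded[OF \<open>compact K\<close>]] by blast
  have "continuous_on (cbox a b) (\<lambda>x. Abs_copy (f x))"
    using continuous_on_subset[OF assms(1)]
    by (intro bounded_linear.continuous_on[OF bounded_linear_Abs_copy]) auto
  then have "(\<lambda>x. Abs_copy (f x)) integrable_on cbox a b"
    by (rule integrable_continuous)
  moreover have "Abs_copy (f x) = 0" if "x \<notin> cbox a b" for x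
    proof -
    have "x \<notin> K" using K that by blast
    then show ?thesis by (simp add: assms(3) zero_copy_def)
  qed
  ultimately obtain I where "((\<lambda>x. Abs_copy (f x)) has_integral I) UNIV"
    using has_integral_on_superset[of _ _ "cbox a b" UNIV] by (auto simp: integrable_on_def)
  from has_integral_linear[OF this bounded_linear_Rep_copy]
  have "(f has_integral Rep_copy I) UNIV"
    by (simp add: o_def Abs_copy_inverse)
  then show ?thesis
    by (metis integral_unique)
qed

text \<open>A dilation by one common factor is the right generality, because left translation by
  (e^t, 0) multiplies both coordinates by e^t and left translation by (1, t) is a shift.\<close>

lemma has_integral_affine_UNIV:
  fixes g :: "'n::euclidean_space \<Rightarrow> real"
  assumes g: "(g has_integral J) UNIV" and K: "bounded K" "\<And>x. x \<notin> K \<Longrightarrow> g x = 0" and "0 < m"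
  shows "((\<lambda>x. g (m *\<^sub>R x + c)) has_integral J / m ^ DIM('n)) UNIV"
proof -
  obtain a b where ab: "K \<subseteq> cbox a b"
    using bounded_subset_cbox_symmetric[OF K(1)] by blast
  have "g x = 0" if "x \<notin> cbox a b" for x
    using K(2) that ab by blast
  then have "g = (\<lambda>x. if x \<in> cbox a b then g x else 0)"
    by auto
  then have "(g has_integral J) (cbox a b)"
    using g has_integral_restrict_UNIV[of "cbox a b" g J] by metis
  from has_integral_affinity[OF this, of m c] \<open>0 < m\<close>
  have "((\<lambda>x. g (m *\<^sub>R x + c)) has_integral J / m ^ DIM('n))
      ((\<lambda>x. (1 / m) *\<^sub>R x + - ((1 / m) *\<^sub>R c)) ` cbox a b)"
    by simp
  then show ?thesis
  proof (rule has_integral_on_superset)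
    fix x assume x: "x \<notin> (\<lambda>x. (1 / m) *\<^sub>R x + - ((1 / m) *\<^sub>R c)) ` cbox a b"
    have "m *\<^sub>R x + c \<notin> cbox a b"
    proof
      assume "m *\<^sub>R x + c \<in> cbox a b"
      moreover have "x = (1 / m) *\<^sub>R (m *\<^sub>R x + c) + - ((1 / m) *\<^sub>R c)"
        using \<open>0 < m\<close> by (simp add: scaleR_add_right)
      ultimately show False using x by blast
    qed
    then show "g (m *\<^sub>R x + c) = 0" using ab K(2) by blast
  qed auto
qed

subsection \<open>Test functions\<close>

text \<open>Closed under the vector fields that generate the left translations, so that the generators
  \<open>A\<^sub>j\<close> map \<open>T(\<psi>) f\<close> to \<open>T(\<psi>') f\<close> within the class.\<close>
inductive_set test_class :: "(real \<times> real \<Rightarrow> real) \<Rightarrow> (real \<times> real \<Rightarrow> real) set"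
  for \<phi> where
  iter: "iter_dd \<phi> vs \<in> test_class \<phi>"
| add: "\<psi> \<in> test_class \<phi> \<Longrightarrow> \<eta> \<in> test_class \<phi> \<Longrightarrow> (\<lambda>p. \<psi> p + \<eta> p) \<in> test_class \<phi>"
| scale: "\<psi> \<in> test_class \<phi> \<Longrightarrow> (\<lambda>p. c * \<psi> p) \<in> test_class \<phi>"
| mult_fst: "\<psi> \<in> test_class \<phi> \<Longrightarrow> (\<lambda>p. fst p * \<psi> p) \<in> test_class \<phi>"
| mult_snd: "\<psi> \<in> test_class \<phi> \<Longrightarrow> (\<lambda>p. snd p * \<psi> p) \<in> test_class \<phi>"

lemma has_derivative_zero_off_closed:
  assumes "closed K" "\<And>p. p \<notin> K \<Longrightarrow> \<psi> p = (0::real)" "p \<notin> K"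
  shows "(\<psi> has_derivative (\<lambda>_. 0)) (at p)"
proof (rule has_derivative_transform_within_open)
  show "((\<lambda>_. 0) has_derivative (\<lambda>_. 0)) (at p)" by simp
  show "open (- K)" using assms by auto
qed (use assms in auto)

lemma iter_dd_zero_off:
  assumes "closed K" "\<And>p. p \<notin> K \<Longrightarrow> \<phi> p = 0" "p \<notin> K"
  shows "iter_dd \<phi> vs p = 0"
  using assms(3)
proof (induction vs arbitrary: p)
  case (Cons v vs)
  have "(iter_dd \<phi> vs has_derivative (\<lambda>_. 0)) (at p)"
    by (rule has_derivative_zero_off_closed[of K]) (use assms Cons in auto)
  then show ?case
    by (simp add: frechet_derivative_at[symmetric])
qed (use assms in auto)

lemma test_class_zero_off:
  assumes "\<psi> \<in> test_class \<phi>" "closed K" "\<And>p. p \<notin> K \<Longrightarrow> \<phi> p = 0" "p \<notin> K"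
  shows "\<psi> p = 0"
  using assms(1,4) by induction (auto intro: iter_dd_zero_off[OF assms(2,3)])

text \<open>Smoothness is assumed on the half-plane only; off the compact support the function
  vanishes near each point, so differentiability extends to the whole plane. The two coordinate
  derivatives are recorded because the translation fields are combinations of them.\<close>

lemma test_class_has_derivative:
  assumes "test_fun \<phi>" "\<psi> \<in> test_class \<phi>"
  shows "\<exists>\<psi>a\<in>test_class \<phi>. \<exists>\<psi>b\<in>test_class \<phi>. \<forall>p.
    (\<psi> has_derivative (\<lambda>v. fst v * \<psi>a p + snd v * \<psi>b p)) (at p)"
proof -
  obtain K where K: "compact K" "K \<subseteq> axb_G" "\<And>p. p \<notin> K \<Longrightarrow> \<phi> p = 0"
    and smooth: "smooth_on_R2 axb_G \<phi>"
    using assms(1) unfolding test_fun_def by blast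
  show ?thesis
    using assms(2)
  proof induction
    case (iter vs)
    have "(iter_dd \<phi> vs has_derivative (\<lambda>v. fst v * iter_dd \<phi> ((1, 0) # vs) p
        + snd v * iter_dd \<phi> ((0, 1) # vs) p)) (at p)" for p
    proof -
      have "iter_dd \<phi> vs differentiable at p"
      proof (cases "p \<in> axb_G")
        case True
        then show ?thesis using smooth by (simp add: smooth_on_R2_def)
      next
        case False
        then have "p \<notin> K" using K(2) by blast
        then show ?thesis
          using has_derivative_zero_off_closed[of K "iter_dd \<phi> vs" p] iter_dd_zero_off[of K \<phi>] K
          by (meson compact_imp_closed differentiableI)
      qed
      then have D: "(iter_dd \<phi> vs has_derivative frechet_derivative (iter_dd \<phi> vs) (at p)) (at p)"
        by (simp add: frechet_derivative_works)
      have "frechet_derivative (iter_dd \<phi> vs) (at p) v = fst v * iter_dd \<phi> ((1, 0) # vs) p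
        + snd v * iter_dd \<phi> ((0, 1) # vs) p" for v
      proof -
        note lin = has_derivative_linear[OF D]
        have "v = fst v *\<^sub>R (1, 0) + snd v *\<^sub>R (0, 1)" by (simp add: prod_eq_iff)
        then have "frechet_derivative (iter_dd \<phi> vs) (at p) v =
            frechet_derivative (iter_dd \<phi> vs) (at p) (fst v *\<^sub>R (1, 0) + snd v *\<^sub>R (0, 1))"
          by (rule arg_cong)
        then show ?thesis
          by (simp only: linear_add[OF lin] linear_scale[OF lin] real_scaleR_def iter_dd.simps)
      qed
      then have "frechet_derivative (iter_dd \<phi> vs) (at p) = (\<lambda>v. fst v * iter_dd \<phi> ((1, 0) # vs) p
        + snd v * iter_dd \<phi> ((0, 1) # vs) p)"
        by (rule ext)
      with D show ?thesis by (simp only:)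
    qed
    then show ?case using test_class.iter by blast
  next
    case (add \<psi> \<eta>)
    then obtain \<psi>a \<psi>b \<eta>a \<eta>b where *: "\<psi>a \<in> test_class \<phi>" "\<psi>b \<in> test_class \<phi>" "\<eta>a \<in> test_class \<phi>"
      "\<eta>b \<in> test_class \<phi>"
      "\<And>p. (\<psi> has_derivative (\<lambda>v. fst v * \<psi>a p + snd v * \<psi>b p)) (at p)"
      "\<And>p. (\<eta> has_derivative (\<lambda>v. fst v * \<eta>a p + snd v * \<eta>b p)) (at p)"
      by blast
    show ?case
    proof (rule bexI, rule bexI, rule allI)
      show "((\<lambda>p. \<psi> p + \<eta> p) has_derivative (\<lambda>v. fst v * (\<psi>a p + \<eta>a p) + snd v * (\<psi>b p + \<eta>b p))) (at p)" for p
        by (rule has_derivative_eq_rhs[OF has_derivative_add[OF *(5,6)]]) (simp add: fun_eq_iff algebra_simps)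
    qed (intro test_class.add *(1-4))+
  next
    case (scale \<psi> c)
    then obtain \<psi>a \<psi>b where *: "\<psi>a \<in> test_class \<phi>" "\<psi>b \<in> test_class \<phi>"
      "\<And>p. (\<psi> has_derivative (\<lambda>v. fst v * \<psi>a p + snd v * \<psi>b p)) (at p)"
      by blast
    show ?case
    proof (rule bexI, rule bexI, rule allI)
      show "((\<lambda>p. c * \<psi> p) has_derivative (\<lambda>v. fst v * (c * \<psi>a p) + snd v * (c * \<psi>b p))) (at p)" for p
        by (rule has_derivative_eq_rhs[OF has_derivative_mult_right[OF *(3)]]) (simp add: fun_eq_iff algebra_simps)
    qed (intro test_class.scale *(1,2))+
  next
    case (mult_fst \<psi>)
    then obtain \<psi>a \<psi>b where *: "\<psi>a \<in> test_class \<phi>" "\<psi>b \<in> test_class \<phi>"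
      "\<And>p. (\<psi> has_derivative (\<lambda>v. fst v * \<psi>a p + snd v * \<psi>b p)) (at p)"
      by blast
    show ?case
    proof (rule bexI, rule bexI, rule allI)
      show "((\<lambda>p. fst p * \<psi> p) has_derivative (\<lambda>v. fst v * (\<psi> p + fst p * \<psi>a p) + snd v * (fst p * \<psi>b p))) (at p)" for p
        by (rule has_derivative_eq_rhs[OF has_derivative_mult[OF has_derivative_fst[OF has_derivative_ident] *(3)]]) (simp add: fun_eq_iff algebra_simps)
    qed (intro test_class.add test_class.mult_fst *(1,2) mult_fst(1))+
  next
    case (mult_snd \<psi>)
    then obtain \<psi>a \<psi>b where *: "\<psi>a \<in> test_class \<phi>" "\<psi>b \<in> test_class \<phi>"
      "\<And>p. (\<psi> has_derivative (\<lambda>v. fst v * \<psi>a p + snd v * \<psi>b p)) (at p)"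
      by blast
    show ?case
    proof (rule bexI, rule bexI, rule allI)
      show "((\<lambda>p. snd p * \<psi> p) has_derivative (\<lambda>v. fst v * (snd p * \<psi>a p) + snd v * (\<psi> p + snd p * \<psi>b p))) (at p)" for p
        by (rule has_derivative_eq_rhs[OF has_derivative_mult[OF has_derivative_snd[OF has_derivative_ident] *(3)]]) (simp add: fun_eq_iff algebra_simps)
    qed (intro test_class.add test_class.mult_snd *(1,2) mult_snd(1))+
  qed
qed

text \<open>Later integrals are taken over one box, which must stay where \<open>T\<close> is
  continuous. The first coordinate attains its minimum on \<open>C\<close>, so this minimum is
  positive and can serve as the left edge.\<close>

lemma compact_axb_G_subset_cbox:
  assumes "compact C" "C \<subseteq> axb_G"
  obtains a b where "C \<subseteq> cbox a b" "cbox a b \<subseteq> axb_G"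
proof (cases "C = {}")
  case True
  show ?thesis
    using that[of "(1, 1)" "(0, 0)"] True by (force simp: axb_G_def cbox_Pair_eq)
next
  case False
  have "compact (fst ` C)"
    by (intro compact_continuous_image continuous_intros assms)
  then obtain p where p: "p \<in> C" "\<And>q. q \<in> C \<Longrightarrow> fst p \<le> fst q"
    using compact_attains_inf[of "fst ` C"] False by blast
  obtain c d where cd: "C \<subseteq> cbox c d"
    using bounded_subset_cbox_symmetric[OF compact_imp_bounded[OF \<open>compact C\<close>]] by blast
  show ?thesis
  proof (rule that)
    show "C \<subseteq> cbox (fst p, snd c) d"
      using p cd by (cases c; cases d) (force simp: cbox_Pair_eq)
    show "cbox (fst p, snd c) d \<subseteq> axb_G"
      using p(1) assms(2) by (cases d) (force simp: cbox_Pair_eq axb_G_def)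
  qed
qed

subsection \<open>Garding vectors are smooth\<close>

context axb_rep
begin

lemma garding_vec_has_integral:
  assumes "continuous_on UNIV \<psi>" "compact K" "K \<subseteq> axb_G" "\<And>p. p \<notin> K \<Longrightarrow> \<psi> p = 0"
  shows "((\<lambda>p. \<psi> p * inner (T p f) h) has_integral inner (garding_vec T \<psi> f) h) UNIV"
proof -
  \<comment> \<open>\<open>T\<close> is arbitrary off \<open>axb_G\<close>, so continuity is glued
    from the open cover by \<open>axb_G\<close> and the complement of the support.\<close>
  have "continuous_on (axb_G \<union> - K) (\<lambda>p. \<psi> p *\<^sub>R T p f)"
  proof (rule continuous_on_open_Un)
    have "axb_G = fst -` {0<..}" by (auto simp: axb_G_def)
    then show "open axb_G" by (metis open_greaterThan open_vimage_fst)
    show "open (- K)" using assms(2) by (simp add: compact_imp_closed open_Compl)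
    show "continuous_on axb_G (\<lambda>p. \<psi> p *\<^sub>R T p f)"
      using rep continuous_on_subset[OF assms(1)] unfolding unitary_rep_def
      by (intro continuous_intros) auto
    show "continuous_on (- K) (\<lambda>p. \<psi> p *\<^sub>R T p f)"
      by (rule continuous_on_cong[THEN iffD1, OF refl _ continuous_on_const[of _ 0]])
        (use assms(4) in auto)
  qed
  moreover have "axb_G \<union> - K = UNIV" using assms(3) by auto
  ultimately have "continuous_on UNIV (\<lambda>p. \<psi> p *\<^sub>R T p f)" by simp
  from has_integral_compact_support[OF this \<open>compact K\<close>] assms(4)
  have "((\<lambda>p. \<psi> p *\<^sub>R T p f) has_integral garding_vec T \<psi> f) UNIV"
    by (auto simp: garding_vec_def)
  from has_integral_linear[OF this bounded_linear_inner_left[of h]]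
  show ?thesis by (simp add: o_def)
qed

text \<open>A change of variables moves the group action from \<open>T\<close> onto the test
  function: \<open>(1 / m t) ^ 2\<close> is the Jacobian of the inverse translation in the plane,
  and \<open>\<eta>\<close> is the resulting derivative of the test function. By
  \<open>D_weak\<close> it suffices to differentiate under the scalar integral against a fixed
  \<open>h\<close>.\<close>

lemma D_garding_vec:
  assumes \<psi>: "continuous_on UNIV \<psi>" "compact K" "K \<subseteq> axb_G" "\<And>p. p \<notin> K \<Longrightarrow> \<psi> p = 0"
    and \<tau>: "\<And>t p. p \<in> axb_G \<Longrightarrow> one_param T j t (T p f) = T (m t *\<^sub>R p + c t) f"
    and m: "\<And>t. 0 < m t" "continuous_on UNIV m" "continuous_on UNIV c" "\<And>t. 0 \<le> fst (c t)"
      "m 0 = 1" "c 0 = 0"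
    and deriv: "\<And>t x. ((\<lambda>t. (1 / m t) ^ 2 * \<psi> ((1 / m t) *\<^sub>R (x - c t))) has_real_derivative
       (1 / m t) ^ 2 * \<eta> ((1 / m t) *\<^sub>R (x - c t))) (at t)"
    and \<eta>: "continuous_on UNIV \<eta>" "\<And>p. p \<notin> K \<Longrightarrow> \<eta> p = 0"
  shows "G.D j (garding_vec T \<psi> f) (garding_vec T \<eta> f)"
proof (rule G.D_weak)
  fix h
  define G where "G p = inner (T p f) h" for p
  \<comment> \<open>The translates of the support for |t| \<le> 1 sweep out one compact set, so a
    single box serves all small t.\<close>
  define C where "C = (\<lambda>(t, p). m t *\<^sub>R p + c t) ` ({-1..1} \<times> K)"
  have "compact C"
    unfolding C_def split_def
    by (intro compact_continuous_image compact_Times \<psi> compact_Icc continuous_intros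
        continuous_on_compose2[OF m(2)] continuous_on_compose2[OF m(3)]) auto
  moreover have "C \<subseteq> axb_G"
  proof
    fix x assume "x \<in> C"
    then obtain t p where "p \<in> K" "x = m t *\<^sub>R p + c t" by (auto simp: C_def)
    then show "x \<in> axb_G"
      using \<psi>(3) m(1,4) by (auto simp: axb_G_def intro!: add_pos_nonneg)
  qed
  ultimately obtain a b where ab: "C \<subseteq> cbox a b" "cbox a b \<subseteq> axb_G"
    by (rule compact_axb_G_subset_cbox)
  have off: "\<rho> ((1 / m t) *\<^sub>R (x - c t)) = 0"
    if "t \<in> {-1<..<1}" "x \<notin> cbox a b" "\<And>p. p \<notin> K \<Longrightarrow> \<rho> p = (0::real)" for t x \<rho>
  proof (rule that(3), rule notI)
    assume "(1 / m t) *\<^sub>R (x - c t) \<in> K"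
    then have "m t *\<^sub>R ((1 / m t) *\<^sub>R (x - c t)) + c t \<in> C"
      using that(1) unfolding C_def by (intro image_eqI[of _ _ "(t, (1 / m t) *\<^sub>R (x - c t))"]) auto
    then show False using that(2) ab(1) m(1)[of t] by auto
  qed
  have repr: "((\<lambda>x. (1 / m t) ^ 2 * \<psi> ((1 / m t) *\<^sub>R (x - c t)) * G x) has_integral
      inner (one_param T j t (garding_vec T \<psi> f)) h) UNIV" for t
  proof -
    have "((\<lambda>p. \<psi> p * inner (T p f) (one_param T j (- t) h)) has_integral
        inner (garding_vec T \<psi> f) (one_param T j (- t) h)) UNIV"
      by (rule garding_vec_has_integral[OF \<psi>])
    moreover have "\<psi> p * inner (T p f) (one_param T j (- t) h) = \<psi> p * G (m t *\<^sub>R p + c t)" for p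
      using \<psi>(3,4) by (cases "p \<in> K") (auto simp: G_def G.inner_U_minus[symmetric] \<tau>)
    ultimately have "((\<lambda>p. \<psi> p * G (m t *\<^sub>R p + c t)) has_integral
        inner (one_param T j t (garding_vec T \<psi> f)) h) UNIV"
      by (simp add: G.inner_U_minus)
    from has_integral_affine_UNIV[OF this compact_imp_bounded[OF \<psi>(2)], of "1 / m t" "- (1 / m t) *\<^sub>R c t"]
    have "((\<lambda>x. \<psi> ((1 / m t) *\<^sub>R (x - c t)) * G x) has_integral
        inner (one_param T j t (garding_vec T \<psi> f)) h / (1 / m t) ^ 2) UNIV"
      using \<psi>(4) m(1)[of t] by (simp add: scaleR_diff_right power2_eq_square)
    from has_integral_mult_right[OF this, of "(1 / m t) ^ 2"]
    show ?thesis using m(1)[of t] by (simp add: mult.assoc)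
  qed
  have onto_box: "integral (cbox a b) g = I" if "(g has_integral I) UNIV" "\<And>x. x \<notin> cbox a b \<Longrightarrow> g x = 0"
    for g :: "real \<times> real \<Rightarrow> real" and I
  proof -
    have "g = (\<lambda>x. if x \<in> cbox a b then g x else 0)" using that(2) by auto
    then have "(g has_integral I) (cbox a b)"
      using that(1) has_integral_restrict_UNIV[of "cbox a b" g I] by metis
    then show ?thesis by (rule integral_unique)
  qed
  have cont_G: "continuous_on (cbox a b) G"
    unfolding G_def using rep ab(2) unfolding unitary_rep_def
    by (intro continuous_intros) (auto intro: continuous_on_subset)
  have cont: "continuous_on ({-1<..<1} \<times> cbox a b)
      (\<lambda>(t, x). (1 / m t) ^ 2 * \<rho> ((1 / m t) *\<^sub>R (x - c t)) * G x)"
    if "continuous_on UNIV \<rho>" for \<rho> :: "real \<times> real \<Rightarrow> real"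
    unfolding split_def using m(1)
    by (intro continuous_intros continuous_on_compose2[OF m(2)] continuous_on_compose2[OF m(3)]
       continuous_on_compose2[OF that] continuous_on_compose2[OF cont_G])
      (auto simp: less_imp_neq[symmetric] intro: less_imp_neq[OF m(1), symmetric])
  have "((\<lambda>t. integral (cbox a b) (\<lambda>x. (1 / m t) ^ 2 * \<psi> ((1 / m t) *\<^sub>R (x - c t)) * G x))
      has_field_derivative
      integral (cbox a b) (\<lambda>x. (1 / m 0) ^ 2 * \<eta> ((1 / m 0) *\<^sub>R (x - c 0)) * G x)) (at 0 within {-1<..<1})"
  proof (rule leibniz_rule_field_derivative)
    show "((\<lambda>t. (1 / m t) ^ 2 * \<psi> ((1 / m t) *\<^sub>R (x - c t)) * G x) has_field_derivative
        (1 / m t) ^ 2 * \<eta> ((1 / m t) *\<^sub>R (x - c t)) * G x) (at t within {-1<..<1})" for t x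
      by (rule DERIV_cmult_right[OF has_field_derivative_at_within[OF deriv]])
    show "(\<lambda>x. (1 / m t) ^ 2 * \<psi> ((1 / m t) *\<^sub>R (x - c t)) * G x) integrable_on cbox a b"
      if "t \<in> {-1<..<1}" for t
      by (rule integrable_continuous,
          rule continuous_on_compose2[OF cont[OF \<psi>(1)], of _ "\<lambda>x. (t, x)", simplified])
        (use that in \<open>auto intro!: continuous_intros\<close>)
    show "continuous_on ({-1<..<1} \<times> cbox a b)
        (\<lambda>(t, x). (1 / m t) ^ 2 * \<eta> ((1 / m t) *\<^sub>R (x - c t)) * G x)"
      by (rule cont[OF \<eta>(1)])
  qed auto
  moreover have "integral (cbox a b) (\<lambda>x. (1 / m 0) ^ 2 * \<eta> ((1 / m 0) *\<^sub>R (x - c 0)) * G x)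
      = inner (garding_vec T \<eta> f) h"
  proof (rule onto_box)
    show "((\<lambda>x. (1 / m 0) ^ 2 * \<eta> ((1 / m 0) *\<^sub>R (x - c 0)) * G x) has_integral
       inner (garding_vec T \<eta> f) h) UNIV"
      using garding_vec_has_integral[OF \<eta>(1) \<psi>(2,3) \<eta>(2)] by (simp add: G_def m)
    show "(1 / m 0) ^ 2 * \<eta> ((1 / m 0) *\<^sub>R (x - c 0)) * G x = 0" if "x \<notin> cbox a b" for x
      using off[of 0 x \<eta>] that \<eta>(2) by simp
  qed
  moreover have "integral (cbox a b) (\<lambda>x. (1 / m t) ^ 2 * \<psi> ((1 / m t) *\<^sub>R (x - c t)) * G x) =
      inner (one_param T j t (garding_vec T \<psi> f)) h" if "t \<in> {-1<..<1}" for t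
    by (rule onto_box[OF repr]) (use off[of t _ \<psi>] that \<psi>(4) in simp)
  moreover have "at (0::real) within {-1<..<1} = at 0"
    by (rule at_within_open) auto
  ultimately have deriv_0: "((\<lambda>t. integral (cbox a b) (\<lambda>x. (1 / m t) ^ 2 * \<psi> ((1 / m t) *\<^sub>R (x - c t)) * G x))
      has_field_derivative inner (garding_vec T \<eta> f) h) (at 0)"
    and on_box: "\<And>t. t \<in> {-1<..<1} \<Longrightarrow>
      integral (cbox a b) (\<lambda>x. (1 / m t) ^ 2 * \<psi> ((1 / m t) *\<^sub>R (x - c t)) * G x) =
      inner (one_param T j t (garding_vec T \<psi> f)) h"
    by simp_all
  show "((\<lambda>t. inner (one_param T j t (garding_vec T \<psi> f)) h) has_real_derivative
      inner (garding_vec T \<eta> f) h) (at 0)"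
    by (rule has_field_derivative_transform_within_open[OF deriv_0, of "{-1<..<1}"]) (auto intro: on_box)
qed

lemma D_garding_vec_test_class:
  assumes \<phi>: "test_fun \<phi>" and \<psi>: "\<psi> \<in> test_class \<phi>" and j: "j \<in> {1, 2}"
  shows "\<exists>\<eta>\<in>test_class \<phi>. G.D j (garding_vec T \<psi> f) (garding_vec T \<eta> f)"
proof -
  obtain K where K: "compact K" "K \<subseteq> axb_G" "\<And>p. p \<notin> K \<Longrightarrow> \<phi> p = 0"
    using \<phi> unfolding test_fun_def by blast
  note zero = test_class_zero_off[OF _ compact_imp_closed[OF K(1)] K(3)]
  have cont: "continuous_on UNIV \<eta>" if "\<eta> \<in> test_class \<phi>" for \<eta>
    using test_class_has_derivative[OF \<phi> that]
    by (meson continuous_at_imp_continuous_on has_derivative_continuous)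
  obtain \<psi>a \<psi>b where ab: "\<psi>a \<in> test_class \<phi>" "\<psi>b \<in> test_class \<phi>"
    and D: "\<And>p. (\<psi> has_derivative (\<lambda>v. fst v * \<psi>a p + snd v * \<psi>b p)) (at p)"
    using test_class_has_derivative[OF \<phi> \<psi>] by blast
  show ?thesis
  proof (cases "j = 1")
    case True
    \<comment> \<open>The derivative of e^(-2t) \<psi>(e^(-t) x): the coefficient -2 comes from the
      Jacobian factor, the rest is minus the Euler field.\<close>
    define \<eta> where "\<eta> = (\<lambda>p. (-2) * \<psi> p + ((-1) * (fst p * \<psi>a p) + (-1) * (snd p * \<psi>b p)))"
    have \<eta>: "\<eta> \<in> test_class \<phi>"
      unfolding \<eta>_def by (intro test_class.intros(2-) \<psi> ab)
    have "G.D j (garding_vec T \<psi> f) (garding_vec T \<eta> f)"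
    proof (rule D_garding_vec[where m = exp and c = "\<lambda>_. 0" and K = K])
      show "one_param T j t (T p f) = T (exp t *\<^sub>R p + 0) f" if "p \<in> axb_G" for t p
        using that True by (cases p) (simp add: one_param_def T_mult axb_G_def)
      fix t :: real and x :: "real \<times> real"
      have 1: "((\<lambda>t. \<psi> (exp (- t) *\<^sub>R x)) has_derivative
          (\<lambda>s. fst ((- s * exp (- t)) *\<^sub>R x) * \<psi>a (exp (- t) *\<^sub>R x)
            + snd ((- s * exp (- t)) *\<^sub>R x) * \<psi>b (exp (- t) *\<^sub>R x))) (at t)"
        by (rule has_derivative_compose[OF _ D]) (auto intro!: derivative_eq_intros)
      have 2: "((\<lambda>t. \<psi> (exp (- t) *\<^sub>R x)) has_real_derivative
          - (fst (exp (- t) *\<^sub>R x) * \<psi>a (exp (- t) *\<^sub>R x) + snd (exp (- t) *\<^sub>R x) * \<psi>b (exp (- t) *\<^sub>R x))) (at t)"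
        using 1 unfolding has_field_derivative_def
        by (rule has_derivative_eq_rhs) (auto simp: algebra_simps)
      show "((\<lambda>t. (1 / exp t) ^ 2 * \<psi> ((1 / exp t) *\<^sub>R (x - 0))) has_real_derivative
          (1 / exp t) ^ 2 * \<eta> ((1 / exp t) *\<^sub>R (x - 0))) (at t)"
        using 2 by (auto simp: exp_minus divide_inverse \<eta>_def power2_eq_square algebra_simps
          intro!: derivative_eq_intros)
    qed (simp_all add: cont[OF \<psi>] cont[OF \<eta>] zero[OF \<psi>] zero[OF \<eta>] K continuous_on_exp continuous_on_id)
    then show ?thesis using \<eta> by blast
  next
    case False
    define \<eta> where "\<eta> = (\<lambda>p. (-1) * \<psi>b p)"
    have \<eta>: "\<eta> \<in> test_class \<phi>"
      unfolding \<eta>_def by (intro test_class.intros(2-) \<psi> ab)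
    have "G.D j (garding_vec T \<psi> f) (garding_vec T \<eta> f)"
    proof (rule D_garding_vec[where m = "\<lambda>_. 1" and c = "\<lambda>t. (0, t)" and K = K])
      show "one_param T j t (T p f) = T (1 *\<^sub>R p + (0, t)) f" if "p \<in> axb_G" for t p
        using that False by (cases p) (simp add: one_param_def T_mult axb_G_def)
      fix t :: real and x :: "real \<times> real"
      have "((\<lambda>t. \<psi> (x - (0, t))) has_derivative
          (\<lambda>s. fst (- (0::real, s)) * \<psi>a (x - (0, t)) + snd (- (0::real, s)) * \<psi>b (x - (0, t)))) (at t)"
        by (rule has_derivative_compose[OF _ D]) (auto intro!: derivative_eq_intros)
      moreover have "(*) (- \<psi>b (x - (0, t))) = (\<lambda>s. - (s * \<psi>b (x - (0, t))))"
        by auto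
      ultimately show "((\<lambda>t. (1 / 1) ^ 2 * \<psi> ((1 / 1) *\<^sub>R (x - (0, t)))) has_real_derivative
          (1 / 1) ^ 2 * \<eta> ((1 / 1) *\<^sub>R (x - (0, t)))) (at t)"
        unfolding has_field_derivative_def \<eta>_def by simp
    qed (simp_all add: cont[OF \<psi>] cont[OF \<eta>] zero[OF \<psi>] zero[OF \<eta>] K continuous_on_Pair continuous_on_id zero_prod_def)
    then show ?thesis using \<eta> by blast
  qed
qed

lemma garding_vec_words_bound:
  assumes "test_fun \<phi>" "\<psi> \<in> test_class \<phi>"
  shows "\<exists>M. words_bound T k (garding_vec T \<psi> f) M"
  using assms(2)
proof (induction k arbitrary: \<psi>)
  case (Suc k)
  obtain \<eta>1 \<eta>2 where *: "\<eta>1 \<in> test_class \<phi>" "gen_rel T 1 (garding_vec T \<psi> f) (garding_vec T \<eta>1 f)"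
     "\<eta>2 \<in> test_class \<phi>" "gen_rel T 2 (garding_vec T \<psi> f) (garding_vec T \<eta>2 f)"
    using D_garding_vec_test_class[OF assms(1) Suc.prems] unfolding D_iff by blast
  obtain M1 M2 where M: "words_bound T k (garding_vec T \<eta>1 f) M1" "words_bound T k (garding_vec T \<eta>2 f) M2"
    using Suc.IH * by metis
  define M where "M = max (norm (garding_vec T \<psi> f)) (max M1 M2)"
  have "words_bound T k (garding_vec T \<eta>1 f) M" "words_bound T k (garding_vec T \<eta>2 f) M"
    using M by (auto intro: words_bound_mono simp: M_def)
  then have "words_bound T (Suc k) (garding_vec T \<psi> f) M"
    using * by (auto simp: M_def)
  then show ?case ..
qed auto

lemma garding_space_words_bound:
  assumes "v \<in> garding_space T"
  shows "\<exists>M. words_bound T k v M"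
  using assms unfolding garding_space_def
proof (induction rule: span_induct_alt)
  case base
  then show ?case using words_bound_zero[of 0] by blast
next
  case (step c x y)
  then obtain \<phi> f where "x = garding_vec T \<phi> f" "test_fun \<phi>" by blast
  moreover have "\<phi> \<in> test_class \<phi>" using test_class.iter[of \<phi> "[]"] by simp
  ultimately obtain M where "words_bound T k x M" using garding_vec_words_bound by metis
  then show ?case using step words_bound_add words_bound_scaleR by blast
qed

lemma subspace_garding_space: "subspace (garding_space T)"
  unfolding garding_space_def by (rule subspace_span)

end

subsection \<open>Functional calculus of a projection-valued measure\<close>

text \<open>Polarization produces bounds by |f|^2 + |h|^2 instead of |f| |h|. Taking
  \<open>h\<close> parallel to \<open>v\<close> with norm |f| balances the two terms; for
  \<open>f = 0\<close> the norm of \<open>h\<close> tends to 0.\<close>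

lemma norm_le_from_inner_bound:
  fixes v f :: "'h::real_inner"
  assumes "0 \<le> c" and bound: "\<And>h. inner v h \<le> c * (norm f ^ 2 + norm h ^ 2) / 2"
  shows "norm v \<le> c * norm f"
proof (cases "v = 0")
  case False
  have *: "s * norm v \<le> c * (norm f ^ 2 + s ^ 2) / 2" if "0 < s" for s
    using bound[of "(s / norm v) *\<^sub>R v"] that False
    by (simp add: power2_norm_eq_inner[symmetric] power2_eq_square)
  show ?thesis
  proof (cases "f = 0")
    case True
    have "norm v \<le> 0"
    proof (rule field_le_epsilon)
      fix e :: real assume "0 < e"
      define s where "s = e / (c + 1)"
      have "s > 0" using \<open>0 < e\<close> assms(1) by (simp add: s_def)
      with *[OF this] True have "norm v \<le> c * s / 2"
        by (simp add: power2_eq_square mult.commute field_simps)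
      also have "\<dots> \<le> (c + 1) * s" using \<open>s > 0\<close> assms(1) by (simp add: field_simps)
      also have "\<dots> = e" using assms(1) by (simp add: s_def)
      finally show "norm v \<le> 0 + e" by simp
    qed
    then show ?thesis using False by simp
  next
    case False
    then show ?thesis using *[of "norm f"] by (simp add: power2_eq_square)
  qed
qed (use assms(1) in auto)

text \<open>The binary digits of x are the parities of the floors of 2^(i+1) x. Applied pointwise,
  this writes a measurable function with values in [0, 1) as a uniform limit of combinations of
  indicators.\<close>

lemma dyadic_digits:
  fixes x :: real
  assumes "0 \<le> x" "x < 1"
  shows "(\<Sum>i<N. (1 / 2) ^ Suc i * (of_bool (odd \<lfloor>2 ^ Suc i * x\<rfloor>) :: real)) = of_int \<lfloor>2 ^ N * x\<rfloor> / 2 ^ N"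
proof (induction N)
  case 0
  then show ?case using assms by (simp add: floor_eq_iff)
next
  case (Suc N)
  define k where "k = \<lfloor>2 ^ N * x\<rfloor>"
  have "of_int k \<le> 2 ^ N * x" "2 ^ N * x < of_int k + 1"
    unfolding k_def by linarith+
  then have "\<lfloor>2 ^ Suc N * x\<rfloor> = 2 * k \<or> \<lfloor>2 ^ Suc N * x\<rfloor> = 2 * k + 1"
    by (simp add: floor_eq_iff mult.assoc) linarith
  then have "(of_int \<lfloor>2 ^ Suc N * x\<rfloor> :: real) = 2 * of_int k + of_bool (odd \<lfloor>2 ^ Suc N * x\<rfloor>)"
    by auto
  then show ?case
    using Suc by (simp add: k_def field_simps)
qed

section \<open>Bounded Borel functions and their integrals against a projection-valued
  measure\<close>

definition bdd_borel :: "(real \<Rightarrow> real) \<Rightarrow> bool" where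
  "bdd_borel F \<longleftrightarrow> F \<in> borel_measurable borel \<and> (\<exists>M. \<forall>x. \<bar>F x\<bar> \<le> M)"

lemma bdd_borelI: "F \<in> borel_measurable borel \<Longrightarrow> (\<And>x. \<bar>F x\<bar> \<le> M) \<Longrightarrow> bdd_borel F"
  unfolding bdd_borel_def by blast

lemma bdd_borel_measurable: "bdd_borel F \<Longrightarrow> F \<in> borel_measurable borel"
  by (simp add: bdd_borel_def)

lemma bdd_borel_add:
  assumes "bdd_borel F" "bdd_borel G"
  shows "bdd_borel (\<lambda>x. F x + G x)"
proof -
  obtain M N where "\<And>x. \<bar>F x\<bar> \<le> M" "\<And>x. \<bar>G x\<bar> \<le> N"
    using assms unfolding bdd_borel_def by blast
  then show ?thesis
    using assms by (intro bdd_borelI[of _ "M + N"])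
      (auto simp: bdd_borel_def intro: order_trans[OF abs_triangle_ineq] add_mono)
qed

lemma bdd_borel_mult:
  assumes "bdd_borel F" "bdd_borel G"
  shows "bdd_borel (\<lambda>x. F x * G x)"
proof -
  obtain M N where "\<And>x. \<bar>F x\<bar> \<le> M" "\<And>x. \<bar>G x\<bar> \<le> N"
    using assms unfolding bdd_borel_def by blast
  then show ?thesis
    using assms by (intro bdd_borelI[of _ "M * N"])
      (auto simp: bdd_borel_def abs_mult intro: mult_mono order_trans[OF abs_ge_zero])
qed

lemma bdd_borel_const: "bdd_borel (\<lambda>_. c)"
  by (rule bdd_borelI[of _ "\<bar>c\<bar>"]) auto

lemma bdd_borel_indicator: "B \<in> sets borel \<Longrightarrow> bdd_borel (indicator B)"
  by (rule bdd_borelI[of _ 1]) (auto simp: indicator_def)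

lemma bdd_borel_sum: "(\<And>i. i \<in> I \<Longrightarrow> bdd_borel (F i)) \<Longrightarrow> bdd_borel (\<lambda>x. \<Sum>i\<in>I. F i x)"
  by (induction I rule: infinite_finite_induct) (auto intro: bdd_borel_const bdd_borel_add)

lemmas bdd_borel_intros = bdd_borel_add bdd_borel_mult bdd_borel_const bdd_borel_indicator bdd_borel_sum

locale pvm =
  fixes E :: "real set \<Rightarrow> 'h::{real_inner,complete_space} \<Rightarrow> 'h"
  assumes pvm: "is_pvm E"
begin

lemma bounded_linear_E: "B \<in> sets borel \<Longrightarrow> bounded_linear (E B)"
  and E_symmetric: "B \<in> sets borel \<Longrightarrow> inner (E B x) y = inner x (E B y)"
  and E_E: "A \<in> sets borel \<Longrightarrow> B \<in> sets borel \<Longrightarrow> E A (E B x) = E (A \<inter> B) x"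
  and E_UNIV: "E UNIV x = x"
  using pvm unfolding is_pvm_def by auto

lemma E_idem: "B \<in> sets borel \<Longrightarrow> E B (E B x) = E B x"
  by (simp add: E_E)

lemmas E_add = bounded_linear.linear[OF bounded_linear_E, THEN linear_add]
  and E_diff = bounded_linear.linear[OF bounded_linear_E, THEN linear_diff]
  and E_neg = bounded_linear.linear[OF bounded_linear_E, THEN linear_neg]
  and E_zero = bounded_linear.linear[OF bounded_linear_E, THEN linear_0]
  and E_scaleR = bounded_linear.linear[OF bounded_linear_E, THEN linear_scale]

lemma inner_E_self: "B \<in> sets borel \<Longrightarrow> inner (E B x) x = norm (E B x) ^ 2"
  by (metis E_idem E_symmetric power2_norm_eq_inner)

lemma norm_E_le: "B \<in> sets borel \<Longrightarrow> norm (E B x) \<le> norm x"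
proof -
  assume B: "B \<in> sets borel"
  have "norm (E B x) * norm (E B x) \<le> norm (E B x) * norm x"
    using inner_E_self[OF B, of x] norm_cauchy_schwarz[of "E B x" x] by (simp add: power2_eq_square)
  then show ?thesis
    by (cases "E B x = 0") (auto simp: mult_le_cancel_left)
qed

abbreviation \<mu> :: "'h \<Rightarrow> real measure" where "\<mu> \<equiv> spec_meas E"

lemma sets_spec [simp, measurable_cong]: "sets (\<mu> x) = sets borel"
  unfolding spec_meas_def using sets.sigma_sets_eq[of "borel :: real measure"]
  by (simp add: sets_measure_of)

lemma space_spec [simp]: "space (\<mu> x) = UNIV"
  using sets_eq_imp_space_eq[OF sets_spec] by simp

lemma emeasure_spec: "B \<in> sets borel \<Longrightarrow> emeasure (\<mu> x) B = ennreal (norm (E B x) ^ 2)"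
proof -
  assume B: "B \<in> sets borel"
  have "measure_space UNIV (sets borel) (\<lambda>B. ennreal (inner (E B x) x))"
    using pvm unfolding is_pvm_def by blast
  then have "emeasure (\<mu> x) B = ennreal (inner (E B x) x)"
    unfolding spec_meas_def measure_space_def
    by (intro emeasure_measure_of_sigma B) auto
  then show ?thesis by (simp add: inner_E_self B)
qed

lemma measure_spec: "B \<in> sets borel \<Longrightarrow> measure (\<mu> x) B = norm (E B x) ^ 2"
  by (simp add: measure_def emeasure_spec)

sublocale spec: finite_measure "\<mu> x" for x
  by standard (simp add: emeasure_spec)

lemma integrable_spec: "bdd_borel F \<Longrightarrow> integrable (\<mu> x) F"
  unfolding bdd_borel_def
  by (metis (no_types, lifting) AE_I2 measurable_cong_sets real_norm_def sets_spec spec.integrable_const_bound)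

lemma integral_spec_le:
  assumes "bdd_borel F" "\<And>l. F l \<le> M"
  shows "(\<integral>l. F l \<partial>\<mu> x) \<le> M * norm x ^ 2"
proof -
  have "(\<integral>l. F l \<partial>\<mu> x) \<le> (\<integral>l. M \<partial>\<mu> x)"
    by (intro integral_mono integrable_spec bdd_borel_const assms)
  then show ?thesis by (simp add: measure_spec E_UNIV mult.commute)
qed

lemma integral_spec_abs_le:
  assumes "bdd_borel F" "\<And>l. \<bar>F l\<bar> \<le> M"
  shows "\<bar>\<integral>l. F l \<partial>\<mu> x\<bar> \<le> M * norm x ^ 2"
proof -
  have "F l \<le> M" "- F l \<le> M" for l using assms(2)[of l] by auto
  then show ?thesis
    using integral_spec_le[OF assms(1), of M x] integral_spec_le[of "\<lambda>l. - F l" M x]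
      bdd_borel_mult[OF bdd_borel_const[of "-1"] assms(1)] by simp
qed

lemma integral_spec_restrict:
  assumes F: "bdd_borel F" and B: "B \<in> sets borel"
  shows "(\<integral>l. F l \<partial>\<mu> (E B x)) = (\<integral>l. F l * indicator B l \<partial>\<mu> x)"
proof -
  have "\<mu> (E B x) = density (\<mu> x) (indicator B)"
  proof (rule measure_eqI)
    fix A assume "A \<in> sets (\<mu> (E B x))"
    then have A: "A \<in> sets borel" by simp
    then show "emeasure (\<mu> (E B x)) A = emeasure (density (\<mu> x) (indicator B)) A"
      using B by (simp add: emeasure_spec E_E emeasure_restricted Int_commute)
  qed simp
  also have "density (\<mu> x) (indicator B) = density (\<mu> x) (\<lambda>l. ennreal (indicator B l))"
    by (simp add: ennreal_indicator)
  finally have "(\<integral>l. F l \<partial>\<mu> (E B x)) = (\<integral>l. F l \<partial>density (\<mu> x) (\<lambda>l. ennreal (indicator B l)))"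
    by simp
  also have "\<dots> = (\<integral>l. indicator B l *\<^sub>R F l \<partial>\<mu> x)"
    using B bdd_borel_measurable[OF F] by (intro integral_density) (auto cong: measurable_cong_sets)
  finally show ?thesis by (simp add: mult.commute)
qed

text \<open>The pairing with h of the integral of F dE applied to f, polarized from scalar spectral
  measures in the same way as \<open>pvm_op_graph\<close>. Linearity in h is not built in; it comes
  with the representing vector found below.\<close>

definition form :: "(real \<Rightarrow> real) \<Rightarrow> 'h \<Rightarrow> 'h \<Rightarrow> real" where
  "form F f h = ((\<integral>l. F l \<partial>\<mu> (f + h)) - (\<integral>l. F l \<partial>\<mu> (f - h))) / 4"

lemma form_add: "bdd_borel F \<Longrightarrow> bdd_borel G \<Longrightarrow> form (\<lambda>l. F l + G l) f h = form F f h + form G f h"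
  by (simp add: form_def integrable_spec field_simps)

lemma form_cmult: "form (\<lambda>l. c * F l) f h = c * form F f h"
  by (simp add: form_def field_simps)

lemma form_sum: "finite I \<Longrightarrow> (\<And>i. i \<in> I \<Longrightarrow> bdd_borel (F i)) \<Longrightarrow>
    form (\<lambda>l. \<Sum>i\<in>I. F i l) f h = (\<Sum>i\<in>I. form (F i) f h)"
  by (induction I rule: finite_induct) (simp_all add: form_add bdd_borel_sum, simp add: form_def)

lemma form_indicator: "B \<in> sets borel \<Longrightarrow> form (indicator B) f h = inner (E B f) h"
proof -
  assume B: "B \<in> sets borel"
  have "form (indicator B) f h = (norm (E B (f + h)) ^ 2 - norm (E B (f - h)) ^ 2) / 4"
    by (simp add: form_def measure_spec B)
  also have "\<dots> = inner (E B f) (E B h)"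
    by (simp add: E_add E_diff B power2_norm_eq_inner inner_add_left inner_add_right
        inner_diff_left inner_diff_right inner_commute)
  also have "\<dots> = inner (E B f) h"
    by (metis B E_idem E_symmetric)
  finally show ?thesis .
qed

lemma form_self: "form F f f = (\<integral>l. F l \<partial>\<mu> f)"
proof -
  have 0: "\<mu> 0 = null_measure (\<mu> f)"
    by (rule measure_eqI) (simp_all add: emeasure_spec E_zero)
  have 4: "\<mu> (2 *\<^sub>R f) = density (\<mu> f) (\<lambda>_. ennreal 4)"
    by (rule measure_eqI)
      (simp_all add: emeasure_spec E_scaleR power_mult_distrib ennreal_mult' emeasure_density nn_integral_cmult_indicator)
  show ?thesis
  proof (cases "F \<in> borel_measurable borel")
    case True
    have "(\<integral>l. F l \<partial>\<mu> 0) = 0"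
      unfolding 0 by (rule integral_null_measure)
    moreover have "(\<integral>l. F l \<partial>\<mu> (2 *\<^sub>R f)) = 4 * (\<integral>l. F l \<partial>\<mu> f)"
      unfolding 4 using True by (subst integral_density) (auto cong: measurable_cong_sets)
    ultimately show ?thesis
      by (simp add: form_def scaleR_2)
  next
    \<comment> \<open>For non-measurable \<open>F\<close> every integral is 0 by convention, so both
      sides agree.\<close>
    case False
    then have "(\<integral>l. F l \<partial>\<mu> x) = 0" for x
      by (intro not_integrable_integral_eq) (auto simp: borel_measurable_integrable dest!: borel_measurable_integrable cong: measurable_cong_sets)
    then show ?thesis by (simp add: form_def)
  qed
qed

lemma form_bound:
  assumes "bdd_borel F" "\<And>l. \<bar>F l\<bar> \<le> M"
  shows "\<bar>form F f h\<bar> \<le> M * (norm f ^ 2 + norm h ^ 2) / 2"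
proof -
  have "\<bar>form F f h\<bar> \<le> (M * norm (f + h) ^ 2 + M * norm (f - h) ^ 2) / 4"
    using integral_spec_abs_le[OF assms, of "f + h"] integral_spec_abs_le[OF assms, of "f - h"]
    unfolding form_def abs_divide by simp
  also have "\<dots> = M * (norm (f + h) ^ 2 + norm (f - h) ^ 2) / 4"
    by (simp add: distrib_left)
  also have "norm (f + h) ^ 2 + norm (f - h) ^ 2 = 2 * (norm f ^ 2 + norm h ^ 2)"
    by (simp add: power2_norm_eq_inner algebra_simps inner_commute)
  finally show ?thesis by (simp add: field_simps)
qed

lemma spec_minus: "\<mu> (- x) = \<mu> x"
  by (rule measure_eqI) (simp_all add: emeasure_spec E_neg)

lemma form_commute: "form F f h = form F h f"
  using spec_minus[of "f - h"] by (simp add: form_def add.commute)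

text \<open>Split every integral into its parts on \<open>B\<close> and on the complement. On the
  complement \<open>E B f + h\<close> and \<open>E B f - h\<close> project to opposite vectors,
  which have the same spectral measure, so these parts cancel in the polarization.\<close>

lemma form_restrict:
  assumes F: "bdd_borel F" and B: "B \<in> sets borel"
  shows "form F (E B f) h = form (\<lambda>l. F l * indicator B l) f h"
proof -
  have C: "- B \<in> sets borel" using B by (rule borel_comp)
  have split: "(\<integral>l. F l \<partial>\<mu> x) = (\<integral>l. F l \<partial>\<mu> (E B x)) + (\<integral>l. F l \<partial>\<mu> (E (- B) x))" for x
  proof -
    have "F l = F l * indicator B l + F l * indicator (- B) l" for l
      by (simp add: indicator_def)
    then have "(\<integral>l. F l \<partial>\<mu> x) = (\<integral>l. F l * indicator B l + F l * indicator (- B) l \<partial>\<mu> x)"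
      by presburger
    then show ?thesis
      using F B C by (simp add: integral_spec_restrict integrable_spec bdd_borel_intros)
  qed
  have EC: "E (- B) (E B f) = 0"
    using B C E_UNIV E_E[OF C B, of f] measure_spec[of "{}" f] by simp
  have "form F (E B f) h = ((\<integral>l. F l \<partial>\<mu> (E B (f + h))) - (\<integral>l. F l \<partial>\<mu> (E B (f - h)))) / 4"
    unfolding form_def split[of "E B f + h"] split[of "E B f - h"]
    using spec_minus[of "E (- B) h"]
    by (simp add: E_add[OF B] E_add[OF C] E_diff[OF B] E_diff[OF C] E_idem[OF B] EC)
  then show ?thesis
    by (simp add: form_def integral_spec_restrict F B)
qed

lemma norm_le_from_form:
  assumes "bdd_borel F" "\<And>l. \<bar>F l\<bar> \<le> M" "\<And>h. inner v h = form F f h"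
  shows "norm v \<le> M * norm f"
proof (rule norm_le_from_inner_bound)
  show "0 \<le> M" using assms(2)[of 0] by simp
  show "inner v h \<le> M * (norm f ^ 2 + norm h ^ 2) / 2" for h
    using form_bound[OF assms(1,2), of f h] assms(3)[of h] by linarith
qed

text \<open>The representing vector is a limit of finite sums over the sets \<open>D i\<close> where
  the i-th binary digit of \<open>F\<close> is 1. The partial sums are uniformly within (1/2)^N of
  \<open>F\<close>, and \<open>form_bound\<close> turns this into a Cauchy estimate for the
  vectors.\<close>

lemma form_represented_unit:
  assumes F: "F \<in> borel_measurable borel" "\<And>x. 0 \<le> F x" "\<And>x. F x < 1"
  shows "\<exists>v. \<forall>h. inner v h = form F f h"
proof -
  define D where "D i = {x. odd \<lfloor>2 ^ Suc i * F x\<rfloor>}" for i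
  have D: "D i \<in> sets borel" for i
    unfolding D_def using F(1) by measurable
  define Fn where "Fn N = (\<lambda>x. \<Sum>i<N. (1 / 2) ^ Suc i * (indicator (D i) x :: real))" for N
  define v where "v N = (\<Sum>i<N. (1 / 2) ^ Suc i *\<^sub>R E (D i) f)" for N
  have bF: "bdd_borel F"
    using F by (intro bdd_borelI[of _ 1]) (auto intro: less_imp_le)
  have bFn: "bdd_borel (Fn N)" for N
    unfolding Fn_def by (intro bdd_borel_intros D)
  have Fn: "\<bar>F x - Fn N x\<bar> \<le> (1 / 2) ^ N" for x N
  proof -
    have "Fn N x = of_int \<lfloor>2 ^ N * F x\<rfloor> / 2 ^ N"
      using dyadic_digits[OF F(2)[of x] F(3)[of x], of N] by (simp add: Fn_def D_def indicator_def of_bool_def)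
    moreover have "\<bar>2 ^ N * F x - of_int \<lfloor>2 ^ N * F x\<rfloor>\<bar> \<le> 1" by linarith
    ultimately show ?thesis
      by (simp add: field_simps abs_mult[symmetric] abs_if split: if_splits)
  qed
  have inner_v: "inner (v N) h = form (Fn N) f h" for N h
    unfolding v_def Fn_def
    by (subst form_sum)
      (simp_all only: inner_sum_left inner_scaleR_left form_cmult form_indicator D bdd_borel_intros finite_lessThan)
  have bdiff: "bdd_borel (\<lambda>x. F x + (-1) * Fn N x)" for N
    by (intro bdd_borel_intros bF bFn)
  have diff: "\<bar>inner (v N) h - form F f h\<bar> \<le> (1 / 2) ^ N * (norm f ^ 2 + norm h ^ 2) / 2" for N h
  proof -
    have "form (\<lambda>x. F x + (-1) * Fn N x) f h = form F f h - inner (v N) h"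
      using form_add[OF bF bdd_borel_mult[OF bdd_borel_const[of "-1"] bFn[of N]], of f h]
        form_cmult[of "-1" "Fn N" f h] inner_v[of N h] by simp
    then show ?thesis
      using form_bound[OF bdiff[of N], of "(1 / 2) ^ N" f h] Fn[of _ N]
      by (simp add: abs_minus_commute)
  qed
  have "Cauchy v"
  proof (rule metric_CauchyI)
    have dist_le: "dist (v m) (v n) \<le> ((1 / 2) ^ m + (1 / 2) ^ n) * norm f" for m n
      unfolding dist_norm
    proof (rule norm_le_from_inner_bound)
      fix h
      have "inner (v m - v n) h \<le> \<bar>inner (v m) h - form F f h\<bar> + \<bar>inner (v n) h - form F f h\<bar>"
        by (simp add: inner_diff_left)
      also have "\<dots> \<le> ((1 / 2) ^ m + (1 / 2) ^ n) * (norm f ^ 2 + norm h ^ 2) / 2"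
        using diff[of m h] diff[of n h] by (simp add: distrib_right)
      finally show "inner (v m - v n) h \<le> ((1 / 2) ^ m + (1 / 2) ^ n) * (norm f ^ 2 + norm h ^ 2) / 2" .
    qed simp
    fix e :: real assume "0 < e"
    have "(\<lambda>n. (1 / 2) ^ n * norm f) \<longlonglongrightarrow> 0"
      by (auto intro!: tendsto_eq_intros LIMSEQ_realpow_zero)
    from order_tendstoD(2)[OF this, of "e / 2"] \<open>0 < e\<close>
    obtain M where M: "\<And>n. n \<ge> M \<Longrightarrow> (1 / 2) ^ n * norm f < e / 2"
      unfolding eventually_sequentially by auto
    have "dist (v m) (v n) < e" if "m \<ge> M" "n \<ge> M" for m n
      using dist_le[of m n] M[OF that(1)] M[OF that(2)] by (simp add: distrib_right)
    then show "\<exists>M. \<forall>m\<ge>M. \<forall>n\<ge>M. dist (v m) (v n) < e" by blast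
  qed
  then obtain w where w: "v \<longlonglongrightarrow> w"
    using Cauchy_convergent convergent_def by blast
  have "inner w h = form F f h" for h
  proof (rule LIMSEQ_unique)
    show "(\<lambda>N. inner (v N) h) \<longlonglongrightarrow> inner w h" by (intro tendsto_intros w)
    have "(\<lambda>N. inner (v N) h - form F f h) \<longlonglongrightarrow> 0"
    proof (rule Lim_null_comparison)
      show "\<forall>\<^sub>F N in sequentially. norm (inner (v N) h - form F f h) \<le> (1 / 2) ^ N * (norm f ^ 2 + norm h ^ 2) / 2"
        using diff by simp
      show "(\<lambda>N. (1 / 2) ^ N * (norm f ^ 2 + norm h ^ 2) / 2) \<longlonglongrightarrow> 0"
        by (auto intro!: tendsto_eq_intros LIMSEQ_realpow_zero)
    qed
    then show "(\<lambda>N. inner (v N) h) \<longlonglongrightarrow> form F f h"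
      by (simp add: LIM_zero_iff)
  qed
  then show ?thesis by blast
qed

lemma form_represented:
  assumes F: "bdd_borel F"
  shows "\<exists>v. \<forall>h. inner v h = form F f h"
proof -
  obtain M0 where M0: "\<And>x. \<bar>F x\<bar> \<le> M0" and m: "F \<in> borel_measurable borel"
    using F unfolding bdd_borel_def by blast
  define M where "M = M0 + 1"
  have M: "\<bar>F x\<bar> < M" for x using M0[of x] by (simp add: M_def)
  have M_pos: "M > 0" using M[of 0] by linarith
  \<comment> \<open>An affine rescaling into [0, 1), where \<open>M\<close> exceeds
    \<open>M0\<close> by 1 to make the upper bound strict. The constant is written as an indicator
    so that \<open>form_indicator\<close> evaluates its share.\<close>
  define G where "G = (\<lambda>x. (1 / (2 * M)) * F x + (1 / 2) * indicator UNIV x)"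
  have "G \<in> borel_measurable borel" unfolding G_def using m by measurable
  moreover have "0 \<le> G x" "G x < 1" for x
    using M[of x] M_pos by (auto simp: G_def field_simps abs_less_iff)
  ultimately obtain v where v: "\<And>h. inner v h = form G f h"
    using form_represented_unit by blast
  have UNIV: "UNIV \<in> sets (borel :: real measure)" by simp
  have b: "bdd_borel (\<lambda>x. (1 / (2 * M)) * F x)" "bdd_borel (\<lambda>x. (1 / 2) * indicator UNIV x)"
    by (intro bdd_borel_intros F UNIV)+
  have "form G f h = (1 / (2 * M)) * form F f h + inner f h / 2" for h
    unfolding G_def form_add[OF b] form_cmult form_indicator[OF UNIV] E_UNIV by simp
  then have "inner ((2 * M) *\<^sub>R v - M *\<^sub>R f) h = form F f h" for h
    using v[of h] M_pos by (simp add: inner_diff_left field_simps)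
  then show ?thesis by blast
qed

definition fcalc :: "(real \<Rightarrow> real) \<Rightarrow> 'h \<Rightarrow> 'h" where
  "fcalc F f = (SOME v. \<forall>h. inner v h = form F f h)"

lemma inner_fcalc: "bdd_borel F \<Longrightarrow> inner (fcalc F f) h = form F f h"
  using someI_ex[OF form_represented] unfolding fcalc_def by blast

lemma fcalc_symmetric: "bdd_borel F \<Longrightarrow> inner (fcalc F f) h = inner f (fcalc F h)"
  by (metis form_commute inner_commute inner_fcalc)

lemma fcalc_E:
  assumes "bdd_borel F" "B \<in> sets borel"
  shows "fcalc F (E B f) = fcalc (\<lambda>l. F l * indicator B l) f"
    and "E B (fcalc F f) = fcalc (\<lambda>l. F l * indicator B l) f"
proof -
  have b: "bdd_borel (\<lambda>l. F l * indicator B l)" by (intro bdd_borel_intros assms)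
  have "inner (fcalc F (E B f)) h = inner (fcalc (\<lambda>l. F l * indicator B l) f) h" for h
    by (simp add: inner_fcalc assms b form_restrict)
  then show "fcalc F (E B f) = fcalc (\<lambda>l. F l * indicator B l) f"
    using vector_eq_rdot by blast
  have "inner (E B (fcalc F f)) h = inner (fcalc (\<lambda>l. F l * indicator B l) f) h" for h
    using assms b by (metis E_symmetric form_commute form_restrict inner_fcalc)
  then show "E B (fcalc F f) = fcalc (\<lambda>l. F l * indicator B l) f"
    using vector_eq_rdot by blast
qed

lemma norm_fcalc_le:
  assumes "bdd_borel F" "\<And>l. \<bar>F l\<bar> \<le> M"
  shows "norm (fcalc F f) \<le> M * norm f"
  by (rule norm_le_from_form[OF assms]) (simp add: inner_fcalc assms)

lemma inner_fcalc_self: "bdd_borel F \<Longrightarrow> inner (fcalc F f) f = (\<integral>l. F l \<partial>\<mu> f)"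
  by (simp add: inner_fcalc form_self)

end

subsection \<open>The self-adjoint operator of a projection-valued measure\<close>

context pvm
begin

definition trunc :: "nat \<Rightarrow> real \<Rightarrow> real" where
  "trunc n l = indicator {- real n..real n} l * l"

abbreviation P :: "nat \<Rightarrow> 'h \<Rightarrow> 'h" where "P n \<equiv> E {- real n..real n}"
abbreviation A :: "nat \<Rightarrow> 'h \<Rightarrow> 'h" where "A n \<equiv> fcalc (trunc n)"

lemma bdd_borel_trunc: "bdd_borel (trunc n)"
proof (rule bdd_borelI)
  show "trunc n \<in> borel_measurable borel" unfolding trunc_def by measurable
  show "\<bar>trunc n l\<bar> \<le> real n" for l by (auto simp: trunc_def indicator_def)
qed

text \<open>Testing against all \<open>h\<close> turns the polarized definition into an operator
  identity on each spectral window; \<open>A n\<close> is the bounded part of the operator on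
  [-n, n].\<close>

lemma graph_iff:
  "(f, g) \<in> pvm_op_graph E \<longleftrightarrow> integrable (\<mu> f) (\<lambda>l. l ^ 2) \<and> (\<forall>n. P n g = A n f)"
proof -
  have "(\<forall>h. inner g (P n h) = form (trunc n) f h) \<longleftrightarrow> P n g = A n f" for n
    by (simp add: E_symmetric[symmetric] inner_fcalc[OF bdd_borel_trunc, symmetric])
      (metis vector_eq_rdot)
  then show ?thesis
    unfolding pvm_op_graph_def by (auto simp: form_def trunc_def)
qed

lemma P_tendsto: "(\<lambda>n. P n f) \<longlonglongrightarrow> f"
proof -
  have "norm (f - P n f) ^ 2 = norm f ^ 2 - norm (P n f) ^ 2" for n
    using inner_E_self[of "{- real n..real n}" f]
    by (simp add: power2_norm_eq_inner inner_diff_left inner_diff_right inner_commute)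
  moreover have "(\<lambda>n. measure (\<mu> f) {- real n..real n}) \<longlonglongrightarrow> measure (\<mu> f) (\<Union>n. {- real n..real n})"
    by (rule spec.finite_Lim_measure_incseq) (auto simp: incseq_def)
  moreover have "(\<Union>n. {- real n..real n}) = UNIV"
  proof -
    have "\<exists>n. - real n \<le> x \<and> x \<le> real n" for x
      using real_arch_simple[of "\<bar>x\<bar>"] by (metis abs_le_iff minus_le_iff)
    then show ?thesis by auto
  qed
  ultimately have "(\<lambda>n. norm (f - P n f) ^ 2) \<longlonglongrightarrow> 0"
    by (simp add: measure_spec E_UNIV LIM_zero_iff[symmetric, of _ "norm f ^ 2"])
      (use tendsto_minus in fastforce)
  then have "(\<lambda>n. norm (f - P n f)) \<longlonglongrightarrow> 0"
    using tendsto_real_sqrt by fastforce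
  then show ?thesis
    by (simp add: tendsto_iff dist_norm norm_minus_commute)
qed

lemma P_A: "P m (A n f) = A m (P n f)"
proof -
  have "(\<lambda>l. trunc n l * indicator {- real m..real m} l) = (\<lambda>l. trunc m l * indicator {- real n..real n} l)"
    by (auto simp: trunc_def indicator_def)
  then show ?thesis by (simp add: fcalc_E bdd_borel_trunc)
qed

lemma E_A: "B \<in> sets borel \<Longrightarrow> E B (A n f) = A n (E B f)"
  by (simp add: fcalc_E bdd_borel_trunc)

text \<open>Truncation produces graph elements from arbitrary vectors; these are the test pairs in
  the form and self-adjointness arguments below.\<close>

lemma P_in_graph: "(P n f, A n f) \<in> pvm_op_graph E"
  unfolding graph_iff
proof
  have "\<mu> (P n f) = density (\<mu> f) (\<lambda>l. ennreal (indicator {- real n..real n} l))"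
    by (rule measure_eqI) (simp_all add: emeasure_spec E_E ennreal_indicator emeasure_restricted Int_commute)
  moreover have "bdd_borel (\<lambda>l. indicator {- real n..real n} l *\<^sub>R l ^ 2)"
  proof (rule bdd_borelI)
    show "\<bar>indicator {- real n..real n} l *\<^sub>R l ^ 2\<bar> \<le> real n ^ 2" for l
      using abs_le_square_iff[of l "real n"] by (auto simp: indicator_def)
  qed measurable
  ultimately show "integrable (\<mu> (P n f)) (\<lambda>l. l ^ 2)"
    using integrable_spec[of _ f]
    by (simp add: integrable_density cong: measurable_cong_sets)
  show "\<forall>m. P m (A n f) = A m (P n f)"
    by (simp add: P_A)
qed

lemma A_symmetric: "inner (A n f) h = inner f (A n h)"
  by (rule fcalc_symmetric[OF bdd_borel_trunc])

lemma inner_A_E: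
  assumes B: "B \<in> sets borel"
  shows "inner (A n (E B f)) (P n (E B f)) = inner (A n (E B f)) f"
    and "inner (A n (E B f)) f = (\<integral>l. trunc n l * indicator B l \<partial>\<mu> f)"
proof -
  have b: "bdd_borel (\<lambda>l. trunc n l * indicator B l)"
    by (intro bdd_borel_intros bdd_borel_trunc B)
  have 1: "A n (E B f) = fcalc (\<lambda>l. trunc n l * indicator B l) f" for f
    by (rule fcalc_E[OF bdd_borel_trunc B])
  show "inner (A n (E B f)) f = (\<integral>l. trunc n l * indicator B l \<partial>\<mu> f)"
    unfolding 1 by (rule inner_fcalc_self[OF b])
  have trunc_mult: "(\<lambda>l. trunc n l * indicator {- real n..real n} l) = trunc n"
    by (auto simp: trunc_def indicator_def)
  have "P n (A n (E B f)) = A n (E B f)"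
    by (simp only: fcalc_E(2)[OF bdd_borel_trunc atLeastAtMost_borel] trunc_mult)
  then have "inner (A n (E B f)) (P n (E B f)) = inner (E B (A n f)) (E B f)"
    by (metis E_A[OF B] E_symmetric atLeastAtMost_borel)
  also have "\<dots> = inner (A n (E B f)) f"
    by (metis B E_A E_idem E_symmetric)
  finally show "inner (A n (E B f)) (P n (E B f)) = inner (A n (E B f)) f" .
qed

lemma integral_trunc_lower:
  assumes B: "B \<in> sets borel" "B \<subseteq> {s..}"
  shows "s * norm (P n (E B f)) ^ 2 \<le> (\<integral>l. trunc n l * indicator B l \<partial>\<mu> f)"
proof -
  have "s * norm (P n (E B f)) ^ 2 = (\<integral>l. s * indicator ({- real n..real n} \<inter> B) l \<partial>\<mu> f)"
    using B by (simp add: E_E measure_spec)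
  also have "\<dots> \<le> (\<integral>l. trunc n l * indicator B l \<partial>\<mu> f)"
  proof (rule integral_mono)
    show "integrable (\<mu> f) (\<lambda>l. s * indicator ({- real n..real n} \<inter> B) l)"
      using B by (intro integrable_spec bdd_borel_intros) auto
    show "integrable (\<mu> f) (\<lambda>l. trunc n l * indicator B l)"
      using B by (intro integrable_spec bdd_borel_intros bdd_borel_trunc)
    show "s * indicator ({- real n..real n} \<inter> B) l \<le> trunc n l * indicator B l" for l
      using B(2) by (auto simp: indicator_def trunc_def)
  qed
  finally show ?thesis .
qed

lemma integral_trunc_upper:
  assumes B: "B \<in> sets borel" "B \<subseteq> {..s}"
  shows "(\<integral>l. trunc n l * indicator B l \<partial>\<mu> f) \<le> s * norm (P n (E B f)) ^ 2"
proof -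
  have "(\<integral>l. trunc n l * indicator B l \<partial>\<mu> f) \<le> (\<integral>l. s * indicator ({- real n..real n} \<inter> B) l \<partial>\<mu> f)"
  proof (rule integral_mono)
    show "integrable (\<mu> f) (\<lambda>l. s * indicator ({- real n..real n} \<inter> B) l)"
      using B by (intro integrable_spec bdd_borel_intros) auto
    show "integrable (\<mu> f) (\<lambda>l. trunc n l * indicator B l)"
      using B by (intro integrable_spec bdd_borel_intros bdd_borel_trunc)
    show "trunc n l * indicator B l \<le> s * indicator ({- real n..real n} \<inter> B) l" for l
      using B(2) by (auto simp: indicator_def trunc_def)
  qed
  also have "\<dots> = s * norm (P n (E B f)) ^ 2"
    using B by (simp add: E_E measure_spec)
  finally show ?thesis .
qed

text \<open>\<open>A n (E B f)\<close> equals \<open>P n (E B g)\<close>, so with x =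
  \<open>P n (E B f)\<close> the truncated form gives s |x|^2 \<le> <P n (E B g), x>. Cauchy-Schwarz
  cancels one factor |x|, and n tends to infinity.\<close>

lemma spectral_tail_graph:
  assumes graph: "(f, g) \<in> pvm_op_graph E" and B: "B \<in> sets borel" "B \<subseteq> {s..}" and "0 \<le> s"
  shows "s * norm (E B f) \<le> norm (E B g)"
proof (rule LIMSEQ_le[OF tendsto_mult_left[OF tendsto_norm[OF P_tendsto]] tendsto_norm[OF P_tendsto]])
  have "s * norm (P n (E B f)) \<le> norm (P n (E B g))" for n
  proof -
    have "A n (E B f) = E B (P n g)"
      using graph by (simp add: E_A[OF B(1), symmetric] graph_iff)
    also have "\<dots> = P n (E B g)"
      using B(1) by (simp add: E_E Int_commute)
    finally have "A n (E B f) = P n (E B g)" .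
    then have "s * norm (P n (E B f)) ^ 2 \<le> inner (P n (E B g)) (P n (E B f))"
      using integral_trunc_lower[OF B, of n f] inner_A_E[OF B(1), of n f] by simp
    also have "\<dots> \<le> norm (P n (E B g)) * norm (P n (E B f))"
      by (rule norm_cauchy_schwarz)
    finally show ?thesis
      by (cases "P n (E B f) = 0") (auto simp: power2_eq_square mult.assoc[symmetric] mult_le_cancel_right)
  qed
  then show "\<exists>N. \<forall>n\<ge>N. s * norm (P n (E B f)) \<le> norm (P n (E B g))" by blast
qed

text \<open>Here \<open>f\<close> need not lie in the domain: the hypothesis says that it lies in
  the form domain with energy at most \<open>N\<close>. Testing with the truncation of
  \<open>E B f\<close> makes both inner products the same number w, and w^2 \<le> N w forces w \<le>
  N.\<close>

lemma spectral_tail_form: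
  assumes form: "\<And>u w. (u, w) \<in> pvm_op_graph E \<Longrightarrow> inner w f ^ 2 \<le> N * inner w u"
    and B: "B \<in> sets borel" "B \<subseteq> {s..}" and "0 \<le> s" "0 \<le> N"
  shows "s * norm (E B f) ^ 2 \<le> N"
proof (rule LIMSEQ_le_const2[OF tendsto_mult_left[OF tendsto_power[OF tendsto_norm[OF P_tendsto]]]])
  have "s * norm (P n (E B f)) ^ 2 \<le> N" for n
  proof -
    define w where "w = inner (A n (E B f)) f"
    have "w ^ 2 \<le> N * w"
      using form[OF P_in_graph[of n "E B f"]] inner_A_E(1)[OF B(1), of n f] by (simp add: w_def)
    then have "w \<le> N"
      using \<open>0 \<le> N\<close> by (cases "w \<le> 0") (auto simp: power2_eq_square)
    then show ?thesis
      using integral_trunc_lower[OF B, of n f] inner_A_E(2)[OF B(1), of n f] by (simp add: w_def)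
  qed
  then show "\<exists>N0. \<forall>n\<ge>N0. s * norm (P n (E B f)) ^ 2 \<le> N" by blast
qed

text \<open>On \<open>{..- s}\<close> the truncated quadratic form is at most -s |x|^2, so
  nonnegativity forces x = 0; countably many such half-lines exhaust \<open>{..<0}\<close>.\<close>

lemma spectral_negative_part:
  assumes pos: "\<And>u w. (u, w) \<in> pvm_op_graph E \<Longrightarrow> 0 \<le> inner w u"
  shows "E {..<0} f = 0"
proof -
  have neg: "E {..- s} f = 0" if "s > 0" for s
  proof -
    have B: "{..- s} \<in> sets borel" by simp
    have "norm (P n (E {..- s} f)) = 0" for n
    proof -
      have "0 \<le> - s * norm (P n (E {..- s} f)) ^ 2"
        using pos[OF P_in_graph[of n "E {..- s} f"]] inner_A_E[OF B, of n f]
          integral_trunc_upper[OF B order_refl, where n = n and f = f] by simp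
      then show ?thesis using \<open>s > 0\<close>
        by (simp add: mult_le_0_iff)
    qed
    then show ?thesis
      using LIMSEQ_unique[OF P_tendsto[of "E {..- s} f"], of 0] by simp
  qed
  have "{..- inverse (real (Suc k))} \<in> null_sets (\<mu> f)" for k
    using neg[of "inverse (real (Suc k))"] by (simp add: null_sets_def emeasure_spec)
  then have "(\<Union>k. {..- inverse (real (Suc k))}) \<in> null_sets (\<mu> f)"
    by (rule null_sets_UN)
  moreover have "(\<Union>k. {..- inverse (real (Suc k))}) = {..<0}"
  proof -
    have "(\<exists>k. x \<le> - inverse (real (Suc k))) \<longleftrightarrow> x < 0" for x :: real
    proof
      assume "\<exists>k. x \<le> - inverse (real (Suc k))"
      then obtain k where "x \<le> - inverse (real (Suc k))" ..
      moreover have "0 < inverse (real (Suc k))" by simp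
      ultimately show "x < 0" by linarith
    next
      assume "x < 0"
      then obtain k where "inverse (real (Suc k)) < - x"
        using reals_Archimedean[of "- x"] by auto
      then have "x \<le> - inverse (real (Suc k))" by linarith
      then show "\<exists>k. x \<le> - inverse (real (Suc k))" ..
    qed
    then show ?thesis by auto
  qed
  ultimately show ?thesis
    by (simp add: null_sets_def emeasure_spec)
qed

lemma graph_unique: "(f, g) \<in> pvm_op_graph E \<Longrightarrow> (f, g') \<in> pvm_op_graph E \<Longrightarrow> g = g'"
  using LIMSEQ_unique[OF P_tendsto[of g]] P_tendsto[of g'] by (simp add: graph_iff)

lemma graph_symmetric:
  assumes "(f, g) \<in> pvm_op_graph E" "(u, w) \<in> pvm_op_graph E"
  shows "inner g u = inner f w"
proof (rule LIMSEQ_unique)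
  show "(\<lambda>n. inner (P n g) u) \<longlonglongrightarrow> inner g u"
    by (intro tendsto_intros P_tendsto)
  have "inner (P n g) u = inner f (P n w)" for n
    using assms by (simp add: graph_iff A_symmetric)
  then show "(\<lambda>n. inner (P n g) u) \<longlonglongrightarrow> inner f w"
    by (simp add: tendsto_intros P_tendsto)
qed

text \<open>Closedness supplies the finite second moment demanded by \<open>graph_iff\<close>: the
  truncated pairs lie in the graph and converge to (f, g).\<close>

lemma graphI:
  assumes "closed (pvm_op_graph E)" and "\<And>n. P n g = A n f"
  shows "(f, g) \<in> pvm_op_graph E"
proof (rule closed_sequentially[OF assms(1)])
  show "(P n f, P n g) \<in> pvm_op_graph E" for n
    by (simp add: P_in_graph assms(2))
  show "(\<lambda>n. (P n f, P n g)) \<longlonglongrightarrow> (f, g)"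
    by (intro tendsto_intros P_tendsto)
qed

text \<open>Testing the symmetry relation on the pairs (P n h, A n h) with arbitrary
  \<open>h\<close> recovers \<open>P n g = A n f\<close>.\<close>

lemma graph_self_adjoint:
  assumes "closed (pvm_op_graph E)"
    and sym: "\<And>u w. (u, w) \<in> pvm_op_graph E \<Longrightarrow> inner w f = inner u g"
  shows "(f, g) \<in> pvm_op_graph E"
proof (rule graphI[OF assms(1)])
  fix n
  have "inner (P n g) h = inner (A n f) h" for h
    using sym[OF P_in_graph[of n h]] by (metis A_symmetric E_symmetric atLeastAtMost_borel inner_commute)
  then show "P n g = A n f"
    using vector_eq_rdot by blast
qed

text \<open>That \<open>g\<close> stays in the same spectral range is what lets the Bernstein
  inequality be iterated.\<close>

lemma graph_bounded_spectrum:
  assumes "0 \<le> s"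
  shows "\<exists>g. (E {0..s} f, g) \<in> pvm_op_graph E \<and> E {0..s} g = g \<and> norm g \<le> s * norm (E {0..s} f)"
proof -
  obtain n :: nat where n: "s \<le> real n" using real_arch_simple by blast
  have B: "{0..s} \<in> sets borel" by simp
  have "{- real n..real n} \<inter> {0..s} = {0..s}" using n by auto
  then have Pn: "P n (E {0..s} f) = E {0..s} f"
    using E_E[OF atLeastAtMost_borel B] by metis
  define g where "g = A n (E {0..s} f)"
  have "(E {0..s} f, g) \<in> pvm_op_graph E"
    using P_in_graph[of n "E {0..s} f"] Pn by (simp add: g_def)
  moreover have "E {0..s} g = g"
    by (simp add: g_def E_A E_idem)
  moreover have "norm g \<le> s * norm (E {0..s} f)"
  proof -
    have "g = A n (E {0..s} (E {0..s} f))" by (simp add: g_def E_idem)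
    also have "\<dots> = fcalc (\<lambda>l. trunc n l * indicator {0..s} l) (E {0..s} f)"
      by (rule fcalc_E[OF bdd_borel_trunc B])
    also have "norm \<dots> \<le> s * norm (E {0..s} f)"
      by (rule norm_fcalc_le, intro bdd_borel_intros bdd_borel_trunc B)
        (use \<open>0 \<le> s\<close> in \<open>auto simp: trunc_def indicator_def\<close>)
    finally show ?thesis .
  qed
  ultimately show ?thesis by blast
qed

end

subsection \<open>Regularity of the Laplacian\<close>

locale axb_laplacian = axb_rep T + pvm E
  for T :: "real \<times> real \<Rightarrow> 'h::{real_inner,complete_space} \<Rightarrow> 'h" and E :: "real set \<Rightarrow> 'h \<Rightarrow> 'h" +
  assumes graph_eq: "pvm_op_graph E = closure (lap_graph T)"
begin

abbreviation \<D> :: "nat \<Rightarrow> 'h \<Rightarrow> 'h \<Rightarrow> bool" where "\<D> j \<equiv> G.D j"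

text \<open>Double indices list the outer operator first: \<open>f12\<close> is A_1 A_2 f. The
  remaining word A_2 A_1 f equals \<open>f12 - f2\<close> by the commutation relation, see
  \<open>jet2_D21\<close>.\<close>

definition jet2 :: "'h \<Rightarrow> 'h \<Rightarrow> 'h \<Rightarrow> 'h \<Rightarrow> 'h \<Rightarrow> 'h \<Rightarrow> bool" where
  "jet2 f f1 f2 f11 f12 f22 \<longleftrightarrow> \<D> 1 f f1 \<and> \<D> 2 f f2 \<and> \<D> 1 f1 f11 \<and> \<D> 1 f2 f12 \<and> \<D> 2 f2 f22"

lemma jet2_unique:
  assumes "jet2 f f1 f2 f11 f12 f22" "jet2 f g1 g2 g11 g12 g22"
  shows "f1 = g1" "f2 = g2" "f11 = g11" "f12 = g12" "f22 = g22"
proof -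
  show *: "f1 = g1" "f2 = g2"
    using assms G.D_unique unfolding jet2_def by blast+
  show "f11 = g11" "f12 = g12" "f22 = g22"
    using assms G.D_unique unfolding jet2_def * by blast+
qed

lemma jet2_diff:
  assumes "jet2 f f1 f2 f11 f12 f22" "jet2 g g1 g2 g11 g12 g22"
  shows "jet2 (f - g) (f1 - g1) (f2 - g2) (f11 - g11) (f12 - g12) (f22 - g22)"
  using assms unfolding jet2_def by (simp add: G.D_diff)

lemma jet2_D21: "jet2 f f1 f2 f11 f12 f22 \<Longrightarrow> \<D> 2 f1 (f12 - f2)"
  unfolding jet2_def by (blast intro: D_commutator)

lemma words_bound_jet2:
  assumes "words_bound T (Suc (Suc k)) f M"
  obtains f1 f2 f11 f12 f22 where "jet2 f f1 f2 f11 f12 f22"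
    "words_bound T (Suc k) f1 M" "words_bound T (Suc k) f2 M"
    "words_bound T k f11 M" "words_bound T k f12 M" "words_bound T k f22 M"
    "words_bound T k (f12 - f2) M"
proof -
  obtain f1 f2 where 1: "\<D> 1 f f1" "words_bound T (Suc k) f1 M" "\<D> 2 f f2" "words_bound T (Suc k) f2 M"
    using words_bound_SucD[OF assms, of 1] words_bound_SucD[OF assms, of 2] by (auto simp: D_iff)
  obtain f11 f21 where 2: "\<D> 1 f1 f11" "words_bound T k f11 M" "\<D> 2 f1 f21" "words_bound T k f21 M"
    using words_bound_SucD[OF 1(2), of 1] words_bound_SucD[OF 1(2), of 2] by (auto simp: D_iff)
  obtain f12 f22 where 3: "\<D> 1 f2 f12" "words_bound T k f12 M" "\<D> 2 f2 f22" "words_bound T k f22 M"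
    using words_bound_SucD[OF 1(4), of 1] words_bound_SucD[OF 1(4), of 2] by (auto simp: D_iff)
  have "f21 = f12 - f2"
    using D_commutator[OF 1(3) 3(1) 1(1)] 2(3) G.D_unique by blast
  with 1 2 3 that show ?thesis
    unfolding jet2_def by blast
qed

lemma jet2_words_bound:
  assumes "jet2 f f1 f2 f11 f12 f22" "norm f \<le> M" "norm f1 \<le> M" "norm f2 \<le> M" "norm f11 \<le> M"
    "norm f12 \<le> M" "norm f22 \<le> M" "norm (f12 - f2) \<le> M"
  shows "words_bound T 2 f M"
  using assms jet2_D21[OF assms(1)] unfolding jet2_def D_iff by (auto simp: numeral_2_eq_2)

lemma jet2_green:
  assumes "jet2 f f1 f2 f11 f12 f22" "\<D> 1 h h1" "\<D> 2 h h2"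
  shows "inner (- f11 - f22) h = inner f1 h1 + inner f2 h2"
  using assms G.D_skew[of 1 f1 f11 h h1] G.D_skew[of 2 f2 f22 h h2] unfolding jet2_def
  by (simp add: inner_diff_left)

lemma jet2_energy:
  assumes "jet2 f f1 f2 f11 f12 f22"
  shows "inner (- f11 - f22) f = norm f1 ^ 2 + norm f2 ^ 2"
  using jet2_green[OF assms, of f f1 f2] assms unfolding jet2_def by (simp add: power2_norm_eq_inner)

lemma lap_graph_jet2:
  assumes "jet2 v v1 v2 v11 v12 v22" "v \<in> garding_space T"
  shows "(v, - v11 - v22) \<in> lap_graph T"
proof -
  have "appl T [1, 1] v = Some v11" "appl T [2, 2] v = Some v22"
    using assms(1) unfolding jet2_def D_iff gen_eq_Some_iff[symmetric] by simp_all
  with assms(2) show ?thesis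
    unfolding lap_graph_def by force
qed

lemma lap_graphE:
  assumes "(v, w) \<in> lap_graph T"
  obtains M v1 v2 v11 v12 v22 where "v \<in> garding_space T" "jet2 v v1 v2 v11 v12 v22"
    "w = - v11 - v22" "words_bound T (Suc (Suc k)) v1 M" "words_bound T (Suc (Suc k)) v2 M"
    "words_bound T (Suc k) v11 M" "words_bound T (Suc k) v12 M" "words_bound T (Suc k) v22 M"
proof -
  have v: "v \<in> garding_space T"
    using assms unfolding lap_graph_def by blast
  then obtain M where "words_bound T (Suc (Suc (Suc k))) v M"
    using garding_space_words_bound by blast
  then obtain v1 v2 v11 v12 v22 where *: "jet2 v v1 v2 v11 v12 v22"
    "words_bound T (Suc (Suc k)) v1 M" "words_bound T (Suc (Suc k)) v2 M" "words_bound T (Suc k) v11 M"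
    "words_bound T (Suc k) v12 M" "words_bound T (Suc k) v22 M" "words_bound T (Suc k) (v12 - v2) M"
    by (rule words_bound_jet2)
  have "w = - v11 - v22"
  proof -
    have "appl T [1, 1] v = Some v11" "appl T [2, 2] v = Some v22"
      using *(1) unfolding jet2_def D_iff gen_eq_Some_iff[symmetric] by simp_all
    then show ?thesis
      using assms unfolding lap_graph_def by auto
  qed
  with v * that show ?thesis by blast
qed

lemma closed_graph: "closed (pvm_op_graph E)"
  by (simp add: graph_eq)

lemma graph_sequence:
  assumes "(u, g) \<in> pvm_op_graph E"
  obtains v w where "\<And>n. (v n, w n) \<in> lap_graph T" "v \<longlonglongrightarrow> u" "w \<longlonglongrightarrow> g"
proof -
  obtain x where x: "\<And>n. x n \<in> lap_graph T" "x \<longlonglongrightarrow> (u, g)"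
    using assms unfolding graph_eq closure_sequential by blast
  show ?thesis
    using that[of "\<lambda>n. fst (x n)" "\<lambda>n. snd (x n)"] x(1) tendsto_fst[OF x(2)] tendsto_snd[OF x(2)] by simp
qed

text \<open>Both sides are continuous in (v, w), so the test passes from Garding vectors to the
  closure of their graph, where self-adjointness applies.\<close>

lemma weak_solution_in_graph:
  assumes "\<And>v w. (v, w) \<in> lap_graph T \<Longrightarrow> inner w f = inner v g"
  shows "(f, g) \<in> pvm_op_graph E"
proof (rule graph_self_adjoint[OF closed_graph])
  fix u w assume "(u, w) \<in> pvm_op_graph E"
  then obtain un wn where *: "\<And>n. (un n, wn n) \<in> lap_graph T" "un \<longlonglongrightarrow> u" "wn \<longlonglongrightarrow> w"
    using graph_sequence by blast
  have "(\<lambda>n. inner (wn n) f) \<longlonglongrightarrow> inner w f" "(\<lambda>n. inner (un n) g) \<longlonglongrightarrow> inner u g"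
    by (intro tendsto_intros *)+
  then show "inner w f = inner u g"
    using assms[OF *(1)] LIMSEQ_unique by simp
qed

lemma jet2_in_graph:
  assumes "jet2 f f1 f2 f11 f12 f22"
  shows "(f, - f11 - f22) \<in> pvm_op_graph E"
proof (rule weak_solution_in_graph)
  fix v w assume "(v, w) \<in> lap_graph T"
  then obtain v1 v2 v11 v12 v22 where *: "jet2 v v1 v2 v11 v12 v22" "w = - v11 - v22"
    using lap_graphE[of v w 0] by metis
  show "inner w f = inner v (- f11 - f22)"
    using jet2_green[OF *(1), of f f1 f2] jet2_green[OF assms, of v v1 v2] assms *
    unfolding jet2_def by (simp add: inner_commute)
qed

text \<open>\<open>\<langle>A\<^sub>1\<^sup>2 v, A\<^sub>2\<^sup>2 v\<rangle> = \<parallel>A\<^sub>1 A\<^sub>2 v\<parallel>\<^sup>2 - \<parallel>A\<^sub>2 v\<parallel>\<^sup>2\<close> after integrating by parts and commuting, so the second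
  derivatives are controlled by \<open>\<Delta> v\<close> and \<open>v\<close>.\<close>
lemma lap_graph_estimate:
  assumes vw: "(v, w) \<in> lap_graph T" and jet: "jet2 v v1 v2 v11 v12 v22"
  shows "norm v1 \<le> norm w + norm v" "norm v2 \<le> norm w + norm v" "norm v11 \<le> norm w + norm v"
    "norm v12 \<le> norm w + norm v" "norm v22 \<le> norm w + norm v"
proof -
  obtain M where w: "w = - v11 - v22" and v1: "words_bound T (Suc (Suc 0)) v1 M"
    and v2: "words_bound T (Suc (Suc 0)) v2 M"
    using lap_graphE[OF vw, of 0] jet2_unique[OF jet] by metis
  have 0: "\<D> 1 v v1" "\<D> 2 v v2" "\<D> 1 v1 v11" "\<D> 1 v2 v12" "\<D> 2 v2 v22" "\<D> 2 v1 (v12 - v2)"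
    using jet jet2_D21[OF jet] unfolding jet2_def by blast+
  obtain v112 where v112: "\<D> 1 v12 v112"
    using words_bound_SucD[OF v2, of 1] 0(4) G.D_unique
    by (metis D_iff insertI1 words_bound_SucD)
  have "\<D> 1 (v12 - v2) (v112 - v12)"
    by (intro G.D_diff v112 0)
  then have "\<D> 2 v11 ((v112 - v12) - (v12 - v2))"
    by (rule D_commutator[OF 0(6) _ 0(3)])
  then have "inner v11 v22 = - inner ((v112 - v12) - (v12 - v2)) v2"
    using G.D_skew[of 2 v11 _ v2 v22] 0(5) by simp
  moreover have "inner v112 v2 = - inner v12 v12"
    using G.D_skew[OF v112 0(4)] .
  moreover have "inner v12 v2 = 0"
    using G.D_skew[OF 0(4) 0(4)] by (simp add: inner_commute)
  ultimately have "inner v11 v22 = norm v12 ^ 2 - norm v2 ^ 2"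
    by (simp add: inner_diff_left power2_norm_eq_inner)
  \<comment> \<open>Expanding |w|^2 and inserting the cross term leaves 2 |v2|^2 on the wrong side;
    the energy bound absorbs it, since |w|^2 + 2 |w| |v| \<le> (|w| + |v|)^2.\<close>
  then have sq: "norm w ^ 2 + 2 * norm v2 ^ 2 = norm v11 ^ 2 + norm v22 ^ 2 + 2 * norm v12 ^ 2"
    unfolding w by (simp add: power2_norm_eq_inner inner_diff_left inner_diff_right inner_commute)
  have "norm v1 ^ 2 + norm v2 ^ 2 \<le> norm w * norm v"
    using jet2_energy[OF jet] norm_cauchy_schwarz[of w v] w by simp
  then have en: "norm v1 ^ 2 + norm v2 ^ 2 \<le> norm w * norm v" .
  have N: "norm w ^ 2 + 2 * (norm w * norm v) \<le> (norm w + norm v) ^ 2"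
    by (simp add: power2_eq_square algebra_simps)
  have le: "x \<le> norm w + norm v" if "x ^ 2 \<le> norm w ^ 2 + 2 * (norm w * norm v)" for x
    using order_trans[OF that N] by (rule power2_le_imp_le) simp
  have pos: "0 \<le> norm w * norm v" by simp
  note nonneg = zero_le_power2[of "norm v1"] zero_le_power2[of "norm v2"] zero_le_power2[of "norm v11"]
    zero_le_power2[of "norm v12"] zero_le_power2[of "norm v22"] zero_le_power2[of "norm w"]
  show "norm v1 \<le> norm w + norm v" "norm v2 \<le> norm w + norm v" "norm v11 \<le> norm w + norm v"
    "norm v12 \<le> norm w + norm v" "norm v22 \<le> norm w + norm v"
    by (rule le, use sq en nonneg pos in linarith)+
qed

text \<open>Garding vectors approximating \<open>u\<close> in the graph norm have Cauchy second
  jets, by \<open>lap_graph_estimate\<close> for their differences, and the closed generators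
  identify the limits. The factor 2 pays for A_2 A_1 u = \<open>u12 - u2\<close>.\<close>

lemma graph_jet2:
  assumes ug: "(u, g) \<in> pvm_op_graph E"
  obtains u1 u2 u11 u12 u22 where "jet2 u u1 u2 u11 u12 u22" "g = - u11 - u22"
    "words_bound T 2 u (2 * (norm g + norm u))"
proof -
  obtain v w where vw: "\<And>n. (v n, w n) \<in> lap_graph T" and v: "v \<longlonglongrightarrow> u" and w: "w \<longlonglongrightarrow> g"
    using graph_sequence[OF ug] by blast
  have "\<forall>n. \<exists>v1 v2 v11 v12 v22. jet2 (v n) v1 v2 v11 v12 v22"
    using lap_graphE[OF vw, of _ 0] by metis
  then obtain v1 v2 v11 v12 v22 where jet: "\<And>n. jet2 (v n) (v1 n) (v2 n) (v11 n) (v12 n) (v22 n)"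
    by metis
  define e where "e m n = norm (w m - w n) + norm (v m - v n)" for m n
  have diff: "norm (v1 m - v1 n) \<le> e m n" "norm (v2 m - v2 n) \<le> e m n" "norm (v11 m - v11 n) \<le> e m n"
     "norm (v12 m - v12 n) \<le> e m n" "norm (v22 m - v22 n) \<le> e m n" for m n
  proof -
    have wk: "w k = - v11 k - v22 k" for k
      using lap_graphE[OF vw[of k], of 0] jet2_unique[OF jet[of k]] by metis
    have "v m - v n \<in> garding_space T"
      using vw subspace_garding_space by (auto simp: lap_graph_def subspace_diff)
    from lap_graph_jet2[OF jet2_diff[OF jet jet] this]
    have "(v m - v n, w m - w n) \<in> lap_graph T"
      by (simp add: wk algebra_simps)
    from lap_graph_estimate[OF this jet2_diff[OF jet jet]]
    show "norm (v1 m - v1 n) \<le> e m n" "norm (v2 m - v2 n) \<le> e m n" "norm (v11 m - v11 n) \<le> e m n"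
     "norm (v12 m - v12 n) \<le> e m n" "norm (v22 m - v22 n) \<le> e m n"
      by (simp_all add: e_def)
  qed
  have conv: "\<exists>l. x \<longlonglongrightarrow> l" if "\<And>m n. norm (x m - x n) \<le> e m n" for x :: "nat \<Rightarrow> 'h"
  proof -
    have "Cauchy x"
    proof (rule metric_CauchyI)
      fix \<epsilon> :: real assume "0 < \<epsilon>"
      then obtain N1 N2 where N: "\<And>m n. m \<ge> N1 \<Longrightarrow> n \<ge> N1 \<Longrightarrow> dist (v m) (v n) < \<epsilon> / 2"
        "\<And>m n. m \<ge> N2 \<Longrightarrow> n \<ge> N2 \<Longrightarrow> dist (w m) (w n) < \<epsilon> / 2"
        using metric_CauchyD[OF LIMSEQ_imp_Cauchy[OF v], of "\<epsilon> / 2"]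
          metric_CauchyD[OF LIMSEQ_imp_Cauchy[OF w], of "\<epsilon> / 2"] half_gt_zero[of \<epsilon>] by meson
      have "dist (x m) (x n) < \<epsilon>" if "m \<ge> max N1 N2" "n \<ge> max N1 N2" for m n
        using N(1)[of m n] N(2)[of m n] that \<open>\<And>m n. norm (x m - x n) \<le> e m n\<close>[of m n]
        by (simp add: e_def dist_norm)
      then show "\<exists>M. \<forall>m\<ge>M. \<forall>n\<ge>M. dist (x m) (x n) < \<epsilon>" by blast
    qed
    then show ?thesis using Cauchy_convergent convergent_def by blast
  qed
  obtain u1 u2 u11 u12 u22 where lim: "v1 \<longlonglongrightarrow> u1" "v2 \<longlonglongrightarrow> u2" "v11 \<longlonglongrightarrow> u11" "v12 \<longlonglongrightarrow> u12" "v22 \<longlonglongrightarrow> u22"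
    using conv[of v1] conv[of v2] conv[of v11] conv[of v12] conv[of v22] diff by blast
  have J: "jet2 u u1 u2 u11 u12 u22"
    unfolding jet2_def
    using jet[unfolded jet2_def] G.D_closed v lim by blast
  have lim_N: "(\<lambda>n. norm (w n) + norm (v n)) \<longlonglongrightarrow> norm g + norm u"
    by (intro tendsto_intros v w)
  have bd: "norm y \<le> norm g + norm u" if "x \<longlonglongrightarrow> y" "\<And>n. norm (x n) \<le> norm (w n) + norm (v n)" for x y
    by (rule LIMSEQ_le[OF tendsto_norm[OF that(1)] lim_N]) (use that(2) in blast)
  note est = lap_graph_estimate[OF vw jet]
  have b: "norm u1 \<le> norm g + norm u" "norm u2 \<le> norm g + norm u" "norm u11 \<le> norm g + norm u"
    "norm u12 \<le> norm g + norm u" "norm u22 \<le> norm g + norm u"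
    using bd[OF lim(1) est(1)] bd[OF lim(2) est(2)] bd[OF lim(3) est(3)] bd[OF lim(4) est(4)]
      bd[OF lim(5) est(5)] by auto
  define N where "N = norm g + norm u"
  have "norm u \<le> N" "0 \<le> N" by (simp_all add: N_def)
  moreover have "norm (u12 - u2) \<le> N + N"
    using b by (intro order_trans[OF norm_triangle_ineq4] add_mono) (simp_all only: N_def)
  ultimately have "norm u \<le> 2 * N" "norm u1 \<le> 2 * N" "norm u2 \<le> 2 * N" "norm u11 \<le> 2 * N"
    "norm u12 \<le> 2 * N" "norm u22 \<le> 2 * N" "norm (u12 - u2) \<le> 2 * N"
    using b[folded N_def] by simp_all
  from jet2_words_bound[OF J this]
  have "words_bound T 2 u (2 * (norm g + norm u))" by (simp only: N_def)
  moreover have "g = - u11 - u22"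
    using graph_unique[OF ug jet2_in_graph[OF J]] .
  ultimately show ?thesis using that J by blast
qed

lemma graph_nonneg: "(u, g) \<in> pvm_op_graph E \<Longrightarrow> 0 \<le> inner g u"
proof -
  assume "(u, g) \<in> pvm_op_graph E"
  then obtain u1 u2 u11 u12 u22 where "jet2 u u1 u2 u11 u12 u22" "g = - u11 - u22"
    using graph_jet2 by metis
  then show ?thesis
    using jet2_energy[of u u1 u2 u11 u12 u22] by simp
qed

text \<open>\<open>[\<Delta>, A\<^sub>1] = 2 A\<^sub>2\<^sup>2\<close>; the equation for \<open>A\<^sub>1 u\<close> is first obtained weakly, against Garding
  vectors, and self-adjointness of \<open>\<Delta>\<close> upgrades it.\<close>
lemma graph_D1:
  assumes ug: "(u, g) \<in> pvm_op_graph E" and jet: "jet2 u u1 u2 u11 u12 u22" and g1: "\<D> 1 g g1"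
  shows "(u1, g1 + 2 *\<^sub>R u22) \<in> pvm_op_graph E"
proof (rule weak_solution_in_graph)
  fix v w assume vw: "(v, w) \<in> lap_graph T"
  obtain M v1 v2 v11 v12 v22 where J: "jet2 v v1 v2 v11 v12 v22"
    and w: "w = - v11 - v22" and v1: "words_bound T (Suc (Suc 0)) v1 M"
    and v2: "words_bound T (Suc 0) v11 M" "words_bound T (Suc 0) v22 M"
    using lap_graphE[OF vw, of 0] by metis
  have 0: "\<D> 1 v v1" "\<D> 2 v v2" "\<D> 1 v1 v11" "\<D> 1 v2 v12" "\<D> 2 v2 v22" "\<D> 2 v1 (v12 - v2)"
    using J jet2_D21[OF J] unfolding jet2_def by blast+
  have 1: "\<D> 1 u u1" "\<D> 2 u u2" "\<D> 2 u2 u22"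
    using jet unfolding jet2_def by blast+
  obtain v111 v122 where v111: "\<D> 1 v11 v111" and v122: "\<D> 1 v22 v122"
    using words_bound_SucD[OF v2(1), of 1] words_bound_SucD[OF v2(2), of 1] by (auto simp: D_iff)
  have w1: "\<D> 1 w (- v111 - v122)"
    unfolding w using G.D_diff[OF G.D_scaleR[OF v111, of "-1"] v122] by simp
  have "\<D> 2 v12 (v122 - v22)"
    by (rule D_commutator[OF 0(5) v122 0(4)])
  then have "\<D> 2 (v12 - v2) ((v122 - v22) - v22)"
    by (intro G.D_diff 0)
  moreover obtain z1 z2 z11 z12 z22 where "jet2 v1 z1 z2 z11 z12 z22"
    by (rule words_bound_jet2[OF v1])
  \<comment> \<open>Commuting twice gives A_2^2 A_1 v = A_1 A_2^2 v - 2 A_2^2 v, hence Delta A_1 v =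
    A_1 w + 2 A_2^2 v. Pair this with (u, g) by symmetry; skewness then moves the generators over to
    \<open>u\<close> and \<open>g\<close>.\<close>
  ultimately have "jet2 v1 v11 (v12 - v2) v111 z12 (v122 - v22 - v22)"
    using 0(3,6) v111 G.D_unique unfolding jet2_def by metis
  from graph_symmetric[OF jet2_in_graph[OF this] ug]
  have "inner (- v111 - v122) u + 2 * inner v22 u = inner v1 g"
    by (simp add: inner_diff_left)
  moreover have "inner (- v111 - v122) u = - inner w u1"
    by (rule G.D_skew[OF w1 1(1)])
  moreover have "inner v1 g = - inner v g1"
    by (rule G.D_skew[OF 0(1) g1])
  moreover have "inner v22 u = inner v u22"
    using G.D_skew[OF 0(5) 1(2)] G.D_skew[OF 0(2) 1(3)] by simp
  ultimately show "inner w u1 = inner v (g1 + 2 *\<^sub>R u22)"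
    by (simp add: inner_add_right)
qed

text \<open>\<open>[\<Delta>, A\<^sub>2] = - A\<^sub>1 A\<^sub>2 - A\<^sub>2 A\<^sub>1\<close>.\<close>
lemma graph_D2:
  assumes ug: "(u, g) \<in> pvm_op_graph E" and jet: "jet2 u u1 u2 u11 u12 u22" and g2: "\<D> 2 g g2"
  shows "(u2, g2 - u12 - (u12 - u2)) \<in> pvm_op_graph E"
proof (rule weak_solution_in_graph)
  fix v w assume vw: "(v, w) \<in> lap_graph T"
  obtain M v1 v2 v11 v12 v22 where J: "jet2 v v1 v2 v11 v12 v22"
    and w: "w = - v11 - v22" and v2: "words_bound T (Suc (Suc 0)) v2 M"
    using lap_graphE[OF vw, of 0] by metis
  have 0: "\<D> 1 v v1" "\<D> 2 v v2" "\<D> 1 v1 v11" "\<D> 1 v2 v12" "\<D> 2 v2 v22" "\<D> 2 v1 (v12 - v2)"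
    using J jet2_D21[OF J] unfolding jet2_def by blast+
  have 1: "\<D> 1 u u1" "\<D> 2 u u2" "\<D> 1 u2 u12" "\<D> 2 u1 (u12 - u2)"
    using jet jet2_D21[OF jet] unfolding jet2_def by blast+
  obtain z1 z2 v112 z12 v222 where z: "jet2 v2 z1 z2 v112 z12 v222"
    by (rule words_bound_jet2[OF v2])
  moreover have "z1 = v12" "z2 = v22"
    using z 0(4,5) G.D_unique unfolding jet2_def by blast+
  ultimately have z: "jet2 v2 v12 v22 v112 z12 v222" by simp
  have "\<D> 1 (v12 - v2) (v112 - v12)"
    using z unfolding jet2_def by (intro G.D_diff 0) blast+
  then have "\<D> 2 v11 ((v112 - v12) - (v12 - v2))"
    by (rule D_commutator[OF 0(6) _ 0(3)])
  then have w2: "\<D> 2 w (- ((v112 - v12) - (v12 - v2)) - v222)"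
  proof -
    have "\<D> 2 (- v11) (- ((v112 - v12) - (v12 - v2)))"
      using G.D_scaleR[OF \<open>\<D> 2 v11 _\<close>, of "-1"] by (simp only: scaleR_minus1_left)
    moreover have "\<D> 2 v22 v222" using z unfolding jet2_def by blast
    ultimately show ?thesis unfolding w by (rule G.D_diff)
  qed
  \<comment> \<open>Here Delta A_2 v = A_2 w - A_1 A_2 v - A_2 A_1 v. Moving everything onto
    \<open>u\<close> reverses each mixed word, so the two commutator terms trade places and keep
    their sum.\<close>
  have "inner (- v112 - v222) u = inner v2 g"
    by (rule graph_symmetric[OF jet2_in_graph[OF z] ug])
  moreover have "inner (- ((v112 - v12) - (v12 - v2)) - v222) u = - inner w u2"
    by (rule G.D_skew[OF w2 1(2)])
  moreover have "inner v2 g = - inner v g2"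
    by (rule G.D_skew[OF 0(2) g2])
  moreover have "inner v12 u = inner v (u12 - u2)"
    using G.D_skew[OF 0(4) 1(1)] G.D_skew[OF 0(2) 1(4)] by simp
  moreover have "inner (v12 - v2) u = inner v u12"
    using G.D_skew[OF 0(6) 1(2)] G.D_skew[OF 0(1) 1(3)] by simp
  ultimately show "inner w u2 = inner v (g2 - u12 - (u12 - u2))"
    by (simp add: inner_diff_left inner_diff_right)
qed

text \<open>The bound on |u| is a separate hypothesis because Delta controls derivatives only up to
  a multiple of |u|. One more order is gained by applying the induction hypothesis to A_1 u and A_2
  u: besides A_j g, their right-hand sides contain only second derivatives of \<open>u\<close>,
  which the same hypothesis already bounds.\<close>

lemma elliptic_regularity:
  "\<exists>c\<ge>1. \<forall>u g M. (u, g) \<in> pvm_op_graph E \<longrightarrow> words_bound T k g M \<longrightarrow> norm u \<le> M \<longrightarrow>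
     words_bound T (Suc (Suc k)) u (c * M)"
proof (induction k)
  case 0
  have "words_bound T (Suc (Suc 0)) u (4 * M)"
    if "(u, g) \<in> pvm_op_graph E" "words_bound T 0 g M" "norm u \<le> M" for u g M
  proof -
    have "words_bound T 2 u (2 * (norm g + norm u))"
      using graph_jet2[OF that(1)] by metis
    then show ?thesis
      unfolding numeral_2_eq_2 by (rule words_bound_mono) (use that(2,3) in auto)
  qed
  then show ?case by (intro exI[of _ 4]) auto
next
  case (Suc k)
  then obtain c where c: "c \<ge> 1" and IH: "\<And>u g M. (u, g) \<in> pvm_op_graph E \<Longrightarrow> words_bound T k g M \<Longrightarrow>
      norm u \<le> M \<Longrightarrow> words_bound T (Suc (Suc k)) u (c * M)"
    by blast
  \<comment> \<open>The new right-hand sides are bounded by M + 2 c M, where A_j g contributes M and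
    the two commutator terms c M each; the second use of the hypothesis multiplies by
    \<open>c\<close>.\<close>
  define c' where "c' = c * (1 + 2 * c)"
  have c': "1 \<le> c'" "c \<le> c'"
    using mult_mono[of 1 c 1 "1 + 2 * c"] mult_left_mono[of 1 "1 + 2 * c" c] c by (auto simp: c'_def)
  have "words_bound T (Suc (Suc (Suc k))) u (c' * M)"
    if ug: "(u, g) \<in> pvm_op_graph E" and g: "words_bound T (Suc k) g M" and u: "norm u \<le> M" for u g M
  proof -
    have "M \<ge> 0" using u norm_ge_zero order_trans by blast
    then have M: "M \<le> c' * M" "c * M \<le> M + 2 * (c * M)"
      using mult_right_mono[OF c'(1), of M] mult_right_mono[OF c, of M] by linarith+
    have W: "words_bound T (Suc (Suc k)) u (c * M)"
      by (rule IH[OF ug words_bound_Suc[OF g] u])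
    obtain u1 u2 u11 u12 u22 where J: "jet2 u u1 u2 u11 u12 u22"
      and b: "words_bound T (Suc k) u1 (c * M)" "words_bound T (Suc k) u2 (c * M)"
       "words_bound T k u12 (c * M)" "words_bound T k u22 (c * M)" "words_bound T k (u12 - u2) (c * M)"
      using words_bound_jet2[OF W] by metis
    obtain g1 g2 where g': "\<D> 1 g g1" "words_bound T k g1 M" "\<D> 2 g g2" "words_bound T k g2 M"
      using words_bound_SucD[OF g, of 1] words_bound_SucD[OF g, of 2] by (auto simp: D_iff)
    have "words_bound T (Suc (Suc k)) u1 (c * (M + 2 * (c * M)))"
    proof (rule IH[OF graph_D1[OF ug J g'(1)]])
      show "words_bound T k (g1 + 2 *\<^sub>R u22) (M + 2 * (c * M))"
        using words_bound_add[OF g'(2) words_bound_scaleR[OF b(4), of 2]] by simp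
      show "norm u1 \<le> M + 2 * (c * M)"
        using words_bound_norm[OF b(1)] M by linarith
    qed
    moreover have "words_bound T (Suc (Suc k)) u2 (c * (M + 2 * (c * M)))"
    proof (rule IH[OF graph_D2[OF ug J g'(3)]])
      show "words_bound T k (g2 - u12 - (u12 - u2)) (M + 2 * (c * M))"
        using words_bound_diff[OF words_bound_diff[OF g'(4) b(3)] b(5)] by (simp add: algebra_simps)
      show "norm u2 \<le> M + 2 * (c * M)"
        using words_bound_norm[OF b(2)] M by linarith
    qed
    moreover have "c * (M + 2 * (c * M)) = c' * M"
      by (simp add: c'_def algebra_simps)
    ultimately show ?thesis
      using J u M(1) unfolding jet2_def D_iff words_bound.simps(2)[of T "Suc (Suc k)"] by auto
  qed
  then show ?case using c'(1) by blast
qed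

subsection \<open>Bernstein and Jackson inequalities\<close>

lemma bernstein:
  "\<exists>c\<ge>1. \<forall>\<sigma>\<ge>1. \<forall>u. E {0..\<sigma>\<^sup>2} u = u \<longrightarrow> words_bound T r u (c * \<sigma> ^ r * norm u)"
proof (induction r rule: induct_nat_012)
  case 0
  then show ?case by (intro exI[of _ 1]) auto
next
  case 1
  have "words_bound T (Suc 0) u (\<sigma> * norm u)" if \<sigma>: "\<sigma> \<ge> 1" and u: "E {0..\<sigma>\<^sup>2} u = u" for \<sigma> u
  proof -
    obtain g where ug: "(u, g) \<in> pvm_op_graph E" and g: "norm g \<le> \<sigma>\<^sup>2 * norm u"
      using graph_bounded_spectrum[of "\<sigma>\<^sup>2" u] u by auto
    obtain u1 u2 u11 u12 u22 where J: "jet2 u u1 u2 u11 u12 u22" and "g = - u11 - u22"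
      using graph_jet2[OF ug] by metis
    \<comment> \<open>The first order has to come from the energy: the second-order estimate would
      cost \<sigma>^2 instead of \<sigma>.\<close>
    then have "norm u1 ^ 2 + norm u2 ^ 2 = inner g u"
      using jet2_energy[OF J] by simp
    also have "\<dots> \<le> norm g * norm u" by (rule norm_cauchy_schwarz)
    also have "\<dots> \<le> (\<sigma> * norm u) ^ 2"
      using mult_right_mono[OF g, of "norm u"] by (simp add: power2_eq_square mult_ac)
    finally have *: "norm u1 ^ 2 + norm u2 ^ 2 \<le> (\<sigma> * norm u) ^ 2" .
    have "norm u1 ^ 2 \<le> (\<sigma> * norm u) ^ 2" "norm u2 ^ 2 \<le> (\<sigma> * norm u) ^ 2"
      using * zero_le_power2[of "norm u1"] zero_le_power2[of "norm u2"] by linarith+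
    then have "norm u1 \<le> \<sigma> * norm u" "norm u2 \<le> \<sigma> * norm u"
      using \<sigma> by (auto intro: power2_le_imp_le)
    moreover have "norm u \<le> \<sigma> * norm u"
      using mult_right_mono[OF \<sigma>, of "norm u"] by simp
    ultimately show ?thesis
      using J unfolding jet2_def D_iff by auto
  qed
  then show ?case by (intro exI[of _ 1]) auto
next
  case (ge2 r)
  obtain c where c: "c \<ge> 1" and IH': "\<forall>\<sigma>\<ge>1. \<forall>u. E {0..\<sigma>\<^sup>2} u = u \<longrightarrow> words_bound T r u (c * \<sigma> ^ r * norm u)"
    using ge2.IH(1) by (elim exE conjE)
  have IH: "words_bound T r u (c * \<sigma> ^ r * norm u)" if "\<sigma> \<ge> 1" "E {0..\<sigma>\<^sup>2} u = u" for \<sigma> u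
    using IH' that by simp
  obtain k where k: "k \<ge> 1" and reg: "\<And>u g M. (u, g) \<in> pvm_op_graph E \<Longrightarrow> words_bound T r g M \<Longrightarrow>
      norm u \<le> M \<Longrightarrow> words_bound T (Suc (Suc r)) u (k * M)"
    using elliptic_regularity[of r] by blast
  have "words_bound T (Suc (Suc r)) u (k * c * \<sigma> ^ Suc (Suc r) * norm u)"
    if \<sigma>: "\<sigma> \<ge> 1" and u: "E {0..\<sigma>\<^sup>2} u = u" for \<sigma> u
  proof -
    obtain g where ug: "(u, g) \<in> pvm_op_graph E" and Eg: "E {0..\<sigma>\<^sup>2} g = g" and g: "norm g \<le> \<sigma>\<^sup>2 * norm u"
      using graph_bounded_spectrum[of "\<sigma>\<^sup>2" u] u by auto
    have "words_bound T (Suc (Suc r)) u (k * (c * \<sigma> ^ Suc (Suc r) * norm u))"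
    proof (rule reg[OF ug])
      have "c * \<sigma> ^ r * norm g \<le> c * \<sigma> ^ r * (\<sigma>\<^sup>2 * norm u)"
        using g c \<sigma> by (intro mult_left_mono) auto
      then show "words_bound T r g (c * \<sigma> ^ Suc (Suc r) * norm u)"
        by (intro words_bound_mono[OF IH[OF \<sigma> Eg]]) (simp add: power2_eq_square mult_ac)
      \<comment> \<open>Regularity also wants the bound to dominate |u| itself; this is where
        \<sigma> \<ge> 1 enters.\<close>
      have "1 \<le> c * \<sigma> ^ Suc (Suc r)"
        using mult_mono[of 1 c 1 "\<sigma> ^ Suc (Suc r)"] c \<sigma> one_le_power[OF \<sigma>, of "Suc (Suc r)"] by simp
      then show "norm u \<le> c * \<sigma> ^ Suc (Suc r) * norm u"
        using mult_right_mono[of 1 _ "norm u"] by simp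
    qed
    then show ?thesis by (simp add: mult_ac)
  qed
  moreover have "k * c \<ge> 1" using mult_mono[of 1 k 1 c] k c by simp
  ultimately show ?case by blast
qed

lemma jackson:
  assumes "words_bound T r f M" "0 \<le> \<sigma>"
  shows "\<sigma> ^ r * norm (E {\<sigma>\<^sup>2<..} f) \<le> 2 ^ r * M"
  using assms(1)
proof (induction r arbitrary: f M rule: induct_nat_012)
  case 0
  then show ?case using order_trans[OF norm_E_le[of "{\<sigma>\<^sup>2<..}" f]] by simp
next
  case 1
  then obtain f1 f2 where f: "\<D> 1 f f1" "norm f1 \<le> M" "\<D> 2 f f2" "norm f2 \<le> M" "norm f \<le> M"
    by (auto simp: D_iff)
  have M: "M \<ge> 0" using f(5) norm_ge_zero order_trans by blast
  \<comment> \<open>With one derivative, Delta cannot be applied to \<open>f\<close>. Integration by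
    parts bounds <Delta u, f>^2 by (|f1|^2 + |f2|^2) <Delta u, u> instead, which is the hypothesis
    of \<open>spectral_tail_form\<close>.\<close>
  have "\<sigma>\<^sup>2 * norm (E {\<sigma>\<^sup>2<..} f) ^ 2 \<le> norm f1 ^ 2 + norm f2 ^ 2"
  proof (rule spectral_tail_form)
    fix u w assume "(u, w) \<in> pvm_op_graph E"
    then obtain u1 u2 u11 u12 u22 where J: "jet2 u u1 u2 u11 u12 u22" and w: "w = - u11 - u22"
      using graph_jet2 by metis
    have "\<bar>inner w f\<bar> \<le> norm u1 * norm f1 + norm u2 * norm f2"
      using jet2_green[OF J f(1,3)] Cauchy_Schwarz_ineq2[of u1 f1] Cauchy_Schwarz_ineq2[of u2 f2] w
      by simp
    then have "inner w f ^ 2 \<le> (norm u1 * norm f1 + norm u2 * norm f2) ^ 2"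
      by (metis abs_ge_zero power2_abs power_mono)
    also have "\<dots> \<le> (norm f1 ^ 2 + norm f2 ^ 2) * (norm u1 ^ 2 + norm u2 ^ 2)"
      using zero_le_power2[of "norm u1 * norm f2 - norm u2 * norm f1"]
      by (simp add: power2_eq_square algebra_simps)
    also have "norm u1 ^ 2 + norm u2 ^ 2 = inner w u"
      using jet2_energy[OF J] w by simp
    finally show "inner w f ^ 2 \<le> (norm f1 ^ 2 + norm f2 ^ 2) * inner w u" .
  qed auto
  also have "\<dots> \<le> M ^ 2 + M ^ 2"
    using f by (intro add_mono power_mono) auto
  also have "\<dots> \<le> (2 * M) ^ 2" by (simp add: power2_eq_square)
  finally have "(\<sigma> * norm (E {\<sigma>\<^sup>2<..} f)) ^ 2 \<le> (2 * M) ^ 2"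
    by (simp add: power_mult_distrib)
  then have "\<sigma> * norm (E {\<sigma>\<^sup>2<..} f) \<le> 2 * M"
    by (rule power2_le_imp_le) (use M in simp)
  then show ?case by simp
next
  case (ge2 r)
  obtain f1 f2 f11 f12 f22 where J: "jet2 f f1 f2 f11 f12 f22"
    "words_bound T r f11 M" "words_bound T r f22 M"
    using words_bound_jet2[OF ge2.prems] by metis
  have M: "M \<ge> 0" using words_bound_norm[OF J(2)] norm_ge_zero order_trans by blast
  have "words_bound T r (- f11 - f22) (M + M)"
    by (intro words_bound_diff words_bound_uminus J)
  from ge2.IH(1)[OF this]
  have IH: "\<sigma> ^ r * norm (E {\<sigma>\<^sup>2<..} (- f11 - f22)) \<le> 2 ^ r * (M + M)" .
  have "\<sigma>\<^sup>2 * norm (E {\<sigma>\<^sup>2<..} f) \<le> norm (E {\<sigma>\<^sup>2<..} (- f11 - f22))"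
    by (rule spectral_tail_graph[OF jet2_in_graph[OF J(1)]]) auto
  then have "\<sigma> ^ r * (\<sigma>\<^sup>2 * norm (E {\<sigma>\<^sup>2<..} f)) \<le> \<sigma> ^ r * norm (E {\<sigma>\<^sup>2<..} (- f11 - f22))"
    using assms(2) by (intro mult_left_mono) auto
  also note IH
  also have "2 ^ r * (M + M) \<le> 2 ^ Suc (Suc r) * M" using M by simp
  finally show ?case by (simp add: power2_eq_square mult_ac)
qed

text \<open>\<open>is_pvm\<close> states additivity only for the scalar measures. The defect f - E B
  f - E (- B) f is annihilated by both projections, so its spectral measure has total mass 0 and it
  vanishes.\<close>

lemma E_Compl: "B \<in> sets borel \<Longrightarrow> f - E B f = E (- B) f"
proof -
  assume B: "B \<in> sets borel"
  then have C: "- B \<in> sets borel" by (rule borel_comp)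
  have "E {} x = 0" for x using measure_spec[of "{}" x] by simp
  then have "E B (f - E B f - E (- B) f) = 0" "E (- B) (f - E B f - E (- B) f) = 0"
    using B C by (simp_all add: E_diff E_E)
  then have "measure (\<mu> (f - E B f - E (- B) f)) B = 0" "measure (\<mu> (f - E B f - E (- B) f)) (- B) = 0"
    using B C by (simp_all add: measure_spec)
  moreover have "measure (\<mu> (f - E B f - E (- B) f)) (B \<union> - B) =
      measure (\<mu> (f - E B f - E (- B) f)) B + measure (\<mu> (f - E B f - E (- B) f)) (- B)"
    using B C by (intro spec.finite_measure_Union) auto
  ultimately have "norm (E UNIV (f - E B f - E (- B) f)) ^ 2 = 0"
    by (simp add: measure_spec)
  then show ?thesis by (simp add: E_UNIV)
qed

lemma E_zero_to:
  assumes "0 \<le> s"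
  shows "f - E {0..s} f = E {s<..} f"
proof -
  have 1: "f - E {0..s} f = E (- {0..s}) f"
    by (rule E_Compl) simp
  have "E (- {0..s}) f - E {s<..} (E (- {0..s}) f) = E (- {s<..}) (E (- {0..s}) f)"
    by (rule E_Compl) simp
  also have "\<dots> = E (- {s<..} \<inter> - {0..s}) f"
    by (rule E_E) (auto intro: borel_comp)
  also have "- {s<..} \<inter> - {0..s} = {..<0}" using assms by auto
  also have "E {..<0} f = 0"
    by (rule spectral_negative_part[OF graph_nonneg])
  finally have "E (- {0..s}) f = E {s<..} (E (- {0..s}) f)" by simp
  also have "\<dots> = E ({s<..} \<inter> - {0..s}) f"
    by (rule E_E) (auto intro: borel_comp)
  also have "{s<..} \<inter> - {0..s} = {s<..}" by auto
  finally show ?thesis using 1 by simp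
qed

text \<open>The infimum over the range is attained at the orthogonal projection. The second form
  discards the negative half-line and is the tail that Jackson controls.\<close>

lemma best_approx_eq:
  shows "best_approx E \<sigma> f = norm (f - E {0..\<sigma>\<^sup>2} f)" and "best_approx E \<sigma> f = norm (E {\<sigma>\<^sup>2<..} f)"
proof -
  let ?P = "E {0..\<sigma>\<^sup>2}"
  have B: "{0..\<sigma>\<^sup>2} \<in> sets borel" "- {0..\<sigma>\<^sup>2} \<in> sets borel" by (auto intro: borel_comp)
  have "norm (f - ?P f) \<le> dist f (?P h)" for h
  proof -
    have "f - ?P f = E (- {0..\<sigma>\<^sup>2}) (f - ?P h)"
      using E_Compl[OF B(1), of f] E_Compl[OF B(1), of "?P h"] by (simp add: E_diff[OF B(2)] E_idem[OF B(1)])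
    then show ?thesis
      using norm_E_le[OF B(2), of "f - ?P h"] by (simp add: dist_norm)
  qed
  then have "norm (f - ?P f) \<le> infdist f (range ?P)"
    unfolding infdist_def by (auto intro: cINF_greatest)
  moreover have "infdist f (range ?P) \<le> norm (f - ?P f)"
    using infdist_le[of "?P f" "range ?P" f] by (simp add: dist_norm)
  ultimately show 1: "best_approx E \<sigma> f = norm (f - ?P f)"
    by (simp add: best_approx_def)
  then show "best_approx E \<sigma> f = norm (E {\<sigma>\<^sup>2<..} f)"
    by (simp add: E_zero_to)
qed

end

subsection \<open>A discrete Hardy inequality\<close>

lemma powr_contract_le:
  fixes x :: real
  assumes "0 < c" "c \<le> 1" "0 \<le> x" "1 \<le> p"
  shows "(c * x) powr p \<le> c * x powr p"
proof -
  have "c powr p \<le> c powr 1" using assms by (intro powr_mono') auto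
  then show ?thesis
    using assms by (simp add: powr_mult mult_right_mono)
qed

lemma powr_convex_two_point:
  fixes x y :: real
  assumes "0 < \<theta>" "\<theta> < 1" "0 \<le> x" "0 \<le> y" "1 \<le> p"
  shows "(\<theta> * x + (1 - \<theta>) * y) powr p \<le> \<theta> * x powr p + (1 - \<theta>) * y powr p"
proof (cases "x = 0 \<or> y = 0")
  case True
  then show ?thesis
    using powr_contract_le[of \<theta> x p] powr_contract_le[of "1 - \<theta>" y p] assms by auto
next
  case False
  with assms have "x > 0" "y > 0" by auto
  then show ?thesis
    using convex_onD[OF powr_convex[OF assms(5)], of "1 - \<theta>" x y] assms by simp
qed

text \<open>\<open>z\<close> is the convolution of \<open>b\<close> with the powers of \<theta>,
  whose sum is 1 / (1 - \<theta>), so this is Young's inequality with that constant. The recursion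
  exhibits \<open>z (Suc j)\<close> as a convex combination of \<open>z j\<close> and
  \<open>b (Suc j) / (1 - \<theta>)\<close>, to which convexity of the p-th power applies.\<close>

lemma discrete_hardy:
  fixes z b :: "nat \<Rightarrow> real"
  assumes \<theta>: "0 < \<theta>" "\<theta> < 1" and p: "1 \<le> p" and b: "\<And>i. 0 \<le> b i"
    and z: "z 0 = b 0" "\<And>j. z (Suc j) = \<theta> * z j + b (Suc j)"
  shows "(\<Sum>j<n. z j powr p) \<le> (1 - \<theta>) powr (- p) * (\<Sum>j<n. b j powr p)"
proof -
  define k where "k = (1 - \<theta>) * (1 / (1 - \<theta>)) powr p"
  have k: "1 \<le> k"
  proof -
    have "1 / (1 - \<theta>) = (1 / (1 - \<theta>)) powr 1" using \<theta> by simp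
    also have "\<dots> \<le> (1 / (1 - \<theta>)) powr p" using \<theta> p by (intro powr_mono) auto
    finally show ?thesis using \<theta> by (simp add: k_def field_simps)
  qed
  have z0: "0 \<le> z j" for j
    by (induction j) (use z b \<theta> in auto)
  have step: "z (Suc j) powr p \<le> \<theta> * z j powr p + k * b (Suc j) powr p" for j
  proof -
    have "z (Suc j) = \<theta> * z j + (1 - \<theta>) * (b (Suc j) / (1 - \<theta>))"
      using z(2)[of j] \<theta> by simp
    then have "z (Suc j) powr p \<le> \<theta> * z j powr p + (1 - \<theta>) * (b (Suc j) / (1 - \<theta>)) powr p"
      using powr_convex_two_point[OF \<theta> z0[of j] _ p, of "b (Suc j) / (1 - \<theta>)"] b \<theta> by simp
    also have "(b (Suc j) / (1 - \<theta>)) powr p = (1 / (1 - \<theta>)) powr p * b (Suc j) powr p"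
      using b[of "Suc j"] \<theta> by (simp add: powr_divide)
    finally show ?thesis by (simp add: k_def mult.assoc)
  qed
  have sum_Suc: "(\<Sum>j<Suc n. z j powr p) \<le> \<theta> * (\<Sum>j<n. z j powr p) + k * (\<Sum>j<Suc n. b j powr p)" for n
  proof (induction n)
    case 0
    have "b 0 powr p \<le> k * b 0 powr p" using mult_right_mono[OF k, of "b 0 powr p"] by simp
    then show ?case by (simp add: z)
  next
    case (Suc n)
    then show ?case using step[of n] by (simp add: algebra_simps)
  qed
  have "(\<Sum>j<n. z j powr p) \<le> \<theta> * (\<Sum>j<n. z j powr p) + k * (\<Sum>j<n. b j powr p)"
  proof (cases n)
    case (Suc m)
    have "(\<Sum>j<m. z j powr p) \<le> (\<Sum>j<n. z j powr p)" by (simp add: Suc)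
    then have "\<theta> * (\<Sum>j<m. z j powr p) \<le> \<theta> * (\<Sum>j<n. z j powr p)"
      using \<theta> by (intro mult_left_mono) auto
    then show ?thesis using sum_Suc[of m] Suc by simp
  qed simp
  \<comment> \<open>The sum of the \<open>z j powr p\<close> is finite, so its \<theta>-multiple can
    be absorbed; division by 1 - \<theta> turns k = (1 - \<theta>)^(1 - p) into (1 -
    \<theta>)^(-p).\<close>
  then have "(1 - \<theta>) * (\<Sum>j<n. z j powr p) \<le> k * (\<Sum>j<n. b j powr p)"
    by (simp add: algebra_simps)
  also have "k = (1 - \<theta>) * (1 - \<theta>) powr (- p)"
    using \<theta> by (simp add: k_def powr_divide powr_minus_divide)
  finally show ?thesis
    using \<theta> by (simp add: mult.assoc)
qed

subsection \<open>Dyadic discretization of the integral\<close>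

lemma half_power_eq_powr: "(1 / 2) ^ j = 2 powr (- real j)"
  by (simp add: powr_minus powr_realpow power_one_over inverse_eq_divide)

lemma ex_dyadic_interval:
  fixes x :: real
  assumes "1 < x"
  shows "\<exists>j. 2 ^ j < x \<and> x \<le> 2 ^ Suc j"
proof -
  define n where "n = (LEAST n. x \<le> 2 ^ n)"
  have "\<exists>n. x \<le> 2 ^ n"
    using real_arch_pow[of 2 x] by (auto intro: less_imp_le)
  then have n: "x \<le> 2 ^ n" unfolding n_def by (rule LeastI_ex)
  then obtain m where m: "n = Suc m"
    using assms by (cases n) auto
  have "\<not> x \<le> 2 ^ m"
    using not_less_Least[of m "\<lambda>n. x \<le> 2 ^ n"] m unfolding n_def by auto
  then show ?thesis using n m by (intro exI[of _ m]) auto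
qed

lemma ex_dyadic_interval_unit:
  fixes x :: real
  assumes "0 < x" "x \<le> 1"
  shows "\<exists>j. (1 / 2) ^ Suc j < x \<and> x \<le> (1 / 2) ^ j"
proof -
  define n where "n = (LEAST n. (1 / 2) ^ n < x)"
  have "\<exists>n. (1 / 2) ^ n < x"
    using real_arch_pow_inv[of x "1 / 2"] assms by auto
  then have n: "(1 / 2) ^ n < x" unfolding n_def by (rule LeastI_ex)
  then obtain m where m: "n = Suc m"
    using assms by (cases n) auto
  have "\<not> (1 / 2) ^ m < x"
    using not_less_Least[of m "\<lambda>n. (1 / 2) ^ n < x"] m unfolding n_def by auto
  then show ?thesis using n m by (intro exI[of _ m]) auto
qed

lemma ennreal_le_suminf: "f j \<le> (\<Sum>j. f j)" for f :: "nat \<Rightarrow> ennreal"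
  using sum_le_suminf[of f "{j}"] by simp

text \<open>\<open>\<kappa>\<close> stands for the map from s to K(s^r, f, H, H^r), and
  \<open>N\<close> for |f|.\<close>

locale dyadic_integral =
  fixes \<kappa> :: "real \<Rightarrow> real" and N \<alpha> p :: real
  assumes mono: "\<And>s t. 0 < s \<Longrightarrow> s \<le> t \<Longrightarrow> \<kappa> s \<le> \<kappa> t"
    and nonneg: "\<And>s. 0 < s \<Longrightarrow> 0 \<le> \<kappa> s" and bounded: "\<And>s. 0 < s \<Longrightarrow> \<kappa> s \<le> N"
    and \<alpha>: "0 < \<alpha>" and p: "1 \<le> p"
begin

definition I :: ennreal where
  "I = (\<integral>\<^sup>+ s. indicator {0<..} s * ennreal ((s powr (- \<alpha>) * \<kappa> s) powr p / s) \<partial>lborel)"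

lemma N_nonneg: "0 \<le> N"
  using nonneg[of 1] bounded[of 1] by simp

text \<open>On (2^(-j-1), 2^(-j)] the weights s^(-\<alpha>) and 1/s are bounded by their values at
  the left end and \<open>\<kappa>\<close> by its value at the right end. Beyond 1 only
  \<open>\<kappa> s \<le> N\<close> is used, and \<alpha> > 0 makes the resulting geometric series
  converge.\<close>

lemma upper:
  "I \<le> ennreal (2 powr (\<alpha> * p)) * (\<Sum>j. ennreal ((2 powr (real j * \<alpha>) * \<kappa> ((1 / 2) ^ j)) powr p))
     + ennreal (1 / (1 - 2 powr (- (\<alpha> * p))) * N powr p)"
proof -
  define c where "c j = (2 powr (real (Suc j) * \<alpha>) * \<kappa> ((1 / 2) ^ j)) powr p * 2 ^ Suc j" for j
  define d where "d j = (2 powr (- real j * \<alpha>) * N) powr p / 2 ^ j" for j :: nat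
  define J where "J j = {(1 / 2) ^ Suc j <.. (1 / 2) ^ j :: real}" for j :: nat
  define L where "L j = {2 ^ j <.. 2 ^ Suc j :: real}" for j :: nat
  have le: "indicator {0<..} s * ennreal ((s powr (- \<alpha>) * \<kappa> s) powr p / s)
      \<le> (\<Sum>j. ennreal (c j) * indicator (J j) s) + (\<Sum>j. ennreal (d j) * indicator (L j) s)" for s
  proof (cases "s > 0")
    case True
    show ?thesis
    proof (cases "s \<le> 1")
      case le1: True
      then obtain j where j: "(1 / 2) ^ Suc j < s" "s \<le> (1 / 2) ^ j"
        using ex_dyadic_interval_unit True by blast
      have "(s powr (- \<alpha>) * \<kappa> s) powr p / s \<le> c j"
      proof -
        have "s powr (- \<alpha>) \<le> ((1 / 2) ^ Suc j) powr (- \<alpha>)"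
          using j \<alpha> by (intro powr_mono2') auto
        also have "\<dots> = 2 powr (real (Suc j) * \<alpha>)"
          by (simp only: half_power_eq_powr powr_powr) (simp add: algebra_simps)
        finally have 1: "s powr (- \<alpha>) \<le> 2 powr (real (Suc j) * \<alpha>)" .
        have "1 / s \<le> 1 / (1 / 2) ^ Suc j"
          using j(1) True by (intro divide_left_mono) auto
        then have 2: "1 / s \<le> 2 ^ Suc j" by (simp add: power_one_over)
        have "(s powr (- \<alpha>) * \<kappa> s) powr p * (1 / s) \<le> c j"
          unfolding c_def using True p 1 2 mono[OF True j(2)] nonneg[OF True]
          by (intro mult_mono powr_mono2) auto
        then show ?thesis by simp
      qed
      then have "indicator {0<..} s * ennreal ((s powr (- \<alpha>) * \<kappa> s) powr p / s) \<le> ennreal (c j) * indicator (J j) s"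
        using True j by (simp add: J_def indicator_def ennreal_leI)
      also have "\<dots> \<le> (\<Sum>j. ennreal (c j) * indicator (J j) s)"
        by (rule ennreal_le_suminf)
      finally show ?thesis by (rule order_trans) simp
    next
      case False
      then obtain j where j: "2 ^ j < s" "s \<le> 2 ^ Suc j"
        using ex_dyadic_interval[of s] by auto
      have "(s powr (- \<alpha>) * \<kappa> s) powr p / s \<le> d j"
      proof -
        have "s powr (- \<alpha>) \<le> (2 ^ j) powr (- \<alpha>)"
          using j \<alpha> by (intro powr_mono2') auto
        also have "\<dots> = 2 powr (- real j * \<alpha>)"
          by (simp add: powr_realpow[symmetric] powr_powr)
        finally have 1: "s powr (- \<alpha>) \<le> 2 powr (- real j * \<alpha>)" .
        have "1 / s \<le> 1 / 2 ^ j"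
          using j(1) True by (intro divide_left_mono) auto
        then have "(s powr (- \<alpha>) * \<kappa> s) powr p * (1 / s) \<le> (2 powr (- real j * \<alpha>) * N) powr p * (1 / 2 ^ j)"
          using True p 1 bounded[OF True] nonneg[OF True]
          by (intro mult_mono powr_mono2) auto
        then show ?thesis by (simp add: d_def)
      qed
      then have "indicator {0<..} s * ennreal ((s powr (- \<alpha>) * \<kappa> s) powr p / s) \<le> ennreal (d j) * indicator (L j) s"
        using True j by (simp add: L_def indicator_def ennreal_leI)
      also have "\<dots> \<le> (\<Sum>j. ennreal (d j) * indicator (L j) s)"
        by (rule ennreal_le_suminf)
      finally show ?thesis by (rule order_trans) simp
    qed
  qed simp
  have c_eq: "ennreal (c j) * emeasure lborel (J j) =
      ennreal (2 powr (\<alpha> * p)) * ennreal ((2 powr (real j * \<alpha>) * \<kappa> ((1 / 2) ^ j)) powr p)" for j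
  proof -
    have "(1 / 2 :: real) ^ Suc j \<le> (1 / 2) ^ j" by simp
    then have "ennreal (c j) * emeasure lborel (J j) = ennreal (c j * ((1 / 2) ^ j - (1 / 2) ^ Suc j))"
      by (simp add: J_def ennreal_mult''[symmetric])
    also have "c j * ((1 / 2) ^ j - (1 / 2) ^ Suc j) = (2 powr (real (Suc j) * \<alpha>) * \<kappa> ((1 / 2) ^ j)) powr p"
      by (simp add: c_def power_one_over)
    also have "2 powr (real (Suc j) * \<alpha>) = 2 powr \<alpha> * 2 powr (real j * \<alpha>)"
      by (simp add: powr_add[symmetric] algebra_simps)
    also have "(2 powr \<alpha> * 2 powr (real j * \<alpha>) * \<kappa> ((1 / 2) ^ j)) powr p =
        2 powr (\<alpha> * p) * (2 powr (real j * \<alpha>) * \<kappa> ((1 / 2) ^ j)) powr p"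
      using nonneg[of "(1 / 2) ^ j"] by (simp add: mult.assoc powr_mult powr_powr)
    finally show ?thesis by (simp add: ennreal_mult')
  qed
  have d_eq: "ennreal (d j) * emeasure lborel (L j) = ennreal ((2 powr (- (\<alpha> * p))) ^ j * N powr p)" for j
  proof -
    have "ennreal (d j) * emeasure lborel (L j) = ennreal (d j * (2 ^ Suc j - 2 ^ j))"
      by (simp add: L_def ennreal_mult''[symmetric])
    also have "d j * (2 ^ Suc j - 2 ^ j) = (2 powr (- real j * \<alpha>) * N) powr p"
      by (simp add: d_def)
    also have "\<dots> = (2 powr (- (\<alpha> * p))) ^ j * N powr p"
      using N_nonneg by (simp add: powr_mult powr_powr powr_realpow[symmetric] mult_ac)
    finally show ?thesis .
  qed
  have "I \<le> (\<integral>\<^sup>+ s. (\<Sum>j. ennreal (c j) * indicator (J j) s) + (\<Sum>j. ennreal (d j) * indicator (L j) s) \<partial>lborel)"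
    unfolding I_def by (rule nn_integral_mono) (rule le)
  also have "\<dots> = (\<Sum>j. ennreal (c j) * emeasure lborel (J j)) + (\<Sum>j. ennreal (d j) * emeasure lborel (L j))"
    by (subst nn_integral_add, simp_all add: J_def L_def)
      (simp add: nn_integral_suminf nn_integral_cmult_indicator)
  also have "(\<Sum>j. ennreal (c j) * emeasure lborel (J j)) =
      ennreal (2 powr (\<alpha> * p)) * (\<Sum>j. ennreal ((2 powr (real j * \<alpha>) * \<kappa> ((1 / 2) ^ j)) powr p))"
    by (simp only: c_eq ennreal_suminf_cmult)
  also have "(\<Sum>j. ennreal (d j) * emeasure lborel (L j)) = (\<Sum>j. ennreal ((2 powr (- (\<alpha> * p))) ^ j * N powr p))"
    by (simp only: d_eq)
  also have "(\<Sum>j. ennreal ((2 powr (- (\<alpha> * p))) ^ j * N powr p)) = ennreal (1 / (1 - 2 powr (- (\<alpha> * p))) * N powr p)"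
  proof (rule suminf_ennreal_eq)
    have "2 powr (- (\<alpha> * p)) < (2 :: real) powr 0"
      using \<alpha> p by (intro powr_less_mono) auto
    then show "(\<lambda>j. (2 powr (- (\<alpha> * p))) ^ j * N powr p) sums (1 / (1 - 2 powr (- (\<alpha> * p))) * N powr p)"
      by (intro sums_mult2 geometric_sums) simp
  qed simp
  finally show ?thesis by simp
qed

text \<open>The two ends exchange roles, so \<open>\<kappa>\<close> is evaluated at the left end
  2^(-j-1). The factor 2 arises because each interval is half as long as its right end.\<close>

lemma lower:
  "(\<Sum>j. ennreal ((2 powr (real j * \<alpha>) * \<kappa> ((1 / 2) ^ Suc j)) powr p)) \<le> 2 * I"
proof -
  define c where "c j = (2 powr (real j * \<alpha>) * \<kappa> ((1 / 2) ^ Suc j)) powr p * 2 ^ j" for j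
  define J where "J j = {(1 / 2) ^ Suc j <.. (1 / 2) ^ j :: real}" for j :: nat
  have le: "(\<Sum>j. ennreal (c j) * indicator (J j) s) \<le>
      indicator {0<..} s * ennreal ((s powr (- \<alpha>) * \<kappa> s) powr p / s)" for s
  proof (cases "\<exists>j. s \<in> J j")
    case False
    then show ?thesis by (simp add: indicator_def)
  next
    case True
    then obtain j where sj: "s \<in> J j" by blast
    then have j: "(1 / 2) ^ Suc j < s" "s \<le> (1 / 2) ^ j" by (simp_all add: J_def)
    have s: "s > 0" using j(1) zero_less_power[of "1 / 2 :: real" "Suc j"] by linarith
    have "i = j" if "s \<in> J i" for i
    proof -
      have "(1 / 2 :: real) ^ Suc i < (1 / 2) ^ j" "(1 / 2 :: real) ^ Suc j < (1 / 2) ^ i"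
        using that j by (auto simp: J_def)
      then have "j < Suc i" "i < Suc j"
        using power_strict_decreasing_iff[of "1 / 2 :: real" "Suc i" j]
          power_strict_decreasing_iff[of "1 / 2 :: real" "Suc j" i] by (simp_all del: power_Suc)
      then show ?thesis by simp
    qed
    then have "(\<Sum>i. ennreal (c i) * indicator (J i) s) = (\<Sum>i\<in>{j}. ennreal (c i) * indicator (J i) s)"
      by (intro suminf_finite) (auto simp: indicator_def)
    also have "\<dots> = ennreal (c j)" using sj by simp
    also have "c j \<le> (s powr (- \<alpha>) * \<kappa> s) powr p / s"
    proof -
      have "2 powr (real j * \<alpha>) = ((1 / 2) ^ j) powr (- \<alpha>)"
        by (simp only: half_power_eq_powr powr_powr) simp
      also have "\<dots> \<le> s powr (- \<alpha>)"
        using j s \<alpha> by (intro powr_mono2') auto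
      finally have 1: "2 powr (real j * \<alpha>) \<le> s powr (- \<alpha>)" .
      have "1 / (1 / 2) ^ j \<le> 1 / s"
        using j(2) s by (intro divide_left_mono) auto
      then have 2: "2 ^ j \<le> 1 / s" by (simp add: power_one_over)
      have "c j \<le> (s powr (- \<alpha>) * \<kappa> s) powr p * (1 / s)"
        unfolding c_def using s p 1 2 mono[of "(1 / 2) ^ Suc j" s] nonneg[of "(1 / 2) ^ Suc j"] j
        by (intro mult_mono powr_mono2) auto
      then show ?thesis by simp
    qed
    finally show ?thesis using s by (simp add: ennreal_leI)
  qed
  have c_eq: "ennreal (c j) * emeasure lborel (J j) =
      ennreal (1 / 2) * ennreal ((2 powr (real j * \<alpha>) * \<kappa> ((1 / 2) ^ Suc j)) powr p)" for j
  proof -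
    have "ennreal (c j) * emeasure lborel (J j) = ennreal (c j * ((1 / 2) ^ j - (1 / 2) ^ Suc j))"
      by (simp add: J_def ennreal_mult''[symmetric])
    also have "c j * ((1 / 2) ^ j - (1 / 2) ^ Suc j) =
        1 / 2 * (2 powr (real j * \<alpha>) * \<kappa> ((1 / 2) ^ Suc j)) powr p"
      by (simp add: c_def power_one_over)
    finally show ?thesis by (simp only: ennreal_mult' zero_le_divide_1_iff zero_le_numeral)
  qed
  have "(\<Sum>j. ennreal (c j) * emeasure lborel (J j)) = (\<integral>\<^sup>+ s. (\<Sum>j. ennreal (c j) * indicator (J j) s) \<partial>lborel)"
    by (simp add: J_def nn_integral_suminf nn_integral_cmult_indicator)
  also have "\<dots> \<le> I"
    unfolding I_def by (rule nn_integral_mono) (rule le)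
  finally have "ennreal (1 / 2) * (\<Sum>j. ennreal ((2 powr (real j * \<alpha>) * \<kappa> ((1 / 2) ^ Suc j)) powr p)) \<le> I"
    by (simp only: c_eq ennreal_suminf_cmult)
  then have "2 * (ennreal (1 / 2) * (\<Sum>j. ennreal ((2 powr (real j * \<alpha>) * \<kappa> ((1 / 2) ^ Suc j)) powr p))) \<le> 2 * I"
    by (rule mult_left_mono) simp
  moreover have "2 * ennreal (1 / 2) = 1"
    using ennreal_mult'[of 2 "1 / 2"] by simp
  ultimately show ?thesis
    by (simp add: mult.assoc[symmetric])
qed

end

text \<open>For finite Y both terms are at most multiples of m^p with m = x + Y^(1/p), so taking
  roots gives a norm bound. The added 1 keeps the constant positive, so that the right side is
  infinite when \<open>Y\<close> is.\<close>

lemma root_enn_le: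
  assumes X: "X \<le> ennreal c * Y + ennreal (d * x powr p)" and "0 \<le> c" "0 \<le> d" "0 \<le> x" "1 \<le> p"
  shows "root_enn X p \<le> ennreal ((c + d + 1) powr (1 / p)) * (ennreal x + root_enn Y p)"
proof (cases "Y = \<infinity>")
  case True
  have "(c + d + 1) powr (1 / p) > 0" using assms by simp
  then show ?thesis
    using True by (simp add: root_enn_def ennreal_mult_top)
next
  case False
  then obtain y where y: "Y = ennreal y" "0 \<le> y" by (cases Y) auto
  have X': "X \<le> ennreal (c * y + d * x powr p)"
    using X assms y by (simp add: ennreal_mult'[symmetric] ennreal_plus[symmetric] del: ennreal_plus)
  then have "X \<noteq> \<infinity>" using neq_top_trans by (auto simp: top_unique)
  then obtain x' where x': "X = ennreal x'" "0 \<le> x'" by (cases X) auto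
  define m where "m = x + y powr (1 / p)"
  have m: "0 \<le> m" "x powr p \<le> m powr p" "y \<le> m powr p"
  proof -
    show "0 \<le> m" using assms by (simp add: m_def)
    show "x powr p \<le> m powr p" using assms by (intro powr_mono2) (auto simp: m_def)
    have "y = (y powr (1 / p)) powr p" using y assms by (simp add: powr_powr)
    also have "\<dots> \<le> m powr p" using assms by (intro powr_mono2) (auto simp: m_def)
    finally show "y \<le> m powr p" .
  qed
  have "0 \<le> c * y + d * x powr p" using y assms by simp
  then have "x' \<le> c * y + d * x powr p" using X' x'(1) by (simp only: ennreal_le_iff)
  also have "\<dots> \<le> c * m powr p + d * m powr p"
    using m assms by (intro add_mono mult_left_mono) auto
  also have "\<dots> \<le> (c + d + 1) * m powr p" by (simp add: distrib_right)
  finally have "x' powr (1 / p) \<le> ((c + d + 1) * m powr p) powr (1 / p)"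
    using x' assms by (intro powr_mono2) auto
  also have "\<dots> = (c + d + 1) powr (1 / p) * m"
    using assms m by (simp add: powr_mult powr_powr)
  finally have "ennreal (x' powr (1 / p)) \<le> ennreal ((c + d + 1) powr (1 / p) * (x + y powr (1 / p)))"
    by (simp add: m_def ennreal_leI)
  then show ?thesis
    using x' y assms by (simp add: root_enn_def ennreal_mult' ennreal_plus)
qed

subsection \<open>The K-functional\<close>

context axb_rep
begin

lemma in_Hr_zero: "in_Hr T r 0"
  by (rule words_bound_imp_Hr(1)[OF words_bound_zero[of 0]]) simp

lemma Hr_norm_zero: "Hr_norm T r 0 = 0"
  using words_bound_imp_Hr(2)[OF words_bound_zero[of 0], of r] Hr_norm_nonneg[of T r 0] by simp

lemma K_fun_le:
  assumes "in_Hr T r f1" "0 \<le> t"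
  shows "K_fun T r t (f0 + f1) \<le> norm f0 + t * Hr_norm T r f1"
  unfolding K_fun_def
proof (rule cInf_lower)
  show "bdd_below {norm g0 + t * Hr_norm T r g1 |g0 g1. in_Hr T r g1 \<and> f0 + f1 = g0 + g1}"
    using assms(2) by (intro bdd_belowI[of _ 0]) (auto simp: Hr_norm_nonneg)
qed (use assms(1) in blast)

lemma K_fun_ge:
  assumes "\<And>f0 f1. in_Hr T r f1 \<Longrightarrow> f = f0 + f1 \<Longrightarrow> x \<le> norm f0 + t * Hr_norm T r f1"
  shows "x \<le> K_fun T r t f"
  unfolding K_fun_def
proof (rule cInf_greatest)
  have "f = f + 0" by simp
  then show "{norm f0 + t * Hr_norm T r f1 |f0 f1. in_Hr T r f1 \<and> f = f0 + f1} \<noteq> {}"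
    using in_Hr_zero by blast
qed (use assms in blast)

lemma K_fun_nonneg: "0 \<le> t \<Longrightarrow> 0 \<le> K_fun T r t f"
  by (rule K_fun_ge) (simp add: Hr_norm_nonneg)

lemma K_fun_le_norm: "0 \<le> t \<Longrightarrow> K_fun T r t f \<le> norm f"
  using K_fun_le[OF in_Hr_zero, of t r f] by (simp add: Hr_norm_zero)

lemma K_fun_mono:
  assumes "0 \<le> s" "s \<le> t"
  shows "K_fun T r s f \<le> K_fun T r t f"
proof (rule K_fun_ge)
  fix f0 f1 assume "in_Hr T r f1" "f = f0 + f1"
  then have "K_fun T r s f \<le> norm f0 + s * Hr_norm T r f1"
    using K_fun_le assms(1) by blast
  also have "\<dots> \<le> norm f0 + t * Hr_norm T r f1"
    using assms(2) by (simp add: mult_right_mono Hr_norm_nonneg)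
  finally show "K_fun T r s f \<le> norm f0 + t * Hr_norm T r f1" .
qed

end

section \<open>Dyadic comparison of the K-functional with best approximation\<close>

context axb_laplacian
begin

lemma best_approx_le_norm: "best_approx E \<sigma> f \<le> norm f"
  unfolding best_approx_eq(2) by (rule norm_E_le) simp

lemma best_approx_nonneg: "0 \<le> best_approx E \<sigma> f"
  unfolding best_approx_eq(2) by simp

text \<open>In any splitting the tail projection contracts \<open>f0\<close>, while Jackson at
  \<sigma> = 1 / s gains the factor s^r on \<open>f1\<close>.\<close>

lemma best_approx_le_K_fun:
  assumes "0 < s"
  shows "best_approx E (1 / s) f \<le> 2 ^ r * K_fun T r (s ^ r) f"
proof -
  have "best_approx E (1 / s) f / 2 ^ r \<le> K_fun T r (s ^ r) f"
  proof (rule K_fun_ge)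
    fix f0 f1 assume f1: "in_Hr T r f1" and f: "f = f0 + f1"
    have B: "{(1 / s)\<^sup>2<..} \<in> sets borel" by simp
    have "(1 / s) ^ r * norm (E {(1 / s)\<^sup>2<..} f1) \<le> 2 ^ r * Hr_norm T r f1"
      using assms by (intro jackson words_bound_Hr_norm f1) auto
    then have 1: "norm (E {(1 / s)\<^sup>2<..} f1) \<le> 2 ^ r * (s ^ r * Hr_norm T r f1)"
      using assms by (simp add: field_simps)
    have "best_approx E (1 / s) f \<le> norm (E {(1 / s)\<^sup>2<..} f0) + norm (E {(1 / s)\<^sup>2<..} f1)"
      unfolding best_approx_eq(2) f E_add[OF B] by (rule norm_triangle_ineq)
    also have "\<dots> \<le> norm f0 + 2 ^ r * (s ^ r * Hr_norm T r f1)"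
      by (intro add_mono norm_E_le B 1)
    also have "\<dots> \<le> 2 ^ r * norm f0 + 2 ^ r * (s ^ r * Hr_norm T r f1)"
      using mult_right_mono[of 1 "2 ^ r" "norm f0"] by simp
    finally show "best_approx E (1 / s) f / 2 ^ r \<le> norm f0 + s ^ r * Hr_norm T r f1"
      by (simp add: field_simps)
  qed
  then show ?thesis by (simp add: field_simps)
qed

text \<open>Telescoping over dyadic blocks: the part of \<open>f\<close> between frequencies 2^i and
  2^(i+1) has norm at most the error at 2^i and lies in the range for 2^(i+1), so Bernstein costs
  (2^(i+1))^r on it. Using Bernstein on the whole projection at once would lose the decay of the
  errors.\<close>

lemma words_bound_projection:
  assumes c: "1 \<le> c" and bern: "\<And>\<sigma> u. 1 \<le> \<sigma> \<Longrightarrow> E {0..\<sigma>\<^sup>2} u = u \<Longrightarrow> words_bound T r u (c * \<sigma> ^ r * norm u)"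
  shows "words_bound T r (E {0..(2 ^ j)\<^sup>2} f)
    (c * (norm f + (\<Sum>i<j. (2 ^ Suc i) ^ r * best_approx E (2 ^ i) f)))"
proof (induction j)
  case 0
  have "words_bound T r (E {0..1\<^sup>2} f) (c * 1 ^ r * norm (E {0..1\<^sup>2} f))"
    by (rule bern) (simp_all add: E_idem)
  moreover have "c * 1 ^ r * norm (E {0..1\<^sup>2} f) \<le> c * norm f"
    using c norm_E_le[of "{0..1\<^sup>2}" f] by (simp add: mult_left_mono)
  ultimately show ?case by (simp add: words_bound_mono)
next
  case (Suc j)
  define S where "S k = {0..((2::real) ^ k)\<^sup>2}" for k
  have S: "S k \<in> sets borel" for k by (simp add: S_def)
  have "S (Suc j) \<inter> S j = S j"
    using power_increasing[of j "Suc j" "2 :: real"] by (auto simp: S_def power_mono order_trans[OF _ power_mono])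
  define d where "d = E (S (Suc j)) (f - E (S j) f)"
  have d: "E (S (Suc j)) f = E (S j) f + d"
    by (simp add: d_def E_diff S E_E \<open>S (Suc j) \<inter> S j = S j\<close>)
  have "norm d \<le> best_approx E (2 ^ j) f"
    unfolding d_def best_approx_eq(1) S_def[of j, symmetric] by (rule norm_E_le[OF S])
  have "words_bound T r d (c * (2 ^ Suc j) ^ r * norm d)"
    by (rule bern) (simp_all only: d_def S_def[symmetric] E_idem[OF S] one_le_power one_le_numeral)
  then have "words_bound T r d (c * ((2 ^ Suc j) ^ r * best_approx E (2 ^ j) f))"
    by (rule words_bound_mono) (use c \<open>norm d \<le> _\<close> in \<open>simp add: mult.assoc mult_left_mono\<close>)
  from words_bound_add[OF Suc this]
  show ?case
    unfolding S_def[symmetric] d by (simp add: algebra_simps)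
qed

text \<open>Take the projection to frequency 2^j as \<open>f1\<close>. The norm of the remainder is
  the error at 2^j, which becomes the summand i = j after multiplying and dividing by
  (2^j)^r.\<close>

lemma K_fun_le_best_approx:
  "\<exists>C\<ge>1. \<forall>f j. K_fun T r (((1 / 2) ^ j) ^ r) f \<le>
     C * (((1 / 2) ^ j) ^ r * (norm f + (\<Sum>i\<le>j. (2 ^ i) ^ r * best_approx E (2 ^ i) f)))"
proof -
  obtain c where c: "1 \<le> c" and bern: "\<forall>\<sigma>\<ge>1. \<forall>u. E {0..\<sigma>\<^sup>2} u = u \<longrightarrow> words_bound T r u (c * \<sigma> ^ r * norm u)"
    using bernstein[of r] by (elim exE conjE)
  \<comment> \<open>\<open>num_words r\<close> passes from \<open>words_bound\<close> to
    \<open>Hr_norm\<close>, \<open>c\<close> is the Bernstein constant, and 2^r comes from the upper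
    ends 2^(i+1) of the blocks.\<close>
  define C where "C = num_words r * c * 2 ^ r"
  have nc: "1 \<le> num_words r * c"
    using mult_mono[OF num_words_ge_1[of r] c] num_words_ge_1[of r] by simp
  have C: "1 \<le> C"
    unfolding C_def using mult_mono[OF nc, of 1 "2 ^ r"] nc by simp
  have "K_fun T r (((1 / 2) ^ j) ^ r) f \<le>
     C * (((1 / 2) ^ j) ^ r * (norm f + (\<Sum>i\<le>j. (2 ^ i) ^ r * best_approx E (2 ^ i) f)))" for f j
  proof -
    define t :: real where "t = ((1 / 2) ^ j) ^ r"
    define e where "e i = best_approx E (2 ^ i) f" for i
    have e: "0 \<le> e i" for i by (simp add: e_def best_approx_nonneg)
    define P where "P = E {0..(2 ^ j)\<^sup>2} f"
    have t: "0 \<le> t" "t * (2 ^ j) ^ r = 1"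
      by (simp_all add: t_def power_one_over power_mult_distrib[symmetric])
    have wb: "words_bound T r P (c * (norm f + (\<Sum>i<j. (2 ^ Suc i) ^ r * e i)))"
      unfolding P_def e_def using bern by (intro words_bound_projection c) auto
    have "K_fun T r t ((f - P) + P) \<le> norm (f - P) + t * Hr_norm T r P"
      by (rule K_fun_le[OF words_bound_imp_Hr(1)[OF wb] t(1)])
    also have "norm (f - P) = t * ((2 ^ j) ^ r * e j)"
      using t(2) by (simp add: P_def e_def best_approx_eq(1) mult.assoc[symmetric])
    also have "t * Hr_norm T r P \<le> t * (num_words r * (c * (norm f + (\<Sum>i<j. (2 ^ Suc i) ^ r * e i))))"
      by (intro mult_left_mono words_bound_imp_Hr(2)[OF wb] t)
    also have "(\<Sum>i<j. (2 ^ Suc i) ^ r * e i) = 2 ^ r * (\<Sum>i<j. (2 ^ i) ^ r * e i)"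
      by (simp add: sum_distrib_left power_mult_distrib mult_ac)
    also have "num_words r * (c * (norm f + 2 ^ r * (\<Sum>i<j. (2 ^ i) ^ r * e i))) \<le>
        C * (norm f + (\<Sum>i<j. (2 ^ i) ^ r * e i))"
    proof -
      have "norm f \<le> 2 ^ r * norm f" using mult_right_mono[of 1 "2 ^ r" "norm f"] by simp
      then have "norm f + 2 ^ r * (\<Sum>i<j. (2 ^ i) ^ r * e i) \<le> 2 ^ r * (norm f + (\<Sum>i<j. (2 ^ i) ^ r * e i))"
        by (simp add: distrib_left)
      from mult_left_mono[OF this, of "num_words r * c"] nc show ?thesis
        by (simp add: C_def mult.assoc)
    qed
    then have "t * (num_words r * (c * (norm f + 2 ^ r * (\<Sum>i<j. (2 ^ i) ^ r * e i)))) \<le>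
        t * (C * (norm f + (\<Sum>i<j. (2 ^ i) ^ r * e i)))"
      by (rule mult_left_mono) (rule t)
    also have "t * ((2 ^ j) ^ r * e j) \<le> t * (C * ((2 ^ j) ^ r * e j))"
      using mult_right_mono[OF C, of "(2 ^ j) ^ r * e j"] e t by (intro mult_left_mono) auto
    finally have "K_fun T r t f \<le> t * (C * ((2 ^ j) ^ r * e j)) + t * (C * (norm f + (\<Sum>i<j. (2 ^ i) ^ r * e i)))"
      by simp
    also have "\<dots> = C * (t * (norm f + (\<Sum>i\<le>j. (2 ^ i) ^ r * e i)))"
      by (simp add: lessThan_Suc_atMost[symmetric] algebra_simps)
    finally show ?thesis by (simp add: t_def e_def)
  qed
  then show ?thesis using C by blast
qed

end

subsection \<open>Equivalence of the norms\<close>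

lemma ennreal_add_left_bound:
  fixes X Y n :: ennreal
  assumes "X \<le> ennreal C * (n + Y)" "0 \<le> C"
  shows "n + X \<le> ennreal (C + 1) * (n + Y)"
proof -
  have "n + X \<le> (n + Y) + ennreal C * (n + Y)"
    using assms(1) by (intro add_mono) auto
  also have "\<dots> = ennreal (C + 1) * (n + Y)"
    using assms(2) by (simp add: distrib_right add.commute)
  finally show ?thesis .
qed

context axb_laplacian
begin

context
  fixes \<alpha> :: real and r :: nat
  assumes \<alpha>: "0 < \<alpha>" "\<alpha> < real r"
begin

abbreviation \<kappa> :: "'h \<Rightarrow> real \<Rightarrow> real" where "\<kappa> f s \<equiv> K_fun T r (s ^ r) f"
abbreviation err :: "'h \<Rightarrow> nat \<Rightarrow> real" where "err f j \<equiv> best_approx E (2 ^ j) f"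
abbreviation werr :: "'h \<Rightarrow> nat \<Rightarrow> real" where "werr f j \<equiv> 2 powr (real j * \<alpha>) * err f j"
abbreviation \<theta> :: real where "\<theta> \<equiv> 2 powr (\<alpha> - real r)"

text \<open>Entry 0 majorizes |f| plus the error at \<sigma> = 1; that error is at most |f|, whence
  the 2.\<close>

definition werr' :: "'h \<Rightarrow> nat \<Rightarrow> real" where
  "werr' f j = (if j = 0 then 2 * norm f else werr f j)"

text \<open>Unfolded, the sum of \<theta>^(j-i) \<open>werr' f i\<close> over i \<le> j: a majorant
  of 2^(j (\<alpha> - r)) times |f| plus the sum of the 2^(i r) \<open>err f i\<close>, in the
  recursive form that \<open>discrete_hardy\<close> expects.\<close>

definition hardy_sum :: "'h \<Rightarrow> nat \<Rightarrow> real" where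
  "hardy_sum f = rec_nat (werr' f 0) (\<lambda>j x. \<theta> * x + werr' f (Suc j))"

lemma hardy_sum_simps: "hardy_sum f 0 = werr' f 0" "hardy_sum f (Suc j) = \<theta> * hardy_sum f j + werr' f (Suc j)"
  by (simp_all add: hardy_sum_def)

lemma werr'_nonneg: "0 \<le> werr' f j"
  by (simp add: werr'_def best_approx_nonneg)

lemma theta: "0 < \<theta>" "\<theta> < 1"
proof -
  have "\<theta> < 2 powr 0" using \<alpha> by (intro powr_less_mono) auto
  then show "\<theta> < 1" by simp
qed simp

lemma K_fun_dyadic_le:
  "\<exists>C\<ge>1. \<forall>f j. 2 powr (real j * \<alpha>) * \<kappa> f ((1 / 2) ^ j) \<le> C * hardy_sum f j"
proof -
  obtain C where C: "1 \<le> C" and K: "\<And>f j. \<kappa> f ((1 / 2) ^ j) \<le>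
     C * (((1 / 2) ^ j) ^ r * (norm f + (\<Sum>i\<le>j. (2 ^ i) ^ r * err f i)))"
    using K_fun_le_best_approx[of r] by blast
  have z: "2 powr (real j * \<alpha>) * (((1 / 2) ^ j) ^ r * (norm f + (\<Sum>i\<le>j. (2 ^ i) ^ r * err f i))) \<le> hardy_sum f j" for f j
  proof (induction j)
    case 0
    then show ?case using best_approx_le_norm[of 1 f] by (simp add: hardy_sum_simps werr'_def)
  next
    case (Suc j)
    \<comment> \<open>\<open>\<rho> j\<close> equals \<theta>^j. Passing to j + 1 therefore
      multiplies the old expression by \<theta> and adds one weighted error, as in the recursion of
      \<open>hardy_sum\<close>.\<close>
    define \<rho> where "\<rho> j = 2 powr (real j * \<alpha>) * ((1 / 2) ^ j) ^ r" for j
    have \<theta>: "\<theta> = 2 powr \<alpha> * (1 / 2) ^ r"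
      by (simp add: powr_diff powr_realpow power_one_over)
    have "\<rho> (Suc j) = \<theta> * \<rho> j"
      by (simp add: \<rho>_def \<theta> powr_add distrib_right power_mult_distrib power_divide)
    moreover have "\<rho> (Suc j) * ((2 ^ Suc j) ^ r * err f (Suc j)) = werr' f (Suc j)"
    proof -
      have one: "((1 / 2 :: real) ^ Suc j) ^ r * (2 ^ Suc j) ^ r = 1"
        by (simp only: power_mult_distrib[symmetric]) simp
      have "\<rho> (Suc j) * ((2 ^ Suc j) ^ r * err f (Suc j)) =
          werr f (Suc j) * (((1 / 2) ^ Suc j) ^ r * (2 ^ Suc j) ^ r)"
        by (simp only: \<rho>_def mult_ac)
      then show ?thesis by (simp only: one) (simp add: werr'_def)
    qed
    ultimately have "\<rho> (Suc j) * (norm f + (\<Sum>i\<le>Suc j. (2 ^ i) ^ r * err f i)) =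
        \<theta> * (\<rho> j * (norm f + (\<Sum>i\<le>j. (2 ^ i) ^ r * err f i))) + werr' f (Suc j)"
      by (simp add: algebra_simps)
    also have "\<dots> \<le> \<theta> * hardy_sum f j + werr' f (Suc j)"
      using Suc theta by (intro add_right_mono mult_left_mono) (simp_all add: \<rho>_def mult.assoc)
    finally show ?case by (simp add: \<rho>_def hardy_sum_simps mult.assoc)
  qed
  have "2 powr (real j * \<alpha>) * \<kappa> f ((1 / 2) ^ j) \<le> C * hardy_sum f j" for f j
  proof -
    have "2 powr (real j * \<alpha>) * \<kappa> f ((1 / 2) ^ j) \<le>
        C * (2 powr (real j * \<alpha>) * (((1 / 2) ^ j) ^ r * (norm f + (\<Sum>i\<le>j. (2 ^ i) ^ r * err f i))))"
      using mult_left_mono[OF K[where f = f and j = j], of "2 powr (real j * \<alpha>)"] by (simp add: mult_ac)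
    also have "\<dots> \<le> C * hardy_sum f j"
      using z C by (intro mult_left_mono) auto
    finally show ?thesis .
  qed
  then show ?thesis using C by blast
qed

lemma err_le_K_fun: "err f j \<le> 2 ^ r * \<kappa> f ((1 / 2) ^ j)"
  using best_approx_le_K_fun[of "(1 / 2) ^ j" f r] by (simp add: power_one_over)

lemma dyadic_integral_K_fun:
  assumes "1 \<le> p"
  shows "dyadic_integral (\<kappa> f) (norm f) \<alpha> p"
  by standard (use assms \<alpha> in \<open>auto intro!: K_fun_mono K_fun_nonneg K_fun_le_norm power_mono\<close>)

section \<open>The two comparisons for finite exponents\<close>

lemma besov_le_approx_finite:
  assumes p: "1 \<le> p"
  shows "\<exists>C\<ge>0. \<forall>f. root_enn (dyadic_integral.I (\<kappa> f) \<alpha> p) p \<le>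
    ennreal C * (ennreal (norm f) + root_enn (\<Sum>j. ennreal (werr f j powr p)) p)"
proof -
  obtain C where C: "1 \<le> C" and az: "\<And>f j. 2 powr (real j * \<alpha>) * \<kappa> f ((1 / 2) ^ j) \<le> C * hardy_sum f j"
    using K_fun_dyadic_le by blast
  \<comment> \<open>\<open>k\<close> combines the constant of \<open>K_fun_dyadic_le\<close> with
    the Hardy constant, and 2^(\<alpha> p) comes from the dyadic upper bound. \<open>d\<close>
    collects the powers of |f|: 2^p from entry 0 of \<open>werr'\<close>, the fraction from s >
    1.\<close>
  define k where "k = C powr p * (1 - \<theta>) powr (- p)"
  define c where "c = 2 powr (\<alpha> * p) * k"
  define d where "d = c * 2 powr p + 1 / (1 - 2 powr (- (\<alpha> * p)))"
  have k: "0 \<le> k" by (simp add: k_def)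
  have c: "0 \<le> c" using k by (simp add: c_def)
  have "2 powr (- (\<alpha> * p)) < (2 :: real) powr 0"
    using \<alpha> p by (intro powr_less_mono) auto
  then have geo: "0 \<le> 1 / (1 - 2 powr (- (\<alpha> * p)))" by simp
  have d: "0 \<le> d" using c geo by (simp add: d_def)
  have "root_enn (dyadic_integral.I (\<kappa> f) \<alpha> p) p \<le>
    ennreal ((c + d + 1) powr (1 / p)) * (ennreal (norm f) + root_enn (\<Sum>j. ennreal (werr f j powr p)) p)" for f
  proof (rule root_enn_le[OF _ c d norm_ge_zero p])
    define S where "S = (\<Sum>j. ennreal (werr f j powr p))"
    define a where "a j = 2 powr (real j * \<alpha>) * \<kappa> f ((1 / 2) ^ j)" for j
    have a0: "0 \<le> a j" for j by (simp add: a_def K_fun_nonneg)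
    have z0: "0 \<le> hardy_sum f j" for j
      by (induction j) (use theta in \<open>auto simp: hardy_sum_simps werr'_nonneg intro!: add_nonneg_nonneg mult_nonneg_nonneg\<close>)
    have "(\<Sum>j. ennreal (a j powr p)) \<le> ennreal k * (ennreal ((2 * norm f) powr p) + S)"
    proof (rule suminf_le_const[OF summableI])
      fix n
      have "(\<Sum>j<n. a j powr p) \<le> (\<Sum>j<n. C powr p * hardy_sum f j powr p)"
      proof (rule sum_mono)
        fix j
        have "a j powr p \<le> (C * hardy_sum f j) powr p"
          using az[where f = f and j = j] a0[of j] p by (intro powr_mono2) (auto simp: a_def)
        then show "a j powr p \<le> C powr p * hardy_sum f j powr p"
          using C z0[of j] by (simp add: powr_mult)
      qed
      also have "\<dots> = C powr p * (\<Sum>j<n. hardy_sum f j powr p)"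
        by (simp add: sum_distrib_left)
      also have "\<dots> \<le> C powr p * ((1 - \<theta>) powr (- p) * (\<Sum>j<n. werr' f j powr p))"
        by (intro mult_left_mono discrete_hardy theta p werr'_nonneg hardy_sum_simps) simp
      also have "\<dots> \<le> k * ((2 * norm f) powr p + (\<Sum>j<n. werr f j powr p))"
      proof -
        have "(\<Sum>j<n. werr' f j powr p) \<le> (2 * norm f) powr p + (\<Sum>j<n. werr f j powr p)"
        proof (induction n)
          case (Suc n)
          then show ?case
            by (cases n) (auto simp: werr'_def)
        qed simp
        from mult_left_mono[OF this k] show ?thesis by (simp add: k_def mult.assoc)
      qed
      finally have "ennreal (\<Sum>j<n. a j powr p) \<le> ennreal (k * ((2 * norm f) powr p + (\<Sum>j<n. werr f j powr p)))"
        by (rule ennreal_leI)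
      also have "\<dots> = ennreal k * (ennreal ((2 * norm f) powr p) + (\<Sum>j<n. ennreal (werr f j powr p)))"
        using k by (simp add: ennreal_mult' ennreal_plus sum_nonneg sum_ennreal)
      also have "(\<Sum>j<n. ennreal (werr f j powr p)) \<le> S"
        unfolding S_def by (rule sum_le_suminf) auto
      finally show "(\<Sum>j<n. ennreal (a j powr p)) \<le> ennreal k * (ennreal ((2 * norm f) powr p) + S)"
        by (simp add: sum_ennreal add_left_mono mult_left_mono)
    qed
    then have "ennreal (2 powr (\<alpha> * p)) * (\<Sum>j. ennreal (a j powr p)) \<le>
        ennreal (2 powr (\<alpha> * p)) * (ennreal k * (ennreal ((2 * norm f) powr p) + S))"
      by (rule mult_left_mono) simp
    also have "\<dots> = ennreal c * S + ennreal (c * 2 powr p * norm f powr p)"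
      using k by (simp add: c_def ennreal_mult' ennreal_mult'' powr_mult distrib_left mult_ac add.commute)
    finally have "ennreal (2 powr (\<alpha> * p)) * (\<Sum>j. ennreal (a j powr p)) \<le>
        ennreal c * S + ennreal (c * 2 powr p * norm f powr p)" .
    moreover have "dyadic_integral.I (\<kappa> f) \<alpha> p \<le> ennreal (2 powr (\<alpha> * p)) * (\<Sum>j. ennreal (a j powr p))
        + ennreal (1 / (1 - 2 powr (- (\<alpha> * p))) * norm f powr p)"
      unfolding a_def by (rule dyadic_integral.upper[OF dyadic_integral_K_fun[OF p]])
    ultimately have "dyadic_integral.I (\<kappa> f) \<alpha> p \<le>
        (ennreal c * S + ennreal (c * 2 powr p * norm f powr p)) + ennreal (1 / (1 - 2 powr (- (\<alpha> * p))) * norm f powr p)"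
      by (rule order_trans[OF _ add_right_mono, rotated])
    also have "\<dots> = ennreal c * S + ennreal (d * norm f powr p)"
      using c geo by (simp add: d_def distrib_right ennreal_plus add.assoc)
    finally show "dyadic_integral.I (\<kappa> f) \<alpha> p \<le> ennreal c * (\<Sum>j. ennreal (werr f j powr p)) + ennreal (d * norm f powr p)"
      by (simp add: S_def)
  qed
  moreover have "0 \<le> (c + d + 1) powr (1 / p)" by simp
  ultimately show ?thesis by blast
qed

lemma approx_le_besov_finite:
  assumes p: "1 \<le> p"
  shows "\<exists>C\<ge>0. \<forall>f. root_enn (\<Sum>j. ennreal (werr f j powr p)) p \<le>
    ennreal C * (ennreal (norm f) + root_enn (dyadic_integral.I (\<kappa> f) \<alpha> p) p)"
proof -
  \<comment> \<open>2^r is the Jackson constant; 2^\<alpha> comes from the shift between j and j +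
    1.\<close>
  define k where "k = (2 ^ r * 2 powr \<alpha>) powr p"
  have k: "0 \<le> k" by (simp add: k_def)
  have "root_enn (\<Sum>j. ennreal (werr f j powr p)) p \<le>
    ennreal ((2 * k + 1 + 1) powr (1 / p)) * (ennreal (norm f) + root_enn (dyadic_integral.I (\<kappa> f) \<alpha> p) p)" for f
  proof (rule root_enn_le[OF _ _ _ norm_ge_zero p])
    define S where "S = (\<Sum>j. ennreal ((2 powr (real j * \<alpha>) * \<kappa> f ((1 / 2) ^ Suc j)) powr p))"
    have step: "werr f (Suc j) powr p \<le> k * (2 powr (real j * \<alpha>) * \<kappa> f ((1 / 2) ^ Suc j)) powr p" for j
    proof -
      have "werr f (Suc j) \<le> 2 powr (real (Suc j) * \<alpha>) * (2 ^ r * \<kappa> f ((1 / 2) ^ Suc j))"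
        by (intro mult_left_mono err_le_K_fun) simp
      also have "\<dots> = (2 ^ r * 2 powr \<alpha>) * (2 powr (real j * \<alpha>) * \<kappa> f ((1 / 2) ^ Suc j))"
      proof -
        have "2 powr (real (Suc j) * \<alpha>) = 2 powr \<alpha> * 2 powr (real j * \<alpha>)"
          by (simp add: powr_add[symmetric] algebra_simps)
        then show ?thesis by (simp only: mult_ac)
      qed
      finally have "werr f (Suc j) \<le> (2 ^ r * 2 powr \<alpha>) * (2 powr (real j * \<alpha>) * \<kappa> f ((1 / 2) ^ Suc j))" .
      then have "werr f (Suc j) powr p \<le> ((2 ^ r * 2 powr \<alpha>) * (2 powr (real j * \<alpha>) * \<kappa> f ((1 / 2) ^ Suc j))) powr p"
        using p by (intro powr_mono2) (auto simp: best_approx_nonneg)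
      then show ?thesis
        by (subst (asm) powr_mult) (auto simp: k_def K_fun_nonneg)
    qed
    have "(\<Sum>j. ennreal (werr f j powr p)) \<le> ennreal (norm f powr p) + ennreal k * S"
    proof (rule suminf_le_const[OF summableI])
      fix n
      have "(\<Sum>j<n. ennreal (werr f j powr p)) \<le> (\<Sum>j<Suc n. ennreal (werr f j powr p))"
        by simp
      \<comment> \<open>The term j = 0 is split off and bounded by |f|, because the lower dyadic
        bound reaches \<open>\<kappa>\<close> only at (1/2)^j with j \<ge> 1.\<close>
      also have "\<dots> = ennreal (werr f 0 powr p) + (\<Sum>j<n. ennreal (werr f (Suc j) powr p))"
        by (rule sum.lessThan_Suc_shift)
      also have "\<dots> \<le> ennreal (norm f powr p) + ennreal k * S"
      proof (rule add_mono)
        show "ennreal (werr f 0 powr p) \<le> ennreal (norm f powr p)"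
          using best_approx_le_norm[of 1 f] best_approx_nonneg[of 1 f] p
          by (intro ennreal_leI powr_mono2) auto
        have "(\<Sum>j<n. ennreal (werr f (Suc j) powr p)) \<le>
            (\<Sum>j<n. ennreal k * ennreal ((2 powr (real j * \<alpha>) * \<kappa> f ((1 / 2) ^ Suc j)) powr p))"
          using step k by (intro sum_mono) (simp only: ennreal_mult'[symmetric] ennreal_leI)
        also have "\<dots> = ennreal k * (\<Sum>j<n. ennreal ((2 powr (real j * \<alpha>) * \<kappa> f ((1 / 2) ^ Suc j)) powr p))"
          by (rule sum_distrib_left[symmetric])
        also have "\<dots> \<le> ennreal k * S"
          unfolding S_def by (intro mult_left_mono sum_le_suminf) auto
        finally show "(\<Sum>j<n. ennreal (werr f (Suc j) powr p)) \<le> ennreal k * S" .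
      qed
      finally show "(\<Sum>j<n. ennreal (werr f j powr p)) \<le> ennreal (norm f powr p) + ennreal k * S" .
    qed
    also have "\<dots> \<le> ennreal (norm f powr p) + ennreal k * (2 * dyadic_integral.I (\<kappa> f) \<alpha> p)"
      unfolding S_def
      by (intro add_left_mono mult_left_mono dyadic_integral.lower[OF dyadic_integral_K_fun[OF p]]) simp
    also have "\<dots> = ennreal (2 * k) * dyadic_integral.I (\<kappa> f) \<alpha> p + ennreal (1 * norm f powr p)"
    proof -
      have "ennreal (2 * k) = 2 * ennreal k" by (simp add: ennreal_mult')
      then show ?thesis by (simp add: mult_ac add.commute)
    qed
    finally show "(\<Sum>j. ennreal (werr f j powr p)) \<le>
      ennreal (2 * k) * dyadic_integral.I (\<kappa> f) \<alpha> p + ennreal (1 * norm f powr p)" .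
  qed (use k in auto)
  moreover have "0 \<le> (2 * k + 1 + 1) powr (1 / p)" by simp
  ultimately show ?thesis by blast
qed

section \<open>The two comparisons for the supremum norms\<close>

lemma besov_le_approx_sup:
  "\<exists>C\<ge>0. \<forall>f. (SUP s\<in>{0<..}. ennreal (s powr (- \<alpha>) * \<kappa> f s)) \<le>
    ennreal C * (ennreal (norm f) + (SUP j. ennreal (werr f j)))"
proof -
  obtain C where C: "1 \<le> C" and az: "\<And>f j. 2 powr (real j * \<alpha>) * \<kappa> f ((1 / 2) ^ j) \<le> C * hardy_sum f j"
    using K_fun_dyadic_le by blast
  \<comment> \<open>The summand 1 covers s > 1, where the K-functional is at most |f|. In the other,
    2^\<alpha> comes from replacing s by a dyadic point and 2 / (1 - \<theta>) from the bound on
    \<open>hardy_sum\<close> with \<open>M = 2 * (norm f + m)\<close>.\<close>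
  define k where "k = 1 + 2 powr \<alpha> * C * (2 / (1 - \<theta>))"
  have k: "1 \<le> k" using C theta by (simp add: k_def)
  have "(SUP s\<in>{0<..}. ennreal (s powr (- \<alpha>) * \<kappa> f s)) \<le>
    ennreal k * (ennreal (norm f) + (SUP j. ennreal (werr f j)))" (is "_ \<le> ennreal k * (_ + ?S)") for f
  proof (cases "?S = \<infinity>")
    case True
    show ?thesis unfolding True using k by (simp add: ennreal_mult_top)
  next
    case False
    then obtain m where m: "?S = ennreal m" "0 \<le> m" by (cases ?S) auto
    have bm: "werr f j \<le> m" for j
    proof -
      have "ennreal (werr f j) \<le> ?S" by (rule SUP_upper) simp
      then show ?thesis using m by (simp only: ennreal_le_iff)
    qed
    define M where "M = 2 * (norm f + m)"
    have werr'_le: "werr' f j \<le> M" for j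
    proof -
      have "m \<le> M" using m(2) by (simp add: M_def add_increasing)
      moreover have "2 * norm f \<le> M" using m(2) by (simp add: M_def)
      ultimately show ?thesis using order_trans[OF bm] by (simp add: werr'_def)
    qed
    \<comment> \<open>\<open>M / (1 - \<theta>)\<close> is the fixed point of x \<mapsto> \<theta> x
      + M; this geometric series replaces the Hardy inequality.\<close>
    have zM: "hardy_sum f j \<le> M / (1 - \<theta>)" for j
    proof (induction j)
      case 0
      have "M * (1 - \<theta>) \<le> M * 1"
        using theta m(2) by (intro mult_left_mono) (auto simp: M_def)
      then have "M \<le> M / (1 - \<theta>)" using theta by (simp add: pos_le_divide_eq)
      then show ?case using werr'_le[of 0] by (simp add: hardy_sum_simps)
    next
      case (Suc j)
      have "hardy_sum f (Suc j) \<le> \<theta> * (M / (1 - \<theta>)) + M"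
        unfolding hardy_sum_simps using Suc werr'_le theta by (intro add_mono mult_left_mono) auto
      also have "\<dots> = M / (1 - \<theta>)"       proof -
        have "t * (M / (1 - t)) + M = M / (1 - t)" if "t < 1" for t
          using that by (simp add: field_simps)
        then show ?thesis using theta(2) by blast
      qed
      finally show ?case .
    qed
    have k_eq: "2 powr \<alpha> * (C * (M / (1 - \<theta>))) \<le> k * (norm f + m)"
    proof -
      have "2 powr \<alpha> * (C * (M / (1 - \<theta>))) = (2 powr \<alpha> * C * (2 / (1 - \<theta>))) * (norm f + m)"
        by (simp add: M_def)
      also have "\<dots> \<le> k * (norm f + m)"
        using m(2) by (intro mult_right_mono) (auto simp: k_def)
      finally show ?thesis .
    qed
    have "s powr (- \<alpha>) * \<kappa> f s \<le> k * (norm f + m)" if s: "0 < s" for s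
    proof (cases "s \<le> 1")
      case True
      then obtain j where j: "(1 / 2) ^ Suc j < s" "s \<le> (1 / 2) ^ j"
        using ex_dyadic_interval_unit s by blast
      have "s powr (- \<alpha>) \<le> ((1 / 2) ^ Suc j) powr (- \<alpha>)"
        using j \<alpha> by (intro powr_mono2') auto
      also have "\<dots> = 2 powr \<alpha> * 2 powr (real j * \<alpha>)"
        by (simp only: half_power_eq_powr powr_powr powr_add[symmetric]) (simp add: algebra_simps)
      finally have "s powr (- \<alpha>) * \<kappa> f s \<le> (2 powr \<alpha> * 2 powr (real j * \<alpha>)) * \<kappa> f ((1 / 2) ^ j)"
        using j s by (intro mult_mono K_fun_mono power_mono K_fun_nonneg) auto
      also have "\<dots> = 2 powr \<alpha> * (2 powr (real j * \<alpha>) * \<kappa> f ((1 / 2) ^ j))"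
        by (simp add: mult.assoc)
      also have "\<dots> \<le> 2 powr \<alpha> * (C * hardy_sum f j)"
        by (intro mult_left_mono az) simp
      also have "\<dots> \<le> 2 powr \<alpha> * (C * (M / (1 - \<theta>)))"
        using C by (intro mult_left_mono zM) auto
      also note k_eq
      finally show ?thesis .
    next
      case False
      then have "s powr (- \<alpha>) \<le> 1 powr (- \<alpha>)"
        using \<alpha> by (intro powr_mono2') auto
      then have "s powr (- \<alpha>) * \<kappa> f s \<le> 1 * norm f"
        using s by (intro mult_mono K_fun_le_norm K_fun_nonneg) auto
      also have "\<dots> \<le> k * (norm f + m)"
        using k m(2) by (intro mult_mono) auto
      finally show ?thesis .
    qed
    then have "(SUP s\<in>{0<..}. ennreal (s powr (- \<alpha>) * \<kappa> f s)) \<le> ennreal (k * (norm f + m))"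
      by (intro SUP_least ennreal_leI) auto
    also have "\<dots> = ennreal k * (ennreal (norm f) + ?S)"
      using k m by (simp add: ennreal_mult' ennreal_plus)
    finally show ?thesis .
  qed
  then show ?thesis using k by (intro exI[of _ k]) auto
qed

lemma approx_le_besov_sup:
  "(SUP j. ennreal (werr f j)) \<le> ennreal (2 ^ r) * (ennreal (norm f) + (SUP s\<in>{0<..}. ennreal (s powr (- \<alpha>) * \<kappa> f s)))"
proof (rule SUP_least)
  fix j :: nat
  have "werr f j \<le> 2 powr (real j * \<alpha>) * (2 ^ r * \<kappa> f ((1 / 2) ^ j))"
    by (intro mult_left_mono err_le_K_fun) simp
  also have "\<dots> = 2 ^ r * (((1 / 2) ^ j) powr (- \<alpha>) * \<kappa> f ((1 / 2) ^ j))"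
    by (simp only: half_power_eq_powr powr_powr) simp
  finally have "ennreal (werr f j) \<le> ennreal (2 ^ r * (((1 / 2) ^ j) powr (- \<alpha>) * \<kappa> f ((1 / 2) ^ j)))"
    by (rule ennreal_leI)
  also have "\<dots> = ennreal (2 ^ r) * ennreal (((1 / 2) ^ j) powr (- \<alpha>) * \<kappa> f ((1 / 2) ^ j))"
    by (rule ennreal_mult') simp
  also have "\<dots> \<le> ennreal (2 ^ r) * (SUP s\<in>{0<..}. ennreal (s powr (- \<alpha>) * \<kappa> f s))"
    by (intro mult_left_mono SUP_upper) auto
  also have "\<dots> \<le> ennreal (2 ^ r) * (ennreal (norm f) + (SUP s\<in>{0<..}. ennreal (s powr (- \<alpha>) * \<kappa> f s)))"
    by (intro mult_left_mono) auto
  finally show "ennreal (werr f j) \<le>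
      ennreal (2 ^ r) * (ennreal (norm f) + (SUP s\<in>{0<..}. ennreal (s powr (- \<alpha>) * \<kappa> f s)))" .
qed

lemma equivalent_from_seminorms:
  assumes "\<exists>C\<ge>0. \<forall>f :: 'h. X f \<le> ennreal C * (ennreal (norm f) + Y f)"
    and "\<exists>C\<ge>0. \<forall>f. Y f \<le> ennreal C * (ennreal (norm f) + X f)"
  shows "\<exists>C>0. \<forall>f. ennreal (norm f) + X f \<le> ennreal C * (ennreal (norm f) + Y f) \<and>
    ennreal (norm f) + Y f \<le> ennreal C * (ennreal (norm f) + X f)"
proof -
  obtain C1 C2 where C: "0 \<le> C1" "0 \<le> C2"
    "\<And>f. X f \<le> ennreal C1 * (ennreal (norm f) + Y f)" "\<And>f. Y f \<le> ennreal C2 * (ennreal (norm f) + X f)"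
    using assms by blast
  have up: "ennreal (C1 + 1) * u \<le> ennreal (C1 + C2 + 1) * u" "ennreal (C2 + 1) * u \<le> ennreal (C1 + C2 + 1) * u" for u
    using C by (auto intro!: mult_right_mono ennreal_leI simp del: ennreal_plus)
  show ?thesis
    using C order_trans[OF ennreal_add_left_bound[OF C(3,1)] up(1)]
      order_trans[OF ennreal_add_left_bound[OF C(4,2)] up(2)]
    by (intro exI[of _ "C1 + C2 + 1"]) auto
qed

lemma besov_equivalent_approx:
  assumes q: "1 \<le> q"
  shows "\<exists>C>0. \<forall>f. besov_norm T r \<alpha> q f \<le> ennreal C * approx_norm E \<alpha> q f \<and>
    approx_norm E \<alpha> q f \<le> ennreal C * besov_norm T r \<alpha> q f"
proof (cases "q = \<infinity>")
  case True
  have "\<exists>C\<ge>0. \<forall>f. (SUP j. ennreal (werr f j)) \<le>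
      ennreal C * (ennreal (norm f) + (SUP s\<in>{0<..}. ennreal (s powr (- \<alpha>) * \<kappa> f s)))"
    using approx_le_besov_sup by (intro exI[of _ "2 ^ r"]) auto
  from equivalent_from_seminorms[OF besov_le_approx_sup this] show ?thesis
    by (simp add: besov_norm_def approx_norm_def True)
next
  case False
  then have "1 \<le> enn2real q"
    using q enn2real_mono[of 1 q] by (simp add: top.not_eq_extremum)
  note p = this
  have I: "dyadic_integral.I (\<kappa> f) \<alpha> (enn2real q) =
      (\<integral>\<^sup>+ s. indicator {0<..} s * ennreal ((s powr (-\<alpha>) * K_fun T r (s ^ r) f) powr enn2real q / s) \<partial>lborel)" for f
    by (rule dyadic_integral.I_def[OF dyadic_integral_K_fun[OF p]])
  from equivalent_from_seminorms[OF besov_le_approx_finite[OF p] approx_le_besov_finite[OF p]] show ?thesis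
    using False by (simp add: besov_norm_def approx_norm_def I)
qed

end

end

theorem mainTheorem12:
  fixes T :: "real \<times> real \<Rightarrow> 'h::{real_inner,complete_space} \<Rightarrow> 'h"
    and E :: "real set \<Rightarrow> 'h \<Rightarrow> 'h"
    and \<alpha> :: real and q :: ennreal and r :: nat
  assumes "unitary_rep T"
    and "is_pvm E"
    and "pvm_op_graph E = closure (lap_graph T)"
    and "\<alpha> > 0" and "1 \<le> q" and "real r > \<alpha>"
  shows "\<exists>C>0. \<forall>f::'h. besov_norm T r \<alpha> q f \<le> ennreal C * approx_norm E \<alpha> q f \<and>
                       approx_norm E \<alpha> q f \<le> ennreal C * besov_norm T r \<alpha> q f"
proof -
  interpret axb_laplacian T E
    by standard (fact assms(1-3))+
  show ?thesis
    using assms(4-6) by (intro besov_equivalent_approx) auto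
qed

end
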